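(* Let $N\ge 2$, let $\Omega\subset\mathbb{R}^N$ be a bounded domain with $C^{1,1}$-boundary, $p>1$, $s\in(0,1)$, and let $K:\mathbb{R}^N\times\mathbb{R}^N\to\mathbb{R}$ be measurable and such that, for some constants $0<C_1\le C_2$ and for a.e. $x,y\in\mathbb{R}^N$, $K(x,y)=K(y,x)$ and $C_1\le K(x,y)|x-y|^{N+ps}\le C_2$. Let $g_0\in L^\infty(\Omega)$ with $g_0\ge 0$ a.e. and $g_0\ne 0$, let $\mathcal{G}$ be the rearrangement class of $g_0$, $\overline{\mathcal{G}}$ its weak* closure in $L^\infty(\Omega)$, and for $g\in\overline{\mathcal{G}}$ let $\lambda(g)$ be the principal eigenvalue $$\lambda(g)=\inf_{u\in W^{s,p}_0(\Omega)\setminus\{0\}}\frac{[u]_K^p}{\int_\Omega g|u|^p\,dx},$$ with $u_g$ the associated normalized positive eigenfunction. Then: (i) there exists $\hat g\in\mathcal{G}$ such that $\lambda(\hat g)\le\lambda(g)$ for all $g\in\mathcal{G}$; (ii) for every $\hat g\in\mathcal{G}$ with the property in (i) and every $g\in\overline{\mathcal{G}}\setminus\mathcal{G}$, one has $\lambda(\hat g)<\lambda(g)$; (iii) for every $\hat g\in\mathcal{G}$ with the property in (i) there exists a nondecreasing map $\eta:\mathbb{R}\to\mathbb{R}$ such that $\hat g=\eta\circ u_{\hat g}$ a.e. in $\Omega$.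
   Context: Rearrangement class: $\mathcal{G}$ is the set of all $g\in L^\infty(\Omega)$, $g\ge 0$ a.e., such that $|\{x\in\Omega: g(x)>t\}|=|\{x\in\Omega: g_0(x)>t\}|$ for all $t\ge 0$, where $|\cdot|$ is Lebesgue measure. $\overline{\mathcal{G}}$ is the closure of $\mathcal{G}$ in $L^\infty(\Omega)=L^1(\Omega)^*$ for the weak* topology; it is known to be convex and sequentially weakly* compact. Function space: $W^{s,p}_0(\Omega)=\{u\in L^p(\mathbb{R}^N): \iint_{\mathbb{R}^N\times\mathbb{R}^N}\frac{|u(x)-u(y)|^p}{|x-y|^{N+ps}}\,dx\,dy<\infty,\ u=0 \text{ a.e. in } \mathbb{R}^N\setminus\Omega\}$, and $[u]_K=\big(\iint_{\mathbb{R}^N\times\mathbb{R}^N}|u(x)-u(y)|^pK(x,y)\,dx\,dy\big)^{1/p}$ (a norm on $W^{s,p}_0(\Omega)$ equivalent to the Gagliardo norm). In the quotient defining $\lambda(g)$, the value is $+\infty$ when the denominator vanishes. Eigenvalue problem: for $u,\varphi\in W^{s,p}_0(\Omega)$ let $\langle\mathcal{L}_K u,\varphi\rangle=\iint_{\mathbb{R}^N\times\mathbb{R}^N}|u(x)-u(y)|^{p-2}(u(x)-u(y))(\varphi(x)-\varphi(y))K(x,y)\,dx\,dy$. A $\lambda$-eigenfunction with weight $g$ is $u\in W^{s,p}_0(\Omega)\setminus\{0\}$ with $\langle\mathcal{L}_K u,\varphi\rangle=\lambda\int_\Omega g|u|^{p-2}u\varphi\,dx$ for all $\varphi\in W^{s,p}_0(\Omega)$.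 It is known that $\lambda(g)>0$ is the smallest positive eigenvalue, that it is simple, that its eigenfunctions have constant sign and are exactly the minimizers of the quotient, and that there is a unique $\lambda(g)$-eigenfunction $u_g\in W^{s,p}_0(\Omega)$ with $u_g>0$ in $\Omega$ and $\int_\Omega g u_g^p\,dx=1$; thus $[u_g]_K^p=\lambda(g)$. *)

theory Defs
  imports "HOL-Analysis.Analysis"
begin

text \<open>
  Elements of the spaces \<open>L\<^sup>p(\<Omega>)\<close> and \<open>L\<^sup>p(\<real>\<^sup>N)\<close> are represented by Lebesgue measurable functions
  \<open>'a \<Rightarrow> real\<close> (representatives, not equivalence classes). All notions below are invariant under
  changing a function on a null set; members of \<open>Linf \<Omega>\<close> and \<open>L1 \<Omega>\<close> are unconstrained outside \<open>\<Omega>\<close>.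
\<close>

text \<open>
  \<open>C\<^sup>1\<^sup>,\<^sup>1\<close> boundary: near each boundary point, in suitable orthonormal coordinates whose last axis has
  direction \<open>\<nu>\<close>, the set is the strict epigraph of a \<open>C\<^sup>1\<^sup>,\<^sup>1\<close> function \<open>\<gamma>\<close> of the remaining \<open>N - 1\<close>
  coordinates. Functions on the hyperplane orthogonal to \<open>\<nu>\<close> are represented by functions on the
  whole space which are only evaluated at the orthogonal projection \<open>x - (x \<bullet> \<nu>) *\<^sub>R \<nu>\<close>.
\<close>

definition C11_boundary :: "'a::euclidean_space set \<Rightarrow> bool" where
  "C11_boundary \<Omega> \<longleftrightarrow>
     (\<forall>x0 \<in> frontier \<Omega>. \<exists>r > 0. \<exists>\<nu>. \<exists>\<gamma> :: 'a \<Rightarrow> real. \<exists>G L.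
        norm \<nu> = 1 \<and> (\<forall>y. GDERIV \<gamma> y :> G y) \<and> L-lipschitz_on UNIV G \<and>
        (\<forall>x \<in> ball x0 r. x \<in> \<Omega> \<longleftrightarrow> x \<bullet> \<nu> > \<gamma> (x - (x \<bullet> \<nu>) *\<^sub>R \<nu>)))"

definition L1 :: "'a::euclidean_space set \<Rightarrow> ('a \<Rightarrow> real) set" where
  "L1 \<Omega> = {\<phi>. integrable (lebesgue_on \<Omega>) \<phi>}"

definition Linf :: "'a::euclidean_space set \<Rightarrow> ('a \<Rightarrow> real) set" where
  "Linf \<Omega> = {g \<in> borel_measurable (lebesgue_on \<Omega>). \<exists>B. AE x in lebesgue_on \<Omega>. \<bar>g x\<bar> \<le> B}"

text \<open>
  The weak* topology on \<open>L\<^sup>\<infinity>(\<Omega>) = L\<^sup>1(\<Omega>)\<^sup>*\<close>: the initial topology for the pairings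
  \<open>g \<mapsto> \<integral>\<^sub>\<Omega> g \<phi> dx\<close> with \<open>\<phi> \<in> L\<^sup>1(\<Omega>)\<close>.
\<close>

definition weak_star_topology :: "'a::euclidean_space set \<Rightarrow> ('a \<Rightarrow> real) topology" where
  "weak_star_topology \<Omega> =
     pullback_topology (Linf \<Omega>)
       (\<lambda>g. \<lambda>\<phi>\<in>L1 \<Omega>. \<integral>x. g x * \<phi> x \<partial>lebesgue_on \<Omega>)
       (product_topology (\<lambda>_. euclideanreal) (L1 \<Omega>))"

definition rearrangement_class :: "'a::euclidean_space set \<Rightarrow> ('a \<Rightarrow> real) \<Rightarrow> ('a \<Rightarrow> real) set" where
  "rearrangement_class \<Omega> g0 =
     {g \<in> Linf \<Omega>. (AE x in lebesgue_on \<Omega>. g x \<ge> 0) \<and>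
        (\<forall>t\<ge>0. emeasure lebesgue {x \<in> \<Omega>. g x > t} = emeasure lebesgue {x \<in> \<Omega>. g0 x > t})}"

definition rearrangement_closure :: "'a::euclidean_space set \<Rightarrow> ('a \<Rightarrow> real) \<Rightarrow> ('a \<Rightarrow> real) set" where
  "rearrangement_closure \<Omega> g0 = weak_star_topology \<Omega> closure_of rearrangement_class \<Omega> g0"

text \<open>
  On the diagonal \<open>x = y\<close> (a null set) the quotient has the value \<open>0 / 0 = 0\<close>.
\<close>

definition W0 :: "real \<Rightarrow> real \<Rightarrow> 'a::euclidean_space set \<Rightarrow> ('a \<Rightarrow> real) set" where
  "W0 s p \<Omega> =
     {u \<in> borel_measurable lebesgue.
        integrable lebesgue (\<lambda>x. \<bar>u x\<bar> powr p) \<and>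
        (\<integral>\<^sup>+ (x, y). ennreal (\<bar>u x - u y\<bar> powr p / norm (x - y) powr (real DIM('a) + p * s))
           \<partial>lebesgue) < \<infinity> \<and>
        (AE x in lebesgue. x \<notin> \<Omega> \<longrightarrow> u x = 0)}"

definition W0_nonzero :: "real \<Rightarrow> real \<Rightarrow> 'a::euclidean_space set \<Rightarrow> ('a \<Rightarrow> real) set" where
  "W0_nonzero s p \<Omega> = {u \<in> W0 s p \<Omega>. \<not> (AE x in lebesgue. u x = 0)}"

definition K_norm :: "real \<Rightarrow> ('a::euclidean_space \<Rightarrow> 'a \<Rightarrow> real) \<Rightarrow> ('a \<Rightarrow> real) \<Rightarrow> real" where
  "K_norm p K u = (\<integral>(x, y). \<bar>u x - u y\<bar> powr p * K x y \<partial>lebesgue) powr (1 / p)"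

definition principal_eigenvalue ::
  "real \<Rightarrow> real \<Rightarrow> 'a::euclidean_space set \<Rightarrow> ('a \<Rightarrow> 'a \<Rightarrow> real) \<Rightarrow> ('a \<Rightarrow> real) \<Rightarrow> ereal" where
  "principal_eigenvalue s p \<Omega> K g =
     (INF u \<in> W0_nonzero s p \<Omega>.
        let d = (\<integral>x. g x * \<bar>u x\<bar> powr p \<partial>lebesgue_on \<Omega>)
        in if d = 0 then \<infinity> else ereal (K_norm p K u powr p / d))"

text \<open>
  Since \<open>0 powr a = 0\<close> for every \<open>a\<close>, the expression \<open>\<bar>t\<bar> powr (p - 2) * t\<close> is \<open>0\<close> at \<open>t = 0\<close>, as
  required also for \<open>p < 2\<close>.
\<close>

definition L_K ::
  "real \<Rightarrow> ('a::euclidean_space \<Rightarrow> 'a \<Rightarrow> real) \<Rightarrow> ('a \<Rightarrow> real) \<Rightarrow> ('a \<Rightarrow> real) \<Rightarrow> real" where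
  "L_K p K u \<phi> =
     (\<integral>(x, y). \<bar>u x - u y\<bar> powr (p - 2) * (u x - u y) * (\<phi> x - \<phi> y) * K x y \<partial>lebesgue)"

definition eigenfunction ::
  "real \<Rightarrow> real \<Rightarrow> 'a::euclidean_space set \<Rightarrow> ('a \<Rightarrow> 'a \<Rightarrow> real) \<Rightarrow> ('a \<Rightarrow> real) \<Rightarrow> real
     \<Rightarrow> ('a \<Rightarrow> real) \<Rightarrow> bool" where
  "eigenfunction s p \<Omega> K g \<mu> u \<longleftrightarrow>
     u \<in> W0_nonzero s p \<Omega> \<and>
     (\<forall>\<phi> \<in> W0 s p \<Omega>.
        L_K p K u \<phi> = \<mu> * (\<integral>x. g x * (\<bar>u x\<bar> powr (p - 2) * u x) * \<phi> x \<partial>lebesgue_on \<Omega>))"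

text \<open>
  The defining property of the function \<open>u\<^sub>g\<close>, which is unique up to null sets.
\<close>

definition normalized_principal_eigenfunction ::
  "real \<Rightarrow> real \<Rightarrow> 'a::euclidean_space set \<Rightarrow> ('a \<Rightarrow> 'a \<Rightarrow> real) \<Rightarrow> ('a \<Rightarrow> real)
     \<Rightarrow> ('a \<Rightarrow> real) \<Rightarrow> bool" where
  "normalized_principal_eigenfunction s p \<Omega> K g u \<longleftrightarrow>
     (\<exists>\<mu>. ereal \<mu> = principal_eigenvalue s p \<Omega> K g \<and> eigenfunction s p \<Omega> K g \<mu> u) \<and>
     (AE x in lebesgue_on \<Omega>. u x > 0) \<and>
     (\<integral>x. g x * u x powr p \<partial>lebesgue_on \<Omega>) = 1"

end

theory Submission
  imports Defs "HOL-Complex_Analysis.Great_Picard"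
begin

text \<open>
  Write \<open>E(u) = [u]\<^sub>K\<^sup>p\<close> and let \<open>m\<close> be the supremum of \<open>\<integral> g |u|\<^sup>p\<close> over all \<open>g\<close> in the rearrangement class and
  all \<open>u\<close> with \<open>E(u) \<le> 1\<close>, so that \<open>\<integral> g |v|\<^sup>p \<le> m E(v)\<close> on the class and, since \<open>|v|\<^sup>p\<close> is an admissible
  test function for the weak* topology, on its closure; hence \<open>\<lambda>(g) \<ge> 1 / m\<close> there.
  Compactness of the embedding of \<open>W\<^sub>0\<close> into \<open>L\<^sup>p\<close> and the bathtub principle (for fixed \<open>u\<close> some \<open>h\<close> in the
  class itself maximizes \<open>\<integral> g |u|\<^sup>p\<close>) show that \<open>m\<close> is attained, which is (i).
  If a weight \<open>g\<close> in the closure has \<open>\<lambda>(g) = 1 / m\<close> with minimizer \<open>u > 0\<close>, then the bathtub maximizer \<open>h\<close>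
  for \<open>u\<close> also has \<open>u\<close> as minimizer, and comparing the two Euler-Lagrange equations gives \<open>g u\<^sup>p\<^sup>-\<^sup>1 = h u\<^sup>p\<^sup>-\<^sup>1\<close>,
  so \<open>g = h\<close> lies in the class; this is (ii). By the same argument an optimal \<open>g\<close> is the only
  maximizer of \<open>\<integral> g u\<^sup>p\<close> in the class. Interchanging the values of \<open>g\<close> on two translates of a small set
  yields another maximizer unless \<open>g\<close> and \<open>u\<close> are ordered alike, which is (iii).
\<close>

section \<open>Lebesgue measure on products\<close>

text \<open>Level sets of \<open>u\<close> may have positive measure, so the bathtub principle alone
  yields neither uniqueness of the maximizing weight nor dependence of the weight on
  \<open>u\<close>. Uniqueness comes from the equation instead: a weight in the class whose mass at
  \<open>u\<close> is at least that of an optimal weight again has \<open>u\<close> as extremal, the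
  energy sides of the two Euler-Lagrange equations coincide, and \<open>u > 0\<close> allows
  division by the power of \<open>u\<close>. Taking the supremum over weights and functions jointly
  avoids weak* limits of weights: for each \<open>v\<close> the maximum over the class is attained,
  and this maximum bounds the masses of a whole maximizing sequence of weights at the limit
  function. Compactness is therefore required of the functions only, and it is obtained from
  convergence of averages over dyadic cubes. Strict positivity of a minimizer for a weight in the
  closure is derived by comparison; for (iii) it is part of the normalization of the given
  eigenfunction.\<close>

lemma null_sets_vimage_fst:
  assumes "N \<in> null_sets (lborel :: 'a::euclidean_space measure)"
  shows "fst -` N \<in> null_sets (lborel :: ('a \<times> 'b::euclidean_space) measure)"
proof -
  have [measurable]: "N \<in> sets lborel" using assms by auto
  have "fst -` N = N \<times> (UNIV :: 'b set)" by auto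
  moreover have "emeasure (lborel \<Otimes>\<^sub>M lborel) (N \<times> (UNIV :: 'b set)) = 0"
    using assms by (subst lborel.emeasure_pair_measure_Times) (auto simp: null_sets_def)
  moreover have "N \<times> (UNIV :: 'b set) \<in> sets (lborel \<Otimes>\<^sub>M lborel)"
    using assms by (intro pair_measureI) auto
  ultimately show ?thesis unfolding lborel_prod by (auto simp: null_sets_def)
qed

lemma null_sets_vimage_snd:
  assumes "N \<in> null_sets (lborel :: 'b::euclidean_space measure)"
  shows "snd -` N \<in> null_sets (lborel :: ('a::euclidean_space \<times> 'b) measure)"
proof -
  have [measurable]: "N \<in> sets lborel" using assms by auto
  have "snd -` N = (UNIV :: 'a set) \<times> N" by auto
  moreover have "emeasure (lborel \<Otimes>\<^sub>M lborel) ((UNIV :: 'a set) \<times> N) = 0"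
    using assms by (subst lborel.emeasure_pair_measure_Times) (auto simp: null_sets_def)
  moreover have "(UNIV :: 'a set) \<times> N \<in> sets (lborel \<Otimes>\<^sub>M lborel)"
    using assms by (intro pair_measureI) auto
  ultimately show ?thesis unfolding lborel_prod by (auto simp: null_sets_def)
qed

text \<open>\<open>lebesgue\<close> on pairs is the completion of the Borel product measure, not the
  product of two copies of \<open>lebesgue\<close>. Measurability of a projection therefore amounts
  to Borel measurability together with pulling null sets back to null sets.\<close>

lemma measurable_lebesgue_fst [measurable]:
  "fst \<in> (lebesgue :: ('a::euclidean_space \<times> 'b::euclidean_space) measure) \<rightarrow>\<^sub>M lebesgue"
proof (rule completion.measurable_completion2)
  have "(fst :: 'a \<times> 'b \<Rightarrow> 'a) \<in> borel \<rightarrow>\<^sub>M borel"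
    by (intro borel_measurable_continuous_onI continuous_intros)
  then show f: "(fst :: 'a \<times> 'b \<Rightarrow> 'a) \<in> lebesgue \<rightarrow>\<^sub>M lborel"
    by (intro measurable_completion) simp
  show "null_sets lborel \<subseteq> null_sets (distr (lebesgue :: ('a \<times> 'b) measure) lborel fst)"
  proof
    fix N :: "'a set" assume N: "N \<in> null_sets lborel"
    show "N \<in> null_sets (distr (lebesgue :: ('a \<times> 'b) measure) lborel fst)"
      using null_sets_vimage_fst[OF N, where 'b='b] f N
      by (subst null_sets_distr_iff) (auto intro: null_sets_completionI)
  qed
qed

lemma measurable_lebesgue_snd [measurable]:
  "snd \<in> (lebesgue :: ('a::euclidean_space \<times> 'b::euclidean_space) measure) \<rightarrow>\<^sub>M lebesgue"
proof (rule completion.measurable_completion2)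
  have "(snd :: 'a \<times> 'b \<Rightarrow> 'b) \<in> borel \<rightarrow>\<^sub>M borel"
    by (intro borel_measurable_continuous_onI continuous_intros)
  then show f: "(snd :: 'a \<times> 'b \<Rightarrow> 'b) \<in> lebesgue \<rightarrow>\<^sub>M lborel"
    by (intro measurable_completion) simp
  show "null_sets lborel \<subseteq> null_sets (distr (lebesgue :: ('a \<times> 'b) measure) lborel snd)"
  proof
    fix N :: "'b set" assume N: "N \<in> null_sets lborel"
    show "N \<in> null_sets (distr (lebesgue :: ('a \<times> 'b) measure) lborel snd)"
      using null_sets_vimage_snd[OF N, where 'a='a] f N
      by (subst null_sets_distr_iff) (auto intro: null_sets_completionI)
  qed
qed

text \<open>With its twin for \<open>snd\<close>, this transfers an almost everywhere statement
  about \<open>u\<close> to double integrals in \<open>u (fst z)\<close> and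
  \<open>u (snd z)\<close>; it is how representatives are exchanged and pointwise limits are
  inserted.\<close>

lemma AE_lebesgue_fst:
  assumes "AE x in lebesgue. P (x::'a::euclidean_space)"
  shows "AE z in (lebesgue :: ('a \<times> 'b::euclidean_space) measure). P (fst z)"
proof -
  obtain N where "{x \<in> space lborel. \<not> P x} \<subseteq> N" "emeasure lborel N = 0" "N \<in> sets lborel"
    using assms[unfolded AE_completion_iff] by (rule AE_E)
  then have N: "N \<in> null_sets lborel" "{x. \<not> P x} \<subseteq> N"
    by (auto simp: null_sets_def)
  then show ?thesis unfolding AE_completion_iff
    by (intro AE_I'[OF null_sets_vimage_fst[OF N(1)]]) auto
qed

lemma AE_lebesgue_snd:
  assumes "AE x in lebesgue. P (x::'b::euclidean_space)"
  shows "AE z in (lebesgue :: ('a::euclidean_space \<times> 'b) measure). P (snd z)"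
proof -
  obtain N where "{x \<in> space lborel. \<not> P x} \<subseteq> N" "emeasure lborel N = 0" "N \<in> sets lborel"
    using assms[unfolded AE_completion_iff] by (rule AE_E)
  then have N: "N \<in> null_sets lborel" "{x. \<not> P x} \<subseteq> N"
    by (auto simp: null_sets_def)
  then show ?thesis unfolding AE_completion_iff
    by (intro AE_I'[OF null_sets_vimage_snd[OF N(1)]]) auto
qed

text \<open>Stated for Borel integrands, because sections of a Lebesgue measurable function on pairs
  may fail to be measurable. Arguments that integrate in one variable at a time first pass to Borel
  representatives.\<close>

lemma nn_integral_lebesgue_prod:
  assumes "f \<in> borel_measurable (borel :: ('a::euclidean_space \<times> 'b::euclidean_space) measure)"
  shows "(\<integral>\<^sup>+z. f z \<partial>lebesgue) = (\<integral>\<^sup>+x. \<integral>\<^sup>+y. f (x, y) \<partial>lborel \<partial>lborel)"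
proof -
  have "(\<integral>\<^sup>+z. f z \<partial>lebesgue) = (\<integral>\<^sup>+z. f z \<partial>(lborel \<Otimes>\<^sub>M lborel))"
    by (simp add: nn_integral_completion lborel_prod)
  also have "\<dots> = (\<integral>\<^sup>+x. \<integral>\<^sup>+y. f (x, y) \<partial>lborel \<partial>lborel)"
    using assms by (intro lborel.nn_integral_fst[symmetric]) (simp add: lborel_prod)
  finally show ?thesis .
qed

lemma nn_integral_lborel_diff:
  assumes [measurable]: "f \<in> borel_measurable (borel :: 'a::euclidean_space measure)"
  shows "(\<integral>\<^sup>+y. f (y - c) \<partial>lborel) = (\<integral>\<^sup>+y. f y \<partial>lborel)"
proof -
  have "(\<integral>\<^sup>+y. f y \<partial>lborel) = (\<integral>\<^sup>+y. f y \<partial>distr lborel borel ((+) (-c)))"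
    by (simp only: lborel_distr_plus)
  also have "\<dots> = (\<integral>\<^sup>+y. f (y - c) \<partial>lborel)"
    by (subst nn_integral_distr) auto
  finally show ?thesis ..
qed

section \<open>Integrability of powers of the norm near the origin and at infinity\<close>

lemma emeasure_lborel_cball_scale:
  fixes c :: "'a :: euclidean_space"
  assumes "r \<ge> 0"
  shows "emeasure lborel (cball c r) = ennreal (r ^ DIM('a) * measure lborel (cball (0::'a) 1))"
proof -
  have "negligible (cball c r - ball c r)" for c::'a and r
    using negligible_sphere[of c r] by (simp add: cball_diff_eq_sphere)
  then have "emeasure lebesgue (cball c r) = emeasure lebesgue (ball c r)" for c::'a and r
    by (intro emeasure_eq_AE) (auto simp: negligible_iff_null_sets intro!: AE_I'[of "cball c r - ball c r"])
  then have "emeasure lborel (cball c r) = ennreal (r ^ DIM('a)) * emeasure lborel (cball (0::'a) 1)"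
    using emeasure_lebesgue_ball_conv_unit_ball[OF assms, of c] by simp
  then show ?thesis
    using emeasure_lborel_cball_finite[of "0::'a" 1] assms
    by (subst (asm) emeasure_eq_ennreal_measure) (auto simp: ennreal_mult)
qed

text \<open>A substitute for polar coordinates: an integrand at most \<open>c j\<close> on the j-th
  dyadic shell is dominated by a sum over full balls. Replacing shells by balls costs only a
  constant factor in the geometric series to which this is applied.\<close>

lemma nn_integral_dyadic_bound:
  fixes f :: "'a::euclidean_space \<Rightarrow> ennreal"
  assumes bnd: "\<And>z. f z \<le> (\<Sum>j. ennreal (c j) * indicator (cball 0 (r j)) z)"
    and nn: "\<And>j. 0 \<le> c j" "\<And>j. 0 \<le> r j"
    and summ: "summable (\<lambda>j. c j * r j ^ DIM('a))"
  shows "(\<integral>\<^sup>+z. f z \<partial>lborel) < \<infinity>"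
proof -
  have "(\<integral>\<^sup>+z. f z \<partial>lborel) \<le> (\<integral>\<^sup>+z. (\<Sum>j. ennreal (c j) * indicator (cball 0 (r j)) (z::'a)) \<partial>lborel)"
    using bnd by (intro nn_integral_mono) auto
  also have "\<dots> = (\<Sum>j. \<integral>\<^sup>+z. ennreal (c j) * indicator (cball 0 (r j)) (z::'a) \<partial>lborel)"
    by (intro nn_integral_suminf borel_measurable_times_ennreal borel_measurable_const
        borel_measurable_indicator) auto
  also have "\<dots> = (\<Sum>j. ennreal (c j * r j ^ DIM('a) * measure lborel (cball (0::'a) 1)))"
    using nn by (auto intro!: suminf_cong simp: nn_integral_cmult_indicator emeasure_lborel_cball_scale
        ennreal_mult[symmetric] mult_ac)
  also have "\<dots> < \<infinity>"
    using nn summ by (subst suminf_ennreal2) (auto intro!: summable_mult2)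
  finally show ?thesis .
qed

lemma ennreal_le_suminf:
  fixes f :: "nat \<Rightarrow> ennreal"
  assumes "x \<le> f i"
  shows "x \<le> (\<Sum>j. f j)"
proof -
  have "f i \<le> sum f {..i}" by (intro member_le_sum) auto
  also have "\<dots> \<le> suminf f" by (intro sum_le_suminf) auto
  finally show ?thesis using assms by simp
qed

lemma dyadic_small:
  fixes t :: real
  assumes "0 < t" "t \<le> 1"
  obtains j :: nat where "(1/2)^(Suc j) < t" "t \<le> (1/2)^j"
proof -
  define j where "j = (LEAST j::nat. (1/2)^(Suc j) < t)"
  have "\<exists>n::nat. (1/2)^n < t" using real_arch_pow_inv[of t "1/2"] assms by auto
  then obtain n::nat where "(1/2)^n < t" by blast
  then have "(1/2)^(Suc n) < t" using \<open>0 < t\<close> by simp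
  then have 1: "(1/2)^(Suc j) < t" unfolding j_def by (rule LeastI)
  have 2: "t \<le> (1/2)^j"
  proof (cases j)
    case 0 then show ?thesis using assms by simp
  next
    case (Suc i)
    then have "\<not> (1/2)^(Suc i) < t" unfolding j_def using not_less_Least by (metis lessI)
    then show ?thesis using Suc by simp
  qed
  show ?thesis using that 1 2 by blast
qed

lemma dyadic_large:
  fixes t :: real
  assumes "1 \<le> t"
  obtains j :: nat where "2^j \<le> t" "t \<le> 2^(Suc j)"
proof -
  have "0 < 1/t" "1/t \<le> 1" using assms by auto
  then obtain j::nat where j: "(1/2)^(Suc j) < 1/t" "1/t \<le> (1/2)^j" by (rule dyadic_small)
  have "2^j \<le> t" using j(2) assms by (simp add: field_simps power_divide)
  moreover have "t \<le> 2^(Suc j)" using j(1) assms by (simp add: field_simps power_divide)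
  ultimately show ?thesis by (rule that)
qed

lemma power_powr_swap: "(b::real) > 0 \<Longrightarrow> (b ^ j) powr q = (b powr q) ^ j"
  by (induction j) (simp_all add: powr_mult)

text \<open>On the shell between radii \<open>(1/2)^(j+1)\<close> and \<open>(1/2)^j\<close> the
  integrand is of order \<open>(1/2)^(j*(a-N))\<close> and the volume of order
  \<open>(1/2)^(j*N)\<close>; the product decays geometrically with ratio
  \<open>(1/2) powr a\<close>.\<close>

lemma nn_integral_powr_near_zero:
  fixes a :: real
  assumes a: "a > 0"
  shows "(\<integral>\<^sup>+z. ennreal (norm z powr (a - DIM('a))) * indicator (cball 0 1) (z::'a::euclidean_space) \<partial>lborel) < \<infinity>"
proof -
  define N where "N = real DIM('a)"
  \<comment> \<open>The exponent \<open>a - N\<close> may have either sign, so the maximum over a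
    shell may sit at the inner or the outer radius; this factor covers both.\<close>
  define D where "D = 2 powr \<bar>a - N\<bar>"
  define c where "c j = D * ((1/2) powr (a - N)) ^ j" for j::nat
  have D: "D \<ge> 1" unfolding D_def by (simp add: ge_one_powr_ge_zero)
  have key: "norm z powr (a - N) \<le> c j" if "(1/2)^(Suc j) < norm z" "norm z \<le> (1/2)^j" for z::'a and j
  proof -
    have z: "norm z > 0" using that(1) by (smt (verit) zero_less_power zero_less_divide_1_iff)
    define w where "w = norm z * 2 ^ j"
    have w: "1/2 < w" "w \<le> 1" using that by (auto simp: w_def field_simps power_divide)
    have "w powr (a - N) \<le> D"
    proof (cases "a \<ge> N")
      case True
      then have "w powr (a - N) \<le> 1" using w by (simp add: powr_le1)
      then show ?thesis using D by simp
    next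
      case False
      have "w powr (a - N) \<le> (1/2) powr (a-N)"
        using w False by (intro powr_mono2') auto
      also have "\<dots> = D" using False by (simp add: D_def powr_divide powr_minus_divide powr_diff)
      finally show ?thesis .
    qed
    moreover have "norm z = w * (1/2)^j" by (simp add: w_def power_divide)
    ultimately show ?thesis using w
      by (simp add: powr_mult c_def power_powr_swap mult_right_mono)
  qed
  have "(\<integral>\<^sup>+z. ennreal (norm z powr (a - N)) * indicator (cball 0 1) (z::'a) \<partial>lborel) < \<infinity>"
  proof (rule nn_integral_dyadic_bound[where c=c and r="\<lambda>j. (1/2)^j"])
    fix z::'a
    show "ennreal (norm z powr (a - N)) * indicator (cball 0 1) z
          \<le> (\<Sum>j. ennreal (c j) * indicator (cball 0 ((1/2)^j)) z)"
    proof (cases "z = 0 \<or> norm z > 1")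
      case True then show ?thesis by auto
    next
      case False
      then obtain j where "(1/2)^(Suc j) < norm z" "norm z \<le> (1/2)^j"
        using dyadic_small[of "norm z"] by auto
      then show ?thesis using key[of j z] False
        by (intro ennreal_le_suminf[of _ _ j]) (auto simp: ennreal_leI)
    qed
  next
    have "c j * ((1/2)^j) ^ DIM('a) = D * ((1/2) powr a)^j" for j
    proof -
      have "((1/2)^j) ^ DIM('a) = ((1/2::real) powr N)^j"
        by (simp add: N_def powr_realpow power_mult[symmetric] mult.commute)
      then show ?thesis by (simp add: c_def power_mult_distrib[symmetric] powr_add[symmetric])
    qed
    moreover have "(1/2::real) powr a < 1" using a powr_less_mono[of "-a" 0 2]
      by (simp add: powr_divide powr_minus_divide)
    ultimately show "summable (\<lambda>j. c j * ((1/2)^j) ^ DIM('a))"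
      by (simp add: summable_geometric)
  qed (auto simp: c_def D_def)
  then show ?thesis by (simp add: N_def)
qed

text \<open>The exponent is negative, so the inner radius \<open>2^j\<close> of a shell bounds the
  integrand; multiplied by the volume the terms are of order \<open>2 powr (-b*j)\<close>.\<close>

lemma nn_integral_powr_at_infinity:
  fixes b :: real
  assumes b: "b > 0"
  shows "(\<integral>\<^sup>+z. ennreal (norm z powr - (DIM('a) + b)) * indicator (- cball 0 1) (z::'a::euclidean_space) \<partial>lborel) < \<infinity>"
proof -
  define N where "N = real DIM('a)"
  define c where "c j = (2 powr (-(N+b))) ^ j" for j::nat
  have N0: "N > 0" by (simp add: N_def)
  have "(\<integral>\<^sup>+z. ennreal (norm z powr -(N + b)) * indicator (- cball 0 1) (z::'a) \<partial>lborel) < \<infinity>"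
  proof (rule nn_integral_dyadic_bound[where c=c and r="\<lambda>j. 2^(Suc j)"])
    fix z::'a
    show "ennreal (norm z powr -(N+b)) * indicator (- cball 0 1) z
          \<le> (\<Sum>j. ennreal (c j) * indicator (cball 0 (2^(Suc j))) z)"
    proof (cases "norm z \<le> 1")
      case True then show ?thesis by auto
    next
      case False
      then obtain j where j: "2^j \<le> norm z" "norm z \<le> 2^(Suc j)"
        using dyadic_large[of "norm z"] by auto
      have "norm z powr -(N+b) \<le> (2^j) powr -(N+b)"
        using j N0 b by (intro powr_mono2') auto
      then have "norm z powr -(N+b) \<le> c j" by (simp add: c_def power_powr_swap)
      then show ?thesis using j False
        by (intro ennreal_le_suminf[of _ _ j]) (auto simp: ennreal_leI)
    qed
  next
    have "c j * (2^(Suc j)) ^ DIM('a) = 2 powr N * (2 powr -b)^j" for j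
    proof -
      have "(2^(Suc j)) ^ DIM('a) = (2::real)^DIM('a) * (2^DIM('a))^j"
        by (simp add: power_mult[symmetric] power_mult_distrib mult.commute)
      also have "\<dots> = 2 powr N * (2 powr N)^j" by (simp add: N_def powr_realpow)
      finally have "c j * (2^(Suc j)) ^ DIM('a) = 2 powr N * (2 powr (-(N+b)) * 2 powr N)^j"
        unfolding c_def by (simp only: power_mult_distrib mult_ac)
      also have "2 powr (-(N+b)) * 2 powr N = 2 powr -b" by (simp flip: powr_add)
      finally show ?thesis .
    qed
    moreover have "2 powr -b < (1::real)" using b powr_less_mono[of "-b" 0 2] by simp
    ultimately show "summable (\<lambda>j. c j * (2^(Suc j)) ^ DIM('a))"
      by (simp add: summable_geometric)
  qed (auto simp: c_def)
  then show ?thesis by (simp add: N_def)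
qed

section \<open>The fractional Sobolev space\<close>

lemma powr_add_le:
  fixes a b p :: real
  assumes "0 \<le> a" "0 \<le> b" "0 \<le> p"
  shows "(a + b) powr p \<le> 2 powr p * (a powr p + b powr p)"
proof -
  have "(a + b) powr p \<le> (2 * max a b) powr p" using assms by (intro powr_mono2) auto
  also have "\<dots> = 2 powr p * max a b powr p" using assms by (simp add: powr_mult)
  also have "max a b powr p \<le> a powr p + b powr p" by (simp add: max_def)
  finally show ?thesis by simp
qed

text \<open>Kept in \<open>ennreal\<close>, so that finiteness is a property of the value and
  Tonelli and Fatou apply without prior integrability.\<close>

definition gagliardo :: "real \<Rightarrow> real \<Rightarrow> ('a::euclidean_space \<Rightarrow> real) \<Rightarrow> ennreal" where
  "gagliardo s p u = (\<integral>\<^sup>+z. ennreal (\<bar>u (fst z) - u (snd z)\<bar> powr p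
      / norm (fst z - snd z) powr (real DIM('a) + p * s)) \<partial>lebesgue)"

lemma borel_measurable_lebesgue_diff_powr:
  fixes u :: "'a::euclidean_space \<Rightarrow> real"
  assumes [measurable]: "u \<in> borel_measurable lebesgue"
  shows "(\<lambda>z. \<bar>u (fst z) - u (snd z)\<bar> powr p) \<in> borel_measurable lebesgue"
  by measurable

lemma borel_measurable_norm_diff_powr:
  "(\<lambda>z::'a::euclidean_space\<times>'a. norm (fst z - snd z) powr q) \<in> borel_measurable borel"
proof -
  have [measurable]: "(\<lambda>z::'a\<times>'a. norm (fst z - snd z)) \<in> borel_measurable borel"
    by (intro borel_measurable_continuous_onI continuous_intros)
  show ?thesis by measurable
qed

lemma borel_measurable_gagliardo:
  fixes u :: "'a::euclidean_space \<Rightarrow> real"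
  assumes "u \<in> borel_measurable lebesgue"
  shows "(\<lambda>z. \<bar>u (fst z) - u (snd z)\<bar> powr p / norm (fst z - snd z) powr q) \<in> borel_measurable lebesgue"
proof (rule borel_measurable_divide[OF borel_measurable_lebesgue_diff_powr[OF assms]])
  show "(\<lambda>z::'a\<times>'a. norm (fst z - snd z) powr q) \<in> borel_measurable lebesgue"
    by (intro measurable_completion) (simp add: borel_measurable_norm_diff_powr)
qed

lemma W0_iff:
  "u \<in> W0 s p \<Omega> \<longleftrightarrow> u \<in> borel_measurable lebesgue \<and> integrable lebesgue (\<lambda>x. \<bar>u x\<bar> powr p) \<and>
     gagliardo s p u < \<infinity> \<and> (AE x in lebesgue. x \<notin> \<Omega> \<longrightarrow> u x = 0)"
  by (simp add: W0_def gagliardo_def case_prod_beta')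

text \<open>One criterion behind all closure properties of the space: linear combinations, absolute
  values and maxima are dominated by the given functions both pointwise and in their
  differences.\<close>

lemma W0_dominated:
  fixes u v w :: "'a::euclidean_space \<Rightarrow> real"
  assumes u: "u \<in> W0 s p \<Omega>" and v: "v \<in> W0 s p \<Omega>" and p: "p > 0" and C: "C \<ge> 0"
    and w: "w \<in> borel_measurable lebesgue"
    and bnd: "\<And>x. \<bar>w x\<bar> \<le> C * (\<bar>u x\<bar> + \<bar>v x\<bar>)"
    and diff: "\<And>x y. \<bar>w x - w y\<bar> \<le> C * (\<bar>u x - u y\<bar> + \<bar>v x - v y\<bar>)"
  shows "w \<in> W0 s p \<Omega>"
proof -
  define B where "B = C powr p * 2 powr p"
  have B: "B \<ge> 0" by (simp add: B_def)
  have le: "\<bar>c\<bar> powr p \<le> B * (\<bar>a\<bar> powr p + \<bar>b\<bar> powr p)" if "\<bar>c\<bar> \<le> C * (\<bar>a\<bar> + \<bar>b\<bar>)" for a b c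
  proof -
    have "\<bar>c\<bar> powr p \<le> (C * (\<bar>a\<bar> + \<bar>b\<bar>)) powr p" using that p by (intro powr_mono2) auto
    also have "\<dots> = C powr p * (\<bar>a\<bar> + \<bar>b\<bar>) powr p" using C by (simp add: powr_mult)
    also have "\<dots> \<le> C powr p * (2 powr p * (\<bar>a\<bar> powr p + \<bar>b\<bar> powr p))"
      using p by (intro mult_left_mono powr_add_le) auto
    finally show ?thesis by (simp add: B_def)
  qed
  note um = u[unfolded W0_iff] and vm = v[unfolded W0_iff]
  have [measurable]: "u \<in> borel_measurable lebesgue" "v \<in> borel_measurable lebesgue"
    "w \<in> borel_measurable lebesgue" using um vm w by auto
  have "integrable lebesgue (\<lambda>x. \<bar>w x\<bar> powr p)"
  proof (rule Bochner_Integration.integrable_bound)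
    show "integrable lebesgue (\<lambda>x. B * (\<bar>u x\<bar> powr p + \<bar>v x\<bar> powr p))"
      using um vm by auto
    show "AE x in lebesgue. norm (\<bar>w x\<bar> powr p) \<le> norm (B * (\<bar>u x\<bar> powr p + \<bar>v x\<bar> powr p))"
      using le[OF bnd] B by auto
  qed measurable
  moreover have "gagliardo s p w < \<infinity>"
  proof -
    define q where "q = real DIM('a) + p * s"
    let ?g = "\<lambda>u z. \<bar>u (fst z) - u (snd z)\<bar> powr p / norm (fst z - snd z) powr q"
    have gm: "(\<lambda>z. ennreal (?g u z)) \<in> borel_measurable lebesgue"
      "(\<lambda>z. ennreal (?g v z)) \<in> borel_measurable lebesgue"
      using um vm by (auto intro!: measurable_compose[OF _ measurable_ennreal] borel_measurable_gagliardo)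
    have "gagliardo s p w \<le> (\<integral>\<^sup>+z. ennreal B * (ennreal (?g u z) + ennreal (?g v z)) \<partial>lebesgue)"
      unfolding gagliardo_def q_def[symmetric]
    proof (rule nn_integral_mono)
      fix z :: "'a \<times> 'a"
      have "?g w z \<le> B * (?g u z + ?g v z)"
        using divide_right_mono[OF le[OF diff[of "fst z" "snd z"]], of "norm (fst z - snd z) powr q"]
        by (simp add: add_divide_distrib[symmetric])
      then show "ennreal (?g w z) \<le> ennreal B * (ennreal (?g u z) + ennreal (?g v z))"
        using B by (simp add: ennreal_mult[symmetric] ennreal_leI flip: ennreal_plus)
    qed
    also have "\<dots> = ennreal B * (gagliardo s p u + gagliardo s p v)"
      unfolding gagliardo_def q_def[symmetric]
      using gm by (subst nn_integral_cmult) (auto simp: nn_integral_add)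
    also have "\<dots> < \<infinity>" using um vm by (auto simp: ennreal_mult_less_top)
    finally show ?thesis .
  qed
  moreover have "AE x in lebesgue. x \<notin> \<Omega> \<longrightarrow> w x = 0"
  proof -
    have "AE x in lebesgue. x \<notin> \<Omega> \<longrightarrow> u x = 0" "AE x in lebesgue. x \<notin> \<Omega> \<longrightarrow> v x = 0"
      using um vm by auto
    then show ?thesis
    proof eventually_elim
      case (elim x)
      then show ?case using bnd[of x] by auto
    qed
  qed
  ultimately show ?thesis using w by (simp add: W0_iff)
qed

lemma W0_measurable: "u \<in> W0 s p \<Omega> \<Longrightarrow> u \<in> borel_measurable lebesgue"
  by (simp add: W0_iff)

lemma W0_linear:
  assumes "u \<in> W0 s p \<Omega>" "v \<in> W0 s p \<Omega>" "p > 0"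
  shows "(\<lambda>x. a * u x + b * v x) \<in> W0 s p \<Omega>"
proof (rule W0_dominated[OF assms, of "\<bar>a\<bar> + \<bar>b\<bar>"])
  have le: "\<bar>a * c + b * d\<bar> \<le> (\<bar>a\<bar> + \<bar>b\<bar>) * (\<bar>c\<bar> + \<bar>d\<bar>)" for c d
  proof -
    have "\<bar>a * c + b * d\<bar> \<le> \<bar>a\<bar> * \<bar>c\<bar> + \<bar>b\<bar> * \<bar>d\<bar>"
      by (metis abs_mult abs_triangle_ineq)
    then show ?thesis using mult_nonneg_nonneg[of "\<bar>a\<bar>" "\<bar>d\<bar>"] mult_nonneg_nonneg[of "\<bar>b\<bar>" "\<bar>c\<bar>"]
      unfolding distrib_left distrib_right by linarith
  qed
  show "\<bar>a * u x + b * v x\<bar> \<le> (\<bar>a\<bar> + \<bar>b\<bar>) * (\<bar>u x\<bar> + \<bar>v x\<bar>)" for x by (rule le)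
  show "\<bar>a * u x + b * v x - (a * u y + b * v y)\<bar>
        \<le> (\<bar>a\<bar> + \<bar>b\<bar>) * (\<bar>u x - u y\<bar> + \<bar>v x - v y\<bar>)" for x y
    using le[of "u x - u y" "v x - v y"] by (simp add: algebra_simps)
  show "(\<lambda>x. a * u x + b * v x) \<in> borel_measurable lebesgue"
    using assms(1,2)[THEN W0_measurable] by measurable
qed auto

lemma W0_abs: "u \<in> W0 s p \<Omega> \<Longrightarrow> p > 0 \<Longrightarrow> (\<lambda>x. \<bar>u x\<bar>) \<in> W0 s p \<Omega>"
  by (rule W0_dominated[of u s p \<Omega> u 1])
    (auto dest: W0_measurable intro!: order_trans[OF abs_triangle_ineq3])

lemma W0_max: "u \<in> W0 s p \<Omega> \<Longrightarrow> v \<in> W0 s p \<Omega> \<Longrightarrow> p > 0 \<Longrightarrow> (\<lambda>x. max (u x) (v x)) \<in> W0 s p \<Omega>"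
  by (rule W0_dominated[of u s p \<Omega> v 1]) (auto intro!: borel_measurable_max dest: W0_measurable)

text \<open>The source of test functions. A pair contributes only if one of its points lies in
  \<open>\<Omega>\<close>, which has finite measure. For \<open>norm (x - y) \<le> 1\<close> the
  Lipschitz bound leaves the power \<open>p * (1 - s) - N\<close>, integrable near zero because
  \<open>s < 1\<close>; beyond that the bound \<open>\<phi> \<le> 1\<close> leaves
  \<open>-(N + p * s)\<close>, integrable at infinity because \<open>s > 0\<close>.\<close>

lemma W0_lipschitz:
  fixes \<Omega> :: "'a::euclidean_space set"
  assumes \<Omega>: "open \<Omega>" "bounded \<Omega>" and p: "p > 1" and s: "0 < s" "s < 1"
    and range: "\<And>x. 0 \<le> \<phi> x" "\<And>x. \<phi> x \<le> 1" and zero: "\<And>x. x \<notin> \<Omega> \<Longrightarrow> \<phi> x = 0"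
    and lip: "\<And>x y. \<bar>\<phi> x - \<phi> y\<bar> \<le> L * norm (x - y)" and L: "L \<ge> 0"
  shows "\<phi> \<in> W0 s p \<Omega>"
proof -
  have [measurable]: "\<Omega> \<in> sets borel" using \<Omega> by auto
  have fin: "emeasure lborel \<Omega> < \<infinity>" using \<Omega> emeasure_bounded_finite[of \<Omega>] by simp
  have "L-lipschitz_on UNIV \<phi>" using lip L by (auto intro!: lipschitz_onI simp: dist_norm)
  then have "continuous_on UNIV \<phi>" by (rule lipschitz_on_continuous_on)
  then have \<phi>b[measurable]: "\<phi> \<in> borel_measurable borel" by (rule borel_measurable_continuous_onI)
  then have \<phi>m: "\<phi> \<in> borel_measurable lebesgue" by (intro measurable_completion) simp
  have "integrable lebesgue (\<lambda>x. \<bar>\<phi> x\<bar> powr p)"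
  proof (rule Bochner_Integration.integrable_bound)
    show "integrable lebesgue (indicator \<Omega> :: 'a \<Rightarrow> real)" using fin by (simp add: integrable_indicator_iff)
    show "(\<lambda>x. \<bar>\<phi> x\<bar> powr p) \<in> borel_measurable lebesgue" using \<phi>m by measurable
    show "AE x in lebesgue. norm (\<bar>\<phi> x\<bar> powr p) \<le> norm (indicator \<Omega> x :: real)"
      using range zero p by (auto simp: indicator_def powr_le1)
  qed
  moreover have "gagliardo s p \<phi> < \<infinity>"
  proof -
    define N where "N = real DIM('a)"
    define q where "q = N + p * s"
    define k1 :: "'a \<Rightarrow> ennreal" where "k1 w = ennreal (norm w powr (p * (1 - s) - N)) * indicator (cball 0 1) w" for w
    define k2 :: "'a \<Rightarrow> ennreal" where "k2 w = ennreal (norm w powr -(N + p * s)) * indicator (- cball 0 1) w" for w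
    define k where "k w = ennreal (L powr p) * k1 w + k2 w" for w
    have [measurable]: "cball (0::'a) 1 \<in> sets borel" by auto
    have k1m[measurable]: "k1 \<in> borel_measurable borel" unfolding k1_def by measurable
    have k2m[measurable]: "k2 \<in> borel_measurable borel" unfolding k2_def by measurable
    have km[measurable]: "k \<in> borel_measurable borel" unfolding k_def by measurable
    have "(\<integral>\<^sup>+w. k1 w \<partial>lborel) < \<infinity>" "(\<integral>\<^sup>+w. k2 w \<partial>lborel) < \<infinity>"
      using nn_integral_powr_near_zero[of "p * (1-s)", where 'a='a] p s
        nn_integral_powr_at_infinity[of "p * s", where 'a='a] by (auto simp: k1_def k2_def N_def)
    then have kfin: "(\<integral>\<^sup>+w. k w \<partial>lborel) < \<infinity>"
      unfolding k_def by (subst nn_integral_add) (auto simp: nn_integral_cmult ennreal_mult_less_top)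
    have ksym: "k (- w) = k w" for w by (simp add: k_def k1_def k2_def indicator_def)
    have kfun[measurable]: "(\<lambda>z::'a\<times>'a. k (snd z - fst z)) \<in> borel_measurable borel"
    proof -
      have "(\<lambda>z::'a\<times>'a. snd z - fst z) \<in> borel \<rightarrow>\<^sub>M borel"
        by (intro borel_measurable_continuous_onI continuous_intros)
      from measurable_compose[OF this km] show ?thesis .
    qed
    have [measurable]: "(fst :: 'a \<times> 'a \<Rightarrow> 'a) \<in> borel \<rightarrow>\<^sub>M borel" "(snd :: 'a \<times> 'a \<Rightarrow> 'a) \<in> borel \<rightarrow>\<^sub>M borel"
      by (intro borel_measurable_continuous_onI continuous_intros)+
    have pt: "ennreal (\<bar>\<phi> (fst z) - \<phi> (snd z)\<bar> powr p / norm (fst z - snd z) powr q)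
        \<le> indicator \<Omega> (fst z) * k (snd z - fst z) + indicator \<Omega> (snd z) * k (snd z - fst z)" for z
    proof (cases "fst z = snd z \<or> (fst z \<notin> \<Omega> \<and> snd z \<notin> \<Omega>)")
      case True
      then show ?thesis using zero p by auto
    next
      case False
      define w where "w = snd z - fst z"
      have w: "norm w > 0" "norm (fst z - snd z) = norm w" using False by (auto simp: w_def norm_minus_commute)
      have "ennreal (\<bar>\<phi> (fst z) - \<phi> (snd z)\<bar> powr p / norm w powr q) \<le> k w"
      proof (cases "norm w \<le> 1")
        case True
        have "\<bar>\<phi> (fst z) - \<phi> (snd z)\<bar> powr p \<le> (L * norm w) powr p"
          using lip[of "fst z" "snd z"] w p by (intro powr_mono2) auto
        also have "\<dots> = L powr p * norm w powr p" using L by (simp add: powr_mult)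
        finally have "\<bar>\<phi> (fst z) - \<phi> (snd z)\<bar> powr p / norm w powr q \<le> L powr p * (norm w powr p / norm w powr q)"
          using w by (simp add: divide_right_mono)
        also have "norm w powr p / norm w powr q = norm w powr (p * (1 - s) - N)"
          by (simp add: powr_diff[symmetric] q_def algebra_simps)
        finally have "ennreal (\<bar>\<phi> (fst z) - \<phi> (snd z)\<bar> powr p / norm w powr q) \<le> ennreal (L powr p * norm w powr (p * (1 - s) - N))"
          by (rule ennreal_leI)
        also have "\<dots> = k w" using True by (simp add: k_def k1_def k2_def ennreal_mult)
        finally show ?thesis .
      next
        case False
        have "\<bar>\<phi> (fst z) - \<phi> (snd z)\<bar> \<le> 1"
          using range[of "fst z"] range[of "snd z"] by (simp add: abs_le_iff)
        then have "\<bar>\<phi> (fst z) - \<phi> (snd z)\<bar> powr p \<le> 1" using p by (simp add: powr_le1)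
        then have "\<bar>\<phi> (fst z) - \<phi> (snd z)\<bar> powr p / norm w powr q \<le> norm w powr -q"
          using w by (simp add: powr_minus_divide divide_right_mono)
        then show ?thesis using False by (simp add: k_def k1_def k2_def q_def ennreal_leI)
      qed
      moreover have "k w \<le> indicator \<Omega> (fst z) * k w + indicator \<Omega> (snd z) * k w"
        using False by (auto simp: indicator_def)
      ultimately show ?thesis using w by (simp add: w_def)
    qed
    have "gagliardo s p \<phi> \<le> (\<integral>\<^sup>+z. indicator \<Omega> (fst z) * k (snd z - fst z) + indicator \<Omega> (snd z) * k (snd z - fst z) \<partial>lebesgue)"
      unfolding gagliardo_def using pt by (intro nn_integral_mono) (auto simp: q_def N_def)
    also have "\<dots> = (\<integral>\<^sup>+z. indicator \<Omega> (fst z) * k (snd z - fst z) \<partial>lebesgue)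
        + (\<integral>\<^sup>+z. indicator \<Omega> (snd z) * k (snd z - fst z) \<partial>lebesgue)"
      unfolding nn_integral_completion by (rule nn_integral_add) measurable
    also have "(\<integral>\<^sup>+z. indicator \<Omega> (fst z) * k (snd z - fst z) \<partial>lebesgue)
      = (\<integral>\<^sup>+x. \<integral>\<^sup>+y. indicator \<Omega> x * k (y - x) \<partial>lborel \<partial>lborel)"
      by (subst nn_integral_lebesgue_prod) simp_all
    also have "\<dots> = (\<integral>\<^sup>+x. indicator \<Omega> x * (\<integral>\<^sup>+w. k w \<partial>lborel) \<partial>lborel)"
      by (intro nn_integral_cong) (simp add: nn_integral_cmult nn_integral_lborel_diff)
    also have "\<dots> = (\<integral>\<^sup>+w. k w \<partial>lborel) * emeasure lborel \<Omega>"
      by (subst nn_integral_multc) (auto simp: mult.commute)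
    also have "(\<integral>\<^sup>+z. indicator \<Omega> (snd z) * k (snd z - fst z) \<partial>lebesgue)
      = (\<integral>\<^sup>+x. \<integral>\<^sup>+y. indicator \<Omega> y * k (y - x) \<partial>lborel \<partial>lborel)"
      by (subst nn_integral_lebesgue_prod) simp_all
    also have "\<dots> = (\<integral>\<^sup>+y. \<integral>\<^sup>+x. indicator \<Omega> y * k (y - x) \<partial>lborel \<partial>lborel)"
    proof -
      have "(\<lambda>z::'a\<times>'a. indicator \<Omega> (snd z) * k (snd z - fst z)) \<in> borel_measurable (lborel \<Otimes>\<^sub>M lborel)"
        unfolding lborel_prod by simp
      from lborel_pair.Fubini[OF this] show ?thesis by simp
    qed
    also have "\<dots> = (\<integral>\<^sup>+y. indicator \<Omega> y * (\<integral>\<^sup>+w. k w \<partial>lborel) \<partial>lborel)"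
    proof (intro nn_integral_cong)
      fix y :: 'a
      have "(\<integral>\<^sup>+x. indicator \<Omega> y * k (y - x) \<partial>lborel) = (\<integral>\<^sup>+x. indicator \<Omega> y * k (x - y) \<partial>lborel)"
        using ksym by (intro nn_integral_cong) (metis minus_diff_eq)
      then show "(\<integral>\<^sup>+x. indicator \<Omega> y * k (y - x) \<partial>lborel) = indicator \<Omega> y * (\<integral>\<^sup>+w. k w \<partial>lborel)"
        by (simp add: nn_integral_cmult nn_integral_lborel_diff)
    qed
    also have "\<dots> = (\<integral>\<^sup>+w. k w \<partial>lborel) * emeasure lborel \<Omega>"
      by (subst nn_integral_multc) (auto simp: mult.commute)
    also have "(\<integral>\<^sup>+w. k w \<partial>lborel) * emeasure lborel \<Omega> + (\<integral>\<^sup>+w. k w \<partial>lborel) * emeasure lborel \<Omega> < \<infinity>"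
      using kfin fin by (auto simp: ennreal_mult_less_top)
    finally show ?thesis .
  qed
  ultimately show ?thesis using \<phi>m zero by (auto simp: W0_iff)
qed

text \<open>Compare each point of \<open>\<Omega>\<close> with all points of a ball \<open>A\<close>
  outside \<open>\<Omega>\<close>, where the function vanishes: then \<open>u x\<close> is itself a
  difference, and the singular weight is bounded below since all distances between the two sets are
  bounded.\<close>

lemma fractional_poincare:
  fixes \<Omega> :: "'a::euclidean_space set"
  assumes \<Omega>: "open \<Omega>" "bounded \<Omega>" and p: "p > 1" and s: "0 < s"
  obtains C where "C \<ge> 0"
    "\<And>u. u \<in> W0 s p \<Omega> \<Longrightarrow> (\<integral>\<^sup>+x. ennreal (\<bar>u x\<bar> powr p) \<partial>lebesgue) \<le> ennreal C * gagliardo s p u"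
proof -
  define q where "q = real DIM('a) + p * s"
  obtain R where R: "R > 0" "\<Omega> \<subseteq> ball 0 R" using \<Omega>(2) bounded_subset_ballD by blast
  obtain e :: 'a where e: "norm e = 1" using norm_Basis nonempty_Basis by blast
  \<comment> \<open>Points of this ball have norm greater than \<open>2 * R\<close>, so it misses
    \<open>\<Omega>\<close>; they have norm less than \<open>4 * R\<close>, which gives the distance
    bound \<open>5 * R\<close>.\<close>
  define A where "A = ball ((3 * R) *\<^sub>R e) R"
  have A[measurable]: "A \<in> sets borel" by (simp add: A_def)
  have disj: "y \<notin> \<Omega>" if "y \<in> A" for y
  proof
    assume "y \<in> \<Omega>"
    then have "norm y < R" using R by auto
    moreover have "norm ((3 * R) *\<^sub>R e - y) < R" using that by (simp add: A_def dist_norm)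
    moreover have "norm ((3 * R) *\<^sub>R e) = 3 * R" using e R by simp
    ultimately show False using norm_triangle_ineq2[of "(3 * R) *\<^sub>R e" y] R by linarith
  qed
  have dist: "norm (x - y) \<le> 5 * R" if "x \<in> \<Omega>" "y \<in> A" for x y
  proof -
    have "norm x < R" using that R by auto
    moreover have "norm (y - (3 * R) *\<^sub>R e) < R" using that by (simp add: A_def dist_norm norm_minus_commute)
    moreover have "norm ((3 * R) *\<^sub>R e) = 3 * R" using e R by simp
    ultimately show ?thesis
      using norm_triangle_ineq4[of x y] norm_triangle_sub[of y "(3 * R) *\<^sub>R e"] by linarith
  qed
  define m where "m = measure lborel A"
  have m: "m > 0" using R by (simp add: m_def A_def content_ball_pos)
  have emA: "emeasure lborel A = ennreal m"
    unfolding m_def A_def using emeasure_lborel_ball_finite[of "(3 * R) *\<^sub>R e" R]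
    by (intro emeasure_eq_ennreal_measure) auto
  define C where "C = (5 * R) powr q / m"
  have main: "(\<integral>\<^sup>+x. ennreal (\<bar>u x\<bar> powr p) \<partial>lebesgue) \<le> ennreal C * gagliardo s p u" if u: "u \<in> W0 s p \<Omega>" for u
  proof -
    obtain v where v[measurable]: "v \<in> borel_measurable borel" and uv: "AE x in lebesgue. u x = v x"
      using completion_ex_borel_measurable_real[OF W0_measurable[OF u]] by (auto simp: AE_completion_iff)
    have "AE x in lebesgue. x \<notin> \<Omega> \<longrightarrow> u x = 0" using u by (simp add: W0_iff)
    with uv have v0: "AE x in lebesgue. x \<notin> \<Omega> \<longrightarrow> v x = 0" by eventually_elim auto
    have geq: "gagliardo s p u = gagliardo s p v"
      unfolding gagliardo_def using AE_lebesgue_fst[OF uv] AE_lebesgue_snd[OF uv]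
      by (intro nn_integral_cong_AE) (auto elim!: eventually_elim2)
    have [measurable]: "(fst :: 'a \<times> 'a \<Rightarrow> 'a) \<in> borel \<rightarrow>\<^sub>M borel" "(snd :: 'a \<times> 'a \<Rightarrow> 'a) \<in> borel \<rightarrow>\<^sub>M borel"
      by (intro borel_measurable_continuous_onI continuous_intros)+
    have "ennreal m * (\<integral>\<^sup>+x. ennreal (\<bar>v x\<bar> powr p) \<partial>lborel)
      = (\<integral>\<^sup>+x. \<integral>\<^sup>+y. ennreal (\<bar>v x\<bar> powr p) * indicator A y \<partial>lborel \<partial>lborel)"
      by (subst nn_integral_cmult_indicator) (auto simp: emA nn_integral_cmult[symmetric] mult.commute)
    also have "\<dots> = (\<integral>\<^sup>+z. ennreal (\<bar>v (fst z)\<bar> powr p) * indicator A (snd z) \<partial>lebesgue)"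
      by (subst nn_integral_lebesgue_prod) simp_all
    also have "\<dots> \<le> (\<integral>\<^sup>+z. ennreal ((5 * R) powr q) * ennreal (\<bar>v (fst z) - v (snd z)\<bar> powr p / norm (fst z - snd z) powr q) \<partial>lebesgue)"
    proof (rule nn_integral_mono_AE)
      show "AE z in lebesgue. ennreal (\<bar>v (fst z)\<bar> powr p) * indicator A (snd z) \<le>
        ennreal ((5 * R) powr q) * ennreal (\<bar>v (fst z) - v (snd z)\<bar> powr p / norm (fst z - snd z) powr q)"
        using AE_lebesgue_fst[OF v0] AE_lebesgue_snd[OF v0]
      proof eventually_elim
        case (elim z)
        show ?case
        proof (cases "snd z \<in> A \<and> fst z \<in> \<Omega>")
          case False
          then show ?thesis using elim p by (auto simp: indicator_def)
        next
          case True
          then have "v (snd z) = 0" using disj elim by auto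
          have pos: "norm (fst z - snd z) > 0" using True disj by auto
          have "norm (fst z - snd z) powr q \<le> (5 * R) powr q"
            using dist True p s by (intro powr_mono2) (auto simp: q_def)
          then have "\<bar>v (fst z)\<bar> powr p \<le> (5 * R) powr q * (\<bar>v (fst z)\<bar> powr p / norm (fst z - snd z) powr q)"
            using pos by (auto simp: field_simps intro!: mult_left_mono)
          then show ?thesis using True \<open>v (snd z) = 0\<close>
            by (simp add: ennreal_mult[symmetric] ennreal_leI)
        qed
      qed
    qed
    also have "\<dots> = ennreal ((5 * R) powr q) * gagliardo s p v"
      unfolding gagliardo_def q_def[symmetric]
      using v by (intro nn_integral_cmult measurable_compose[OF _ measurable_ennreal] borel_measurable_gagliardo measurable_completion) simp
    finally have "ennreal (1/m) * (ennreal m * (\<integral>\<^sup>+x. ennreal (\<bar>v x\<bar> powr p) \<partial>lborel))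
        \<le> ennreal (1/m) * (ennreal ((5 * R) powr q) * gagliardo s p v)" by (rule mult_left_mono) simp
    then have "(\<integral>\<^sup>+x. ennreal (\<bar>v x\<bar> powr p) \<partial>lborel) \<le> ennreal C * gagliardo s p v"
      using m unfolding mult.assoc[symmetric] by (simp add: C_def ennreal_mult[symmetric])
    moreover have "(\<integral>\<^sup>+x. ennreal (\<bar>u x\<bar> powr p) \<partial>lebesgue) = (\<integral>\<^sup>+x. ennreal (\<bar>v x\<bar> powr p) \<partial>lebesgue)"
      using uv by (intro nn_integral_cong_AE) auto
    ultimately show ?thesis using geq by (simp add: nn_integral_completion)
  qed
  show ?thesis using that[of C] main m by (simp add: C_def)
qed

section \<open>Dyadic averages\<close>

text \<open>The signed power \<open>|t|^(p-2) * t\<close>, that is, \<open>1/p\<close> times the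
  derivative of \<open>|t|^p\<close>; in this form no negative exponent occurs for
  \<open>p < 2\<close>.\<close>

definition spow :: "real \<Rightarrow> real \<Rightarrow> real" where
  "spow p t = sgn t * \<bar>t\<bar> powr (p - 1)"

lemma abs_powr_deriv:
  assumes p: "p > 1"
  shows "((\<lambda>t. \<bar>t\<bar> powr p) has_real_derivative p * spow p t) (at t)"
proof -
  consider "t > 0" | "t < 0" | "t = 0" by linarith
  then show ?thesis
  proof cases
    case 1
    have "((\<lambda>t. t powr p) has_real_derivative p * t powr (p - 1)) (at t)"
      by (rule has_real_derivative_powr[OF 1])
    moreover have "\<forall>\<^sub>F x in nhds t. \<bar>x\<bar> powr p = x powr p"
      using eventually_nhds_in_open[of "{0<..}" t] 1 by (auto elim!: eventually_mono)
    ultimately show ?thesis using 1 by (subst DERIV_cong_ev[OF refl _ refl]) (auto simp: spow_def)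
  next
    case 2
    have "((\<lambda>t. (- t) powr p) has_real_derivative (p * (- t) powr (p - 1)) * (- 1)) (at t)"
      by (rule DERIV_chain2[where f="\<lambda>t. t powr p" and g=uminus])
        (use 2 in \<open>auto intro!: has_real_derivative_powr derivative_eq_intros\<close>)
    moreover have "\<forall>\<^sub>F x in nhds t. \<bar>x\<bar> powr p = (- x) powr p"
      using eventually_nhds_in_open[of "{..<0}" t] 2 by (auto elim!: eventually_mono)
    ultimately show ?thesis using 2 by (subst DERIV_cong_ev[OF refl _ refl]) (auto simp: spow_def)
  next
    case 3
    \<comment> \<open>At zero the difference quotient has modulus \<open>|h| powr (p - 1)\<close>,
      which vanishes in the limit because \<open>p > 1\<close>.\<close>
    have "((\<lambda>h::real. \<bar>h\<bar> powr (p - 1)) \<longlongrightarrow> 0) (at 0)"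
    proof -
      have "((\<lambda>h::real. \<bar>h\<bar> powr (p - 1)) \<longlongrightarrow> \<bar>0\<bar> powr (p - 1)) (at 0)"
        using p by (intro tendsto_intros tendsto_powr') auto
      then show ?thesis by simp
    qed
    then have "((\<lambda>h::real. (\<bar>0 + h\<bar> powr p - \<bar>0\<bar> powr p) / h) \<longlongrightarrow> 0) (at 0)"
    proof (rule Lim_null_comparison[rotated])
      have "norm ((\<bar>0 + h\<bar> powr p - \<bar>0\<bar> powr p) / h) \<le> \<bar>h\<bar> powr (p - 1)" for h :: real
        by (cases "h = 0") (auto simp: powr_diff)
      then show "\<forall>\<^sub>F h::real in at 0. norm ((\<bar>0 + h\<bar> powr p - \<bar>0\<bar> powr p) / h) \<le> \<bar>h\<bar> powr (p - 1)"
        by simp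
    qed
    then show ?thesis using 3 by (simp add: DERIV_def spow_def)
  qed
qed

lemma spow_mono:
  assumes p: "p > 1" and "a \<le> b"
  shows "spow p a \<le> spow p b"
proof -
  consider "a \<ge> 0" | "a < 0" "b \<ge> 0" | "b < 0" using assms by linarith
  then show ?thesis
  proof cases
    case 1
    have "a powr (p-1) \<le> b powr (p-1)" using 1 assms by (intro powr_mono2) auto
    then show ?thesis using 1 assms by (cases "a = 0") (auto simp: spow_def sgn_if)
  next
    case 2 then show ?thesis by (auto simp: spow_def sgn_if intro: order_trans[of _ 0])
  next
    case 3
    have "(-b) powr (p-1) \<le> (-a) powr (p-1)" using 3 assms by (intro powr_mono2) auto
    then show ?thesis using 3 assms by (auto simp: spow_def sgn_if)
  qed
qed

text \<open>Convexity in tangent form, from the mean value theorem and the monotone derivative. It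
  yields Jensen's inequality for cell averages, the dominating function for difference quotients and
  the stability of the mass.\<close>

lemma abs_powr_tangent:
  assumes p: "p > 1"
  shows "\<bar>b\<bar> powr p + p * spow p b * (t - b) \<le> \<bar>t\<bar> powr p"
proof -
  consider "b < t" | "b = t" | "t < b" by linarith
  then show ?thesis
  proof cases
    case 1
    obtain z where z: "b < z" "z < t" "\<bar>t\<bar> powr p - \<bar>b\<bar> powr p = (t - b) * (p * spow p z)"
      using MVT2[OF 1 abs_powr_deriv[OF p]] by blast
    have "p * spow p b * (t - b) \<le> p * spow p z * (t - b)"
      using z p spow_mono[OF p, of b z] by (intro mult_right_mono mult_left_mono) auto
    moreover have "(t - b) * (p * spow p z) = p * spow p z * (t - b)" by (simp only: mult_ac)
    ultimately show ?thesis using z by linarith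
  next
    case 3
    obtain z where z: "t < z" "z < b" "\<bar>b\<bar> powr p - \<bar>t\<bar> powr p = (b - t) * (p * spow p z)"
      using MVT2[OF 3 abs_powr_deriv[OF p]] by blast
    have "p * spow p z * (b - t) \<le> p * spow p b * (b - t)"
      using z p spow_mono[OF p, of z b] by (intro mult_right_mono mult_left_mono) auto
    then show ?thesis using z by (simp add: algebra_simps)
  qed auto
qed

text \<open>Jensen's inequality for an average over \<open>Q\<close>. Only \<open>w\<close> itself
  is assumed integrable on \<open>Q\<close>; if the right-hand side is infinite there is nothing to
  prove.\<close>

lemma powr_mean_le:
  assumes p: "p > 1" and Q: "Q \<in> sets M" "emeasure M Q = ennreal m" "m > 0"
    and int: "integrable M (\<lambda>y. indicator Q y * w y)" and w[measurable]: "w \<in> borel_measurable M"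
  shows "ennreal (\<bar>a - (\<integral>y. indicator Q y * w y \<partial>M) / m\<bar> powr p)
    \<le> ennreal (1 / m) * (\<integral>\<^sup>+y. indicator Q y * ennreal (\<bar>a - w y\<bar> powr p) \<partial>M)"
proof -
  note [measurable] = Q(1)
  define A where "A = (\<integral>y. indicator Q y * w y \<partial>M) / m"
  define F where "F = (\<integral>\<^sup>+y. indicator Q y * ennreal (\<bar>a - w y\<bar> powr p) \<partial>M)"
  have F: "F = (\<integral>\<^sup>+y. ennreal (indicator Q y * \<bar>a - w y\<bar> powr p) \<partial>M)"
    unfolding F_def by (intro nn_integral_cong) (auto simp: indicator_def)
  have intQ: "integrable M (indicator Q :: _ \<Rightarrow> real)" using Q by (simp add: integrable_indicator_iff)
  have mQ: "(\<integral>y. indicator Q y \<partial>M) = m" using Q by (simp add: measure_def)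
  show ?thesis
  proof (cases "F = \<infinity>")
    case True
    then show ?thesis using \<open>m > 0\<close> unfolding F_def[symmetric] by (simp add: ennreal_mult_top)
  next
    case False
    have intF: "integrable M (\<lambda>y. indicator Q y * \<bar>a - w y\<bar> powr p)"
      using False unfolding F by (intro integrableI_bounded) (auto simp: less_top abs_mult)
    \<comment> \<open>The linear term integrates to zero over \<open>Q\<close> because
      \<open>A\<close> is the mean of \<open>w\<close> there; the tangent at \<open>a - A\<close>
      then bounds the integrand from below.\<close>
    have "m * \<bar>a - A\<bar> powr p = (\<integral>y. indicator Q y * \<bar>a - A\<bar> powr p + p * spow p (a - A) * (indicator Q y * A - indicator Q y * w y) \<partial>M)"
      using intQ int mQ \<open>m > 0\<close> by (simp add: A_def)
    also have "\<dots> \<le> (\<integral>y. indicator Q y * \<bar>a - w y\<bar> powr p \<partial>M)"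
    proof (rule integral_mono)
      fix y
      show "indicator Q y * \<bar>a - A\<bar> powr p + p * spow p (a - A) * (indicator Q y * A - indicator Q y * w y)
        \<le> indicator Q y * \<bar>a - w y\<bar> powr p"
        using abs_powr_tangent[OF p, of "a - A" "a - w y"] by (auto simp: indicator_def algebra_simps)
    qed (use intQ int intF in auto)
    finally have "\<bar>a - A\<bar> powr p \<le> 1 / m * (\<integral>y. indicator Q y * \<bar>a - w y\<bar> powr p \<partial>M)"
      using \<open>m > 0\<close> by (simp add: field_simps)
    then have "ennreal (\<bar>a - A\<bar> powr p) \<le> ennreal (1 / m * (\<integral>y. indicator Q y * \<bar>a - w y\<bar> powr p \<partial>M))"
      by (rule ennreal_leI)
    also have "\<dots> = ennreal (1/m) * F"
      unfolding F using intF \<open>m > 0\<close> by (subst nn_integral_eq_integral) (auto simp: ennreal_mult[symmetric])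
    finally show ?thesis by (simp add: A_def F_def)
  qed
qed

text \<open>The integer vector that labels the dyadic cube of side \<open>(1/2)^k\<close> containing
  \<open>x\<close>. It is a label and not a point of that cube; cells are the fibres of
  \<open>grid k\<close>.\<close>

definition grid :: "nat \<Rightarrow> 'a::euclidean_space \<Rightarrow> 'a" where
  "grid k x = (\<Sum>i\<in>Basis. of_int \<lfloor>2^k * (x \<bullet> i)\<rfloor> *\<^sub>R i)"

lemma grid_inner: "i \<in> Basis \<Longrightarrow> grid k x \<bullet> i = of_int \<lfloor>2^k * (x \<bullet> i)\<rfloor>"
  by (simp add: grid_def)

lemma grid_eq_iff: "grid k x = grid k y \<longleftrightarrow> (\<forall>i\<in>Basis. \<lfloor>2^k * (x \<bullet> i)\<rfloor> = \<lfloor>2^k * (y \<bullet> i)\<rfloor>)"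
  by (subst euclidean_eq_iff) (simp add: grid_inner)

lemma grid_measurable [measurable]: "grid k \<in> borel_measurable borel"
proof -
  have "(\<lambda>x::'a. real_of_int \<lfloor>2^k * (x \<bullet> i)\<rfloor>) \<in> borel_measurable borel" for i
    by (rule measurable_compose[OF _ borel_measurable_real_floor]) simp
  then show ?thesis unfolding grid_def[abs_def]
    by (intro borel_measurable_sum borel_measurable_scaleR) auto
qed

lemma grid_dist:
  fixes x y :: "'a::euclidean_space"
  assumes "grid k x = grid k y"
  shows "norm (x - y) \<le> real DIM('a) * (1/2)^k"
proof -
  have "\<bar>(x - y) \<bullet> i\<bar> \<le> (1/2)^k" if "i \<in> Basis" for i
  proof -
    have "\<lfloor>2^k * (x \<bullet> i)\<rfloor> = \<lfloor>2^k * (y \<bullet> i)\<rfloor>" using assms that by (simp add: grid_eq_iff)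
    then have "\<bar>2^k * (x \<bullet> i) - 2^k * (y \<bullet> i)\<bar> \<le> 1" by linarith
    then have "2^k * \<bar>(x - y) \<bullet> i\<bar> \<le> 1"
      by (simp add: inner_diff_left right_diff_distrib[symmetric] abs_mult)
    then show ?thesis by (simp add: field_simps power_divide)
  qed
  then have "(\<Sum>i\<in>Basis. \<bar>(x - y) \<bullet> i\<bar>) \<le> real DIM('a) * (1/2)^k"
    using sum_bounded_above[of "Basis::'a set" "\<lambda>i. \<bar>(x - y) \<bullet> i\<bar>" "(1/2)^k"] by simp
  with norm_le_l1[of "x - y"] show ?thesis by linarith
qed

lemma grid_vimage_measurable [measurable]: "{y::'a::euclidean_space. grid k y = c} \<in> sets borel"
  by measurable

text \<open>A half-open cube lies between the open and the closed box with the same corners, and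
  these have equal volume.\<close>

lemma emeasure_grid_cell:
  fixes x :: "'a::euclidean_space"
  shows "emeasure lborel {y. grid k y = grid k x} = ennreal (((1/2)^k) ^ DIM('a))"
proof -
  define a where "a = (1/2)^k *\<^sub>R grid k x"
  define b where "b = a + (1/2)^k *\<^sub>R One"
  have ab: "a \<bullet> i = (1/2)^k * of_int \<lfloor>2^k * (x \<bullet> i)\<rfloor>" "b \<bullet> i = (1/2)^k * (of_int \<lfloor>2^k * (x \<bullet> i)\<rfloor> + 1)"
    if "i \<in> Basis" for i
    using that by (simp_all add: a_def b_def grid_inner inner_add_left distrib_left)
  have ptl: "(1/2)^k * c \<le> t \<longleftrightarrow> c \<le> 2^k * t" "(1/2)^k * c < t \<longleftrightarrow> c < 2^k * t"
     "t \<le> (1/2)^k * c \<longleftrightarrow> 2^k * t \<le> c" "t < (1/2)^k * c \<longleftrightarrow> 2^k * t < c" for c t :: real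
    by (simp_all add: field_simps power_divide)
  have sub1: "box a b \<subseteq> {y. grid k y = grid k x}"
  proof
    fix y assume "y \<in> box a b"
    then have "\<lfloor>2^k * (y \<bullet> i)\<rfloor> = \<lfloor>2^k * (x \<bullet> i)\<rfloor>" if "i \<in> Basis" for i
      using that by (intro floor_unique) (auto simp: mem_box ab ptl intro: less_imp_le)
    then show "y \<in> {y. grid k y = grid k x}" by (simp add: grid_eq_iff)
  qed
  have sub2: "{y. grid k y = grid k x} \<subseteq> cbox a b"
  proof
    fix y assume "y \<in> {y. grid k y = grid k x}"
    then have "\<lfloor>2^k * (x \<bullet> i)\<rfloor> = \<lfloor>2^k * (y \<bullet> i)\<rfloor>" if "i \<in> Basis" for i
      using that by (simp add: grid_eq_iff)
    then show "y \<in> cbox a b" by (auto simp: mem_box ab ptl)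
  qed
  have le: "a \<bullet> i \<le> b \<bullet> i" if "i \<in> Basis" for i using that by (simp add: ab)
  have "(\<Prod>i\<in>Basis. (b - a) \<bullet> i) = ((1/2)^k) ^ DIM('a)"
    by (subst prod.cong[OF refl, of _ _ "\<lambda>_. (1/2)^k"]) (auto simp: inner_diff_left ab right_diff_distrib[symmetric])
  then have "emeasure lborel (box a b) = ennreal (((1/2)^k) ^ DIM('a))"
    "emeasure lborel (cbox a b) = ennreal (((1/2)^k) ^ DIM('a))"
    using le by (auto simp: emeasure_lborel_box emeasure_lborel_cbox)
  moreover have "emeasure lborel (box a b) \<le> emeasure lborel {y. grid k y = grid k x}"
    using sub1 by (intro emeasure_mono) auto
  moreover have "emeasure lborel {y. grid k y = grid k x} \<le> emeasure lborel (cbox a b)"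
    using sub2 by (intro emeasure_mono) auto
  ultimately show ?thesis by simp
qed

text \<open>Finitely many cells meet a bounded set. This makes the family of all cell averages
  countable and gives one index from which all averages at a fixed level are close.\<close>

lemma finite_grid_image:
  fixes S :: "'a::euclidean_space set"
  assumes "bounded S"
  shows "finite (grid k ` S)"
proof -
  obtain R where R: "\<And>x. x \<in> S \<Longrightarrow> norm x \<le> R" using assms by (auto simp: bounded_iff)
  define I where "I = {\<lfloor>- (2^k * R)\<rfloor>..\<lfloor>2^k * R\<rfloor>}"
  have "grid k ` S \<subseteq> (\<lambda>f. \<Sum>i\<in>Basis. of_int (f i) *\<^sub>R i) ` (Basis \<rightarrow>\<^sub>E I)"
  proof
    fix c assume "c \<in> grid k ` S"
    then obtain x where x: "x \<in> S" "c = grid k x" by auto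
    define f where "f = restrict (\<lambda>i. \<lfloor>2^k * (x \<bullet> i)\<rfloor>) Basis"
    have "\<lfloor>2^k * (x \<bullet> i)\<rfloor> \<in> I" if "i \<in> Basis" for i
    proof -
      have "\<bar>x \<bullet> i\<bar> \<le> R" using Basis_le_norm[OF that, of x] R[OF x(1)] by linarith
      then have "2^k * \<bar>x \<bullet> i\<bar> \<le> 2^k * R" by (intro mult_left_mono) auto
      then have "\<bar>2^k * (x \<bullet> i)\<bar> \<le> 2^k * R" by (simp add: abs_mult)
      then have "- (2^k * R) \<le> 2^k * (x \<bullet> i)" "2^k * (x \<bullet> i) \<le> 2^k * R" by (auto simp: abs_le_iff)
      then show ?thesis unfolding I_def by (auto intro: floor_mono)
    qed
    then have "f \<in> Basis \<rightarrow>\<^sub>E I" by (auto simp: f_def)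
    moreover have "c = (\<Sum>i\<in>Basis. of_int (f i) *\<^sub>R i)" by (simp add: x f_def grid_def)
    ultimately show "c \<in> (\<lambda>f. \<Sum>i\<in>Basis. of_int (f i) *\<^sub>R i) ` (Basis \<rightarrow>\<^sub>E I)" by blast
  qed
  moreover have "finite (Basis \<rightarrow>\<^sub>E I)" by (intro finite_PiE) (auto simp: I_def)
  ultimately show ?thesis by (rule finite_subset[OF _ finite_imageI])
qed

text \<open>On each dyadic cell, Jensen's inequality controls the deviation from the mean by the
  Gagliardo energy of the cell.\<close>

lemma powr_integral_le_grid_means:
  fixes \<Omega> :: "'a::euclidean_space set" and w :: "'a \<Rightarrow> real"
  assumes \<Omega>: "open \<Omega>" "bounded \<Omega>" and p: "p > 1" and s: "0 < s"
    and w[measurable]: "w \<in> borel_measurable borel" and int: "integrable lborel w"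
    and zero: "\<And>x. x \<notin> \<Omega> \<Longrightarrow> w x = 0" and e: "e \<ge> 0"
    and means: "\<And>c. c \<in> grid k ` \<Omega> \<Longrightarrow> \<bar>\<integral>y. indicator {y. grid k y = c} y * w y \<partial>lborel\<bar> \<le> e * ((1/2)^k) ^ DIM('a)"
  shows "(\<integral>\<^sup>+x. ennreal (\<bar>w x\<bar> powr p) \<partial>lborel) \<le>
    ennreal (2 powr p) * (ennreal (real DIM('a) powr (real DIM('a) + p * s) * ((1/2) powr (p * s)) ^ k) * gagliardo s p w
       + ennreal (e powr p) * emeasure lborel \<Omega>)"
proof -
  define N where "N = real DIM('a)"
  define q where "q = N + p * s"
  define h where "h = (1/2::real)^k"
  define m where "m = h ^ DIM('a)"
  have h: "h > 0" and m: "m > 0" by (auto simp: h_def m_def)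
  have q: "q > 0" using p s by (simp add: q_def N_def add_pos_pos)
  have [measurable]: "(fst :: 'a \<times> 'a \<Rightarrow> 'a) \<in> borel \<rightarrow>\<^sub>M borel" "(snd :: 'a \<times> 'a \<Rightarrow> 'a) \<in> borel \<rightarrow>\<^sub>M borel"
    by (intro borel_measurable_continuous_onI continuous_intros)+
  have [measurable]: "\<Omega> \<in> sets borel" using \<Omega> by auto
  define G where "G z = indicator {y. grid k y = grid k (fst z)} (snd z) * ennreal (\<bar>w (fst z) - w (snd z)\<bar> powr p)" for z
  have "{z::'a\<times>'a. grid k (snd z) = grid k (fst z)} \<in> sets borel" by measurable
  then have "(indicator {z::'a\<times>'a. grid k (snd z) = grid k (fst z)} :: _ \<Rightarrow> ennreal) \<in> borel_measurable borel" by simp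
  moreover have "(indicator {z::'a\<times>'a. grid k (snd z) = grid k (fst z)} :: _ \<Rightarrow> ennreal)
    = (\<lambda>z. indicator {y. grid k y = grid k (fst z)} (snd z))" by (auto simp: indicator_def)
  ultimately have [measurable]: "(\<lambda>z::'a\<times>'a. indicator {y. grid k y = grid k (fst z)} (snd z) :: ennreal) \<in> borel_measurable borel" by simp
  have G[measurable]: "G \<in> borel_measurable borel" unfolding G_def by measurable
  define F where "F x = (\<integral>\<^sup>+y. G (x, y) \<partial>lborel)" for x
  have "G \<in> borel_measurable (lborel \<Otimes>\<^sub>M lborel)" unfolding lborel_prod by simp
  then have F[measurable]: "F \<in> borel_measurable borel"
    unfolding F_def using lborel.borel_measurable_nn_integral_fst by simp
  \<comment> \<open>At a point of \<open>\<Omega>\<close>, split \<open>w x\<close> into its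
    deviation from the cell mean \<open>A\<close>, handled by Jensen, and \<open>A\<close> itself,
    which is at most \<open>e\<close> in modulus. \<open>F x\<close> collects the energy between
    \<open>x\<close> and the rest of its cell.\<close>
  have pt: "ennreal (\<bar>w x\<bar> powr p) \<le> ennreal (2 powr p) * (ennreal (1/m) * F x + ennreal (e powr p) * indicator \<Omega> x)" for x
  proof (cases "x \<in> \<Omega>")
    case False then show ?thesis using zero p by simp
  next
    case True
    define Q where "Q = {y. grid k y = grid k x}"
    have Q: "Q \<in> sets lborel" "emeasure lborel Q = ennreal m"
      using emeasure_grid_cell by (auto simp: Q_def m_def h_def)
    have intQ: "integrable lborel (\<lambda>y. indicator Q y * w y)"
      using integrable_mult_indicator[OF Q(1) int] by simp
    define A where "A = (\<integral>y. indicator Q y * w y \<partial>lborel) / m"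
    have A: "\<bar>A\<bar> \<le> e" using means[of "grid k x"] True m
      unfolding A_def Q_def m_def h_def abs_divide by (simp add: pos_divide_le_eq)
    have 1: "ennreal (\<bar>w x - A\<bar> powr p) \<le> ennreal (1/m) * F x"
      using powr_mean_le[OF p Q m intQ, of "w x"] w unfolding A_def F_def G_def Q_def by simp
    have "\<bar>w x\<bar> powr p \<le> (\<bar>w x - A\<bar> + e) powr p" using A p by (intro powr_mono2) auto
    also have "\<dots> \<le> 2 powr p * (\<bar>w x - A\<bar> powr p + e powr p)" using p e by (intro powr_add_le) auto
    finally have "ennreal (\<bar>w x\<bar> powr p) \<le> ennreal (2 powr p * (\<bar>w x - A\<bar> powr p + e powr p))"
      by (rule ennreal_leI)
    also have "\<dots> = ennreal (2 powr p) * (ennreal (\<bar>w x - A\<bar> powr p) + ennreal (e powr p))"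
      by (simp add: ennreal_mult)
    also have "\<dots> \<le> ennreal (2 powr p) * (ennreal (1/m) * F x + ennreal (e powr p))"
      using 1 by (intro mult_left_mono add_mono) auto
    finally show ?thesis using True by simp
  qed
  have "(\<integral>\<^sup>+x. ennreal (\<bar>w x\<bar> powr p) \<partial>lborel)
    \<le> (\<integral>\<^sup>+x. ennreal (2 powr p) * (ennreal (1/m) * F x + ennreal (e powr p) * indicator \<Omega> x) \<partial>lborel)"
    using pt by (intro nn_integral_mono) auto
  also have "\<dots> = ennreal (2 powr p) * (ennreal (1/m) * (\<integral>\<^sup>+x. F x \<partial>lborel) + ennreal (e powr p) * emeasure lborel \<Omega>)"
    by (subst nn_integral_cmult, simp, subst nn_integral_add) (auto simp: nn_integral_cmult)
  also have "(\<integral>\<^sup>+x. F x \<partial>lborel) = (\<integral>\<^sup>+z. G z \<partial>lebesgue)"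
    unfolding F_def by (rule nn_integral_lebesgue_prod[symmetric]) simp
  \<comment> \<open>Two points of one cell are at distance at most \<open>N * h\<close>, so
    inserting the singular weight costs at most the factor \<open>(N * h) powr q\<close>.\<close>
  also have "(\<integral>\<^sup>+z. G z \<partial>lebesgue) \<le> (\<integral>\<^sup>+z. ennreal ((N * h) powr q) *
      ennreal (\<bar>w (fst z) - w (snd z)\<bar> powr p / norm (fst z - snd z) powr q) \<partial>lebesgue)"
  proof (rule nn_integral_mono)
    fix z :: "'a \<times> 'a"
    show "G z \<le> ennreal ((N * h) powr q) * ennreal (\<bar>w (fst z) - w (snd z)\<bar> powr p / norm (fst z - snd z) powr q)"
    proof (cases "grid k (snd z) = grid k (fst z) \<and> fst z \<noteq> snd z")
      case False then show ?thesis using p by (auto simp: G_def)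
    next
      case True
      then have "norm (fst z - snd z) powr q \<le> (N * h) powr q"
        using q grid_dist[of k "fst z" "snd z"] by (intro powr_mono2) (auto simp: N_def h_def)
      then have "\<bar>w (fst z) - w (snd z)\<bar> powr p \<le> (N * h) powr q * (\<bar>w (fst z) - w (snd z)\<bar> powr p / norm (fst z - snd z) powr q)"
        using True by (auto simp: field_simps intro!: mult_left_mono mult_right_mono)
      then show ?thesis using True by (simp add: G_def ennreal_mult[symmetric] ennreal_leI)
    qed
  qed
  also have "\<dots> = ennreal ((N * h) powr q) * gagliardo s p w"
    unfolding gagliardo_def q_def N_def
    using w by (intro nn_integral_cmult measurable_compose[OF _ measurable_ennreal] borel_measurable_gagliardo measurable_completion) simp
  also have "ennreal (1/m) * (ennreal ((N * h) powr q) * gagliardo s p w)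
    = ennreal (N powr q * ((1/2) powr (p * s)) ^ k) * gagliardo s p w"
  proof -
    \<comment> \<open>The cell volume \<open>h powr N\<close> cancels the dimensional part of
      \<open>q\<close>; the surviving factor \<open>h powr (p * s)\<close> tends to zero under
      refinement.\<close>
    have "1/m * (N * h) powr q = N powr q * h powr (p * s)"
    proof -
      have "m = h powr N" using h by (simp add: m_def N_def powr_realpow)
      then show ?thesis using h by (simp add: powr_mult q_def powr_add N_def)
    qed
    also have "h powr (p * s) = ((1/2) powr (p * s)) ^ k" unfolding h_def by (simp only: power_powr_swap)
    finally show ?thesis using m unfolding mult.assoc[symmetric] by (subst ennreal_mult[symmetric]) auto
  qed
  finally show ?thesis by (simp add: N_def q_def mult_left_mono add_mono)
qed

section \<open>Compactness of the embedding into the Lebesgue space\<close>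

text \<open>The Riesz-Fischer argument: a fast subsequence converges almost everywhere because its
  weighted increments are summable, and Fatou in the second index turns the Cauchy estimate into
  convergence to the limit.\<close>

lemma powr_mean_Cauchy_imp_AE_convergent:
  fixes f :: "nat \<Rightarrow> 'a \<Rightarrow> real"
  assumes p: "p > 0" and f[measurable]: "\<And>n. f n \<in> borel_measurable M"
    and Cauchy: "\<And>e. e > 0 \<Longrightarrow> \<exists>N. \<forall>n\<ge>N. \<forall>m\<ge>N. (\<integral>\<^sup>+x. ennreal (\<bar>f n x - f m x\<bar> powr p) \<partial>M) \<le> ennreal e"
  obtains r g where "strict_mono (r :: nat \<Rightarrow> nat)" "g \<in> borel_measurable M" "AE x in M. (\<lambda>n. f (r n) x) \<longlonglongrightarrow> g x"
    "(\<lambda>n. \<integral>\<^sup>+x. ennreal (\<bar>f (r n) x - g x\<bar> powr p) \<partial>M) \<longlonglongrightarrow> 0"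
proof -
  \<comment> \<open>The ratio leaves room for the weight \<open>(2 powr p)^k\<close>: the weighted
    series is still geometric, with ratio \<open>(1/2) powr p\<close>, and its finiteness at a point
    forces increments of order \<open>(1/2)^k\<close>.\<close>
  define \<epsilon> where "\<epsilon> k = ((1/4) powr p) ^ k" for k::nat
  have \<epsilon>: "\<epsilon> k > 0" for k by (simp add: \<epsilon>_def)
  define I where "I n m = (\<integral>\<^sup>+x. ennreal (\<bar>f n x - f m x\<bar> powr p) \<partial>M)" for n m
  have "\<forall>k. \<exists>N. \<forall>n\<ge>N. \<forall>m\<ge>N. I n m \<le> ennreal (\<epsilon> k)"
    unfolding I_def using Cauchy \<epsilon> by blast
  then obtain N where N: "\<And>k n m. n \<ge> N k \<Longrightarrow> m \<ge> N k \<Longrightarrow> I n m \<le> ennreal (\<epsilon> k)"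
    by metis
  \<comment> \<open>Adding \<open>k\<close> makes the sequence strictly increasing, and the sum of
    all earlier indices dominates \<open>N k\<close>.\<close>
  define r where "r k = k + (\<Sum>i\<le>k. N i)" for k
  have r: "strict_mono r" unfolding r_def by (intro strict_monoI_Suc) simp
  have rN: "r k \<ge> N k" for k unfolding r_def using member_le_sum[of k "{..k}" N] by simp
  have rN': "r n \<ge> N k" if "n \<ge> k" for n k
    using rN[of k] that strict_mono_less_eq[OF r, of k n] by linarith
  have step: "I (r n) (r m) \<le> ennreal (\<epsilon> k)" if "n \<ge> k" "m \<ge> k" for n m k
    using N[OF rN' rN'] that by blast
  define d where "d k x = \<bar>f (r (Suc k)) x - f (r k) x\<bar>" for k x
  have [measurable]: "d k \<in> borel_measurable M" for k unfolding d_def by measurable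
  have "(\<integral>\<^sup>+x. (\<Sum>k. ennreal ((2 powr p)^k * d k x powr p)) \<partial>M)
      = (\<Sum>k. ennreal ((2 powr p)^k) * I (r (Suc k)) (r k))"
    unfolding I_def d_def by (subst nn_integral_suminf) (auto intro!: suminf_cong simp: ennreal_mult nn_integral_cmult)
  also have "\<dots> \<le> (\<Sum>k. ennreal (((1/2) powr p)^k))"
  proof (intro suminf_le allI)
    fix k
    have "ennreal ((2 powr p)^k) * I (r (Suc k)) (r k) \<le> ennreal ((2 powr p)^k) * ennreal (\<epsilon> k)"
      using step[of k "Suc k" k] by (intro mult_left_mono) auto
    also have "\<dots> = ennreal ((2 powr p * (1/4) powr p)^k)"
      by (simp add: ennreal_mult[symmetric] \<epsilon>_def power_mult_distrib)
    also have "2 powr p * (1/4::real) powr p = (1/2) powr p" by (simp flip: powr_mult)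
    finally show "ennreal ((2 powr p)^k) * I (r (Suc k)) (r k) \<le> ennreal (((1/2) powr p)^k)" .
  qed auto
  also have "\<dots> < \<infinity>"
  proof -
    have "(1/2::real) powr p < 1" using p powr_less_mono[of "-p" 0 2]
      by (simp add: powr_divide powr_minus_divide)
    then show ?thesis by (subst suminf_ennreal2) (auto intro!: summable_geometric)
  qed
  finally have "AE x in M. (\<Sum>k. ennreal ((2 powr p)^k * d k x powr p)) \<noteq> \<infinity>"
    by (intro nn_integral_PInf_AE) auto
  then have conv: "AE x in M. convergent (\<lambda>n. f (r n) x)"
  proof eventually_elim
    case (elim x)
    define S where "S = (\<Sum>k. ennreal ((2 powr p)^k * d k x powr p))"
    obtain c where c: "S = ennreal c" "c \<ge> 0" using elim by (cases S) (auto simp: S_def)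
    have dk: "d k x \<le> c powr (1/p) * (1/2)^k" for k
    proof -
      have "ennreal ((2 powr p)^k * d k x powr p) \<le> S" unfolding S_def by (rule ennreal_le_suminf[of _ _ k]) simp
      then have "(2 powr p)^k * d k x powr p \<le> c" using c by (simp add: ennreal_le_iff)
      then have "(2^k * d k x) powr p \<le> c" by (simp add: powr_mult power_powr_swap d_def)
      then have "((2^k * d k x) powr p) powr (1/p) \<le> c powr (1/p)" using p by (intro powr_mono2) auto
      then have "2^k * d k x \<le> c powr (1/p)" using p by (simp add: powr_powr d_def)
      then show ?thesis by (simp add: field_simps power_divide)
    qed
    have "summable (\<lambda>k. f (r (Suc k)) x - f (r k) x)"
    proof (rule summable_comparison_test)
      show "\<exists>N. \<forall>n\<ge>N. norm (f (r (Suc n)) x - f (r n) x) \<le> c powr (1/p) * (1/2)^n"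
        using dk by (auto simp: d_def)
      show "summable (\<lambda>n. c powr (1/p) * (1/2)^n)" by (intro summable_mult summable_geometric) simp
    qed
    then have "convergent (\<lambda>n. \<Sum>k<n. f (r (Suc k)) x - f (r k) x)" by (simp add: summable_iff_convergent)
    then have "convergent (\<lambda>n. (\<Sum>k<n. f (r (Suc k)) x - f (r k) x) + f (r 0) x)"
      by (intro convergent_add convergent_const)
    moreover have "(\<lambda>n. (\<Sum>k<n. f (r (Suc k)) x - f (r k) x) + f (r 0) x) = (\<lambda>n. f (r n) x)"
      using sum_lessThan_telescope[of "\<lambda>k. f (r k) x"] by auto
    ultimately show ?case by simp
  qed
  define g where "g x = lim (\<lambda>n. f (r n) x)" for x
  have g[measurable]: "g \<in> borel_measurable M" unfolding g_def by measurable
  have lim: "AE x in M. (\<lambda>n. f (r n) x) \<longlonglongrightarrow> g x"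
    using conv by eventually_elim (simp add: g_def convergent_LIMSEQ_iff)
  have bound: "(\<integral>\<^sup>+x. ennreal (\<bar>f (r n) x - g x\<bar> powr p) \<partial>M) \<le> ennreal (\<epsilon> n)" for n
  proof -
    have "(\<integral>\<^sup>+x. ennreal (\<bar>f (r n) x - g x\<bar> powr p) \<partial>M)
        = (\<integral>\<^sup>+x. liminf (\<lambda>m. ennreal (\<bar>f (r n) x - f (r m) x\<bar> powr p)) \<partial>M)"
    proof (rule nn_integral_cong_AE)
      show "AE x in M. ennreal (\<bar>f (r n) x - g x\<bar> powr p) = liminf (\<lambda>m. ennreal (\<bar>f (r n) x - f (r m) x\<bar> powr p))"
        using lim
      proof eventually_elim
        case (elim x)
        have "(\<lambda>m. ennreal (\<bar>f (r n) x - f (r m) x\<bar> powr p)) \<longlonglongrightarrow> ennreal (\<bar>f (r n) x - g x\<bar> powr p)"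
          using p by (intro tendsto_ennrealI tendsto_powr' tendsto_intros elim) auto
        then show ?case by (rule lim_imp_Liminf[OF trivial_limit_sequentially, symmetric])
      qed
    qed
    also have "\<dots> \<le> liminf (\<lambda>m. I (r n) (r m))"
      unfolding I_def by (intro nn_integral_liminf) measurable
    also have "\<dots> \<le> liminf (\<lambda>m. ennreal (\<epsilon> n))"
      using step[of n n] by (intro Liminf_mono eventually_sequentiallyI[of n]) auto
    finally show ?thesis by (simp add: Liminf_const)
  qed
  have "\<epsilon> \<longlonglongrightarrow> 0"
  proof -
    have "(1/4::real) powr p < 1" using p powr_less_mono[of "-p" 0 4]
      by (simp add: powr_divide powr_minus_divide)
    then show ?thesis unfolding \<epsilon>_def by (intro LIMSEQ_power_zero) simp
  qed
  then have "(\<lambda>n. ennreal (\<epsilon> n)) \<longlonglongrightarrow> 0" using tendsto_ennrealI by fastforce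
  then have "(\<lambda>n. \<integral>\<^sup>+x. ennreal (\<bar>f (r n) x - g x\<bar> powr p) \<partial>M) \<longlonglongrightarrow> 0"
    by (rule tendsto_sandwich[OF _ _ tendsto_const, rotated -1]) (simp_all add: bound always_eventually)
  then show ?thesis using that r g lim by blast
qed

lemma gagliardo_cong_AE:
  assumes "AE x in lebesgue. u x = v x"
  shows "gagliardo s p u = gagliardo s p v"
  unfolding gagliardo_def using AE_lebesgue_fst[OF assms] AE_lebesgue_snd[OF assms]
  by (intro nn_integral_cong_AE) (auto elim!: eventually_elim2)

lemma gagliardo_diff_le:
  fixes u v :: "'a::euclidean_space \<Rightarrow> real"
  assumes u: "u \<in> borel_measurable lebesgue" and v: "v \<in> borel_measurable lebesgue" and p: "p > 0"
  shows "gagliardo s p (\<lambda>x. u x - v x) \<le> ennreal (2 powr p) * (gagliardo s p u + gagliardo s p v)"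
proof -
  define q where "q = real DIM('a) + p * s"
  let ?g = "\<lambda>u z. \<bar>u (fst z) - u (snd z)\<bar> powr p / norm (fst z - snd z) powr q"
  have gm: "(\<lambda>z. ennreal (?g u z)) \<in> borel_measurable lebesgue" "(\<lambda>z. ennreal (?g v z)) \<in> borel_measurable lebesgue"
    using u v by (auto intro!: measurable_compose[OF _ measurable_ennreal] borel_measurable_gagliardo)
  have "gagliardo s p (\<lambda>x. u x - v x) \<le> (\<integral>\<^sup>+z. ennreal (2 powr p) * (ennreal (?g u z) + ennreal (?g v z)) \<partial>lebesgue)"
    unfolding gagliardo_def q_def[symmetric]
  proof (rule nn_integral_mono)
    fix z :: "'a \<times> 'a"
    have "\<bar>(u (fst z) - v (fst z)) - (u (snd z) - v (snd z))\<bar> powr p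
        \<le> (\<bar>u (fst z) - u (snd z)\<bar> + \<bar>v (fst z) - v (snd z)\<bar>) powr p"
      using p by (intro powr_mono2) auto
    also have "\<dots> \<le> 2 powr p * (\<bar>u (fst z) - u (snd z)\<bar> powr p + \<bar>v (fst z) - v (snd z)\<bar> powr p)"
      using p by (intro powr_add_le) auto
    finally have "?g (\<lambda>x. u x - v x) z \<le> 2 powr p * (?g u z + ?g v z)"
      by (simp add: divide_right_mono add_divide_distrib[symmetric])
    then show "ennreal (?g (\<lambda>x. u x - v x) z) \<le> ennreal (2 powr p) * (ennreal (?g u z) + ennreal (?g v z))"
      by (simp add: ennreal_mult[symmetric] ennreal_leI flip: ennreal_plus)
  qed
  also have "\<dots> = ennreal (2 powr p) * (gagliardo s p u + gagliardo s p v)"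
    unfolding gagliardo_def q_def[symmetric]
    using gm by (subst nn_integral_cmult) (auto simp: nn_integral_add)
  finally show ?thesis .
qed

lemma W0_borel_representative:
  fixes \<Omega> :: "'a::euclidean_space set"
  assumes u: "u \<in> W0 s p \<Omega>" and \<Omega>: "open \<Omega>"
  obtains v where "v \<in> borel_measurable borel" "AE x in lebesgue. u x = v x" "\<And>x. x \<notin> \<Omega> \<Longrightarrow> v x = 0"
proof -
  obtain w where w[measurable]: "w \<in> borel_measurable borel" and uw: "AE x in lebesgue. u x = w x"
    using completion_ex_borel_measurable_real[OF W0_measurable[OF u]] by (auto simp: AE_completion_iff)
  have [measurable]: "\<Omega> \<in> sets borel" using \<Omega> by auto
  have "AE x in lebesgue. x \<notin> \<Omega> \<longrightarrow> u x = 0" using u by (simp add: W0_iff)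
  with uw have "AE x in lebesgue. u x = indicator \<Omega> x * w x"
    by eventually_elim (auto simp: indicator_def)
  moreover have "(\<lambda>x. indicator \<Omega> x * w x) \<in> borel_measurable borel" by measurable
  ultimately show ?thesis using that[of "\<lambda>x. indicator \<Omega> x * w x"] by auto
qed

text \<open>Choose a subsequence along which the averages over all cells of all levels converge. For
  the difference of two late members the level \<open>k\<close> makes the energy part of the dyadic
  estimate small, and convergence of the finitely many averages at that level makes the other part
  small.\<close>

lemma W0_Cauchy_subsequence:
  fixes \<Omega> :: "'a::euclidean_space set"
  assumes \<Omega>: "open \<Omega>" "bounded \<Omega>" and p: "p > 1" and s: "0 < s"
    and u: "\<And>n::nat. u n \<in> W0 s p \<Omega>" and B: "B \<ge> 0" "\<And>n. gagliardo s p (u n) \<le> ennreal B"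
  obtains r where "strict_mono (r :: nat \<Rightarrow> nat)"
    "\<And>e. e > 0 \<Longrightarrow> \<exists>N. \<forall>n\<ge>N. \<forall>m\<ge>N. (\<integral>\<^sup>+x. ennreal (\<bar>u (r n) x - u (r m) x\<bar> powr p) \<partial>lebesgue) \<le> ennreal e"
proof -
  have [measurable]: "\<Omega> \<in> sets borel" using \<Omega> by auto
  have "\<forall>n. \<exists>v. v \<in> borel_measurable borel \<and> (AE x in lebesgue. u n x = v x) \<and> (\<forall>x. x \<notin> \<Omega> \<longrightarrow> v x = 0)"
    using W0_borel_representative[OF u \<Omega>(1)] by metis
  then obtain v where v[measurable]: "\<And>n. v n \<in> borel_measurable borel" and uv: "\<And>n. AE x in lebesgue. u n x = v n x"
    and v0: "\<And>n x. x \<notin> \<Omega> \<Longrightarrow> v n x = 0" by metis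
  have vl: "v n \<in> borel_measurable lebesgue" for n by (intro measurable_completion) simp
  have gv: "gagliardo s p (v n) \<le> ennreal B" for n
    using B(2) gagliardo_cong_AE[OF uv] by metis
  define V where "V = measure lborel \<Omega>"
  have emV: "emeasure lborel \<Omega> = ennreal V" and V0: "V \<ge> 0"
    unfolding V_def using emeasure_bounded_finite[OF \<Omega>(2)] by (auto intro!: emeasure_eq_ennreal_measure)
  obtain C where C: "C \<ge> 0"
    "\<And>u. u \<in> W0 s p \<Omega> \<Longrightarrow> (\<integral>\<^sup>+x. ennreal (\<bar>u x\<bar> powr p) \<partial>lebesgue) \<le> ennreal C * gagliardo s p u"
    using fractional_poincare[OF \<Omega> p s] by metis
  have powbound: "(\<integral>\<^sup>+x. ennreal (\<bar>v n x\<bar> powr p) \<partial>lborel) \<le> ennreal (C * B)" for n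
  proof -
    have "(\<integral>\<^sup>+x. ennreal (\<bar>v n x\<bar> powr p) \<partial>lborel) = (\<integral>\<^sup>+x. ennreal (\<bar>u n x\<bar> powr p) \<partial>lebesgue)"
      unfolding nn_integral_completion[of lborel, symmetric] using uv[of n] by (intro nn_integral_cong_AE) auto
    also have "\<dots> \<le> ennreal C * ennreal B"
      using C(2)[OF u] B(2) by (meson mult_left_mono order_trans zero_le)
    finally show ?thesis using C B by (simp add: ennreal_mult)
  qed
  \<comment> \<open>Cell averages require integrability of \<open>v n\<close> itself. On
    \<open>\<Omega>\<close>, \<open>|t|\<close> is at most \<open>1 + |t| powr p\<close>, so the
    bound on the p-th power integral suffices, uniformly in \<open>n\<close>.\<close>
  have l1: "(\<integral>\<^sup>+x. ennreal \<bar>v n x\<bar> \<partial>lborel) \<le> ennreal (V + C * B)" for n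
  proof -
    have "(\<integral>\<^sup>+x. ennreal \<bar>v n x\<bar> \<partial>lborel) \<le> (\<integral>\<^sup>+x. indicator \<Omega> x + ennreal (\<bar>v n x\<bar> powr p) \<partial>lborel)"
    proof (rule nn_integral_mono)
      fix x
      show "ennreal \<bar>v n x\<bar> \<le> indicator \<Omega> x + ennreal (\<bar>v n x\<bar> powr p)"
      proof (cases "x \<in> \<Omega>")
        case False then show ?thesis by (simp add: v0)
      next
        case True
        have "\<bar>v n x\<bar> \<le> 1 + \<bar>v n x\<bar> powr p"
        proof (cases "\<bar>v n x\<bar> \<le> 1")
          case True then show ?thesis by (smt (verit) powr_ge_zero)
        next
          case False
          then have "\<bar>v n x\<bar> powr 1 \<le> \<bar>v n x\<bar> powr p" using p by (intro powr_mono) auto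
          then show ?thesis using False by simp
        qed
        then have "ennreal \<bar>v n x\<bar> \<le> ennreal (1 + \<bar>v n x\<bar> powr p)" by (rule ennreal_leI)
        then show ?thesis using True by simp
      qed
    qed
    also have "\<dots> = ennreal V + (\<integral>\<^sup>+x. ennreal (\<bar>v n x\<bar> powr p) \<partial>lborel)"
      by (subst nn_integral_add) (auto simp: emV)
    also have "\<dots> \<le> ennreal V + ennreal (C * B)" using powbound by (intro add_left_mono) auto
    finally show ?thesis using V0 C B by simp
  qed
  have vint: "integrable lborel (v n)" for n
  proof (rule integrableI_bounded)
    have "(\<integral>\<^sup>+x. ennreal \<bar>v n x\<bar> \<partial>lborel) < \<infinity>"
      using l1[of n] by (rule le_less_trans) simp
    then show "(\<integral>\<^sup>+x. ennreal (norm (v n x)) \<partial>lborel) < \<infinity>" by simp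
  qed simp
  define a where "a n kc = (\<integral>y. indicator {y. grid (fst kc) y = snd kc} y * v n y \<partial>lborel)" for n and kc :: "nat \<times> 'a"
  define S where "S = (\<Union>k. {k} \<times> (grid k ` \<Omega>))"
  have "countable S" unfolding S_def using finite_grid_image[OF \<Omega>(2)]
    by (intro countable_UN countable_SIGMA) (auto intro: countable_finite)
  moreover have "norm (a n kc) \<le> V + C * B" for n kc
  proof -
    have "norm (a n kc) \<le> (\<integral>y. norm (indicator {y. grid (fst kc) y = snd kc} y * v n y) \<partial>lborel)"
      unfolding a_def by (rule integral_norm_bound)
    also have "\<dots> \<le> (\<integral>y. \<bar>v n y\<bar> \<partial>lborel)"
    proof (rule integral_mono)
      have "integrable lborel (\<lambda>y. indicator {y. grid (fst kc) y = snd kc} y * v n y)"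
        using integrable_mult_indicator[OF _ vint, of "{y. grid (fst kc) y = snd kc}"] by simp
      then show "integrable lborel (\<lambda>y. norm (indicator {y. grid (fst kc) y = snd kc} y * v n y))" by (rule integrable_norm)
    qed (use vint in \<open>auto simp: indicator_def\<close>)
    also have "\<dots> \<le> V + C * B"
    proof -
      have "ennreal (\<integral>y. \<bar>v n y\<bar> \<partial>lborel) = (\<integral>\<^sup>+x. ennreal \<bar>v n x\<bar> \<partial>lborel)"
        using vint by (subst nn_integral_eq_integral) auto
      then have "ennreal (\<integral>y. \<bar>v n y\<bar> \<partial>lborel) \<le> ennreal (V + C * B)"
        using l1[of n] by (rule ord_eq_le_trans)
      then show ?thesis using V0 C(1) B(1) by (subst (asm) ennreal_le_iff) auto
    qed
    finally show ?thesis .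
  qed
  \<comment> \<open>The diagonal argument for a uniformly bounded sequence of functions on a
    countable set, here on all pairs of a level and a cell.\<close>
  ultimately obtain r where r: "strict_mono (r :: nat \<Rightarrow> nat)" and ar: "\<And>kc. kc \<in> S \<Longrightarrow> \<exists>l. (\<lambda>n. a (r n) kc) \<longlonglongrightarrow> l"
    using function_convergent_subsequence[of S a "V + C * B"] by blast
  have "\<exists>N. \<forall>n\<ge>N. \<forall>m\<ge>N. (\<integral>\<^sup>+x. ennreal (\<bar>u (r n) x - u (r m) x\<bar> powr p) \<partial>lebesgue) \<le> ennreal \<eta>"
    if \<eta>: "\<eta> > 0" for \<eta>
  proof -
    define D where "D = real DIM('a) powr (real DIM('a) + p * s)"
    define \<theta> where "\<theta> = (1/2::real) powr (p * s)"
    define G where "G = 2 powr p * (B + B)"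
    have \<theta>: "0 \<le> \<theta>" "\<theta> < 1" using p s powr_less_mono[of "-(p * s)" 0 2]
      by (auto simp: \<theta>_def powr_divide powr_minus_divide)
    have "(\<lambda>k. 2 powr p * (D * \<theta>^k * G)) \<longlonglongrightarrow> 2 powr p * (D * 0 * G)"
      using \<theta> by (intro tendsto_intros LIMSEQ_power_zero) auto
    then have "\<forall>\<^sub>F k in sequentially. 2 powr p * (D * \<theta>^k * G) < \<eta>/2"
      by (rule order_tendstoD(2)) (use \<eta> in simp)
    then obtain k where k: "2 powr p * (D * \<theta>^k * G) < \<eta>/2" by (auto simp: eventually_sequentially)
    \<comment> \<open>Chosen so that the averages contribute at most half of \<open>\<eta>\<close>;
      \<open>V + 1\<close> keeps the denominator positive even if \<open>V\<close> is zero.\<close>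
    define e where "e = (\<eta> / (2 * 2 powr p * (V + 1))) powr (1/p)"
    have e: "e > 0" and ep: "2 powr p * (e powr p * V) \<le> \<eta>/2"
    proof -
      have *: "\<eta> / (2 * 2 powr p * (V + 1)) > 0" using \<eta> V0 by simp
      then show "e > 0" unfolding e_def by (metis powr_gt_zero less_irrefl)
      have "e powr p = (\<eta> / (2 * 2 powr p * (V + 1))) powr 1" using p unfolding e_def powr_powr by simp
      also have "\<dots> = \<eta> / (2 * 2 powr p * (V + 1))" using * by (rule powr_one[OF less_imp_le])
      finally have "e powr p = \<eta> / (2 * 2 powr p * (V + 1))" .
      then have "2 powr p * (e powr p * V) = \<eta>/2 * (V / (V + 1))" by simp
      also have "\<dots> \<le> \<eta>/2 * 1" using \<eta> V0 by (intro mult_left_mono) auto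
      finally show "2 powr p * (e powr p * V) \<le> \<eta>/2" by simp
    qed
    define m where "m = ((1/2::real)^k) ^ DIM('a)"
    have m: "m > 0" by (simp add: m_def)
    have "\<exists>N. \<forall>n\<ge>N. \<forall>l\<ge>N. \<bar>a (r n) (k, c) - a (r l) (k, c)\<bar> \<le> e * m" if "c \<in> grid k ` \<Omega>" for c
    proof -
      have "(k, c) \<in> S" using that by (auto simp: S_def)
      then have "Cauchy (\<lambda>n. a (r n) (k, c))" using ar LIMSEQ_imp_Cauchy by blast
      from CauchyD[OF this, of "e * m"] e m show ?thesis by (auto intro: less_imp_le)
    qed
    then obtain N where N: "\<And>c n l. c \<in> grid k ` \<Omega> \<Longrightarrow> n \<ge> N c \<Longrightarrow> l \<ge> N c \<Longrightarrow> \<bar>a (r n) (k, c) - a (r l) (k, c)\<bar> \<le> e * m"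
      by metis
    \<comment> \<open>One index for all cells of level \<open>k\<close>; inserting \<open>0\<close>
      keeps the finite set nonempty.\<close>
    define M where "M = Max (insert 0 (N ` grid k ` \<Omega>))"
    have M: "N c \<le> M" if "c \<in> grid k ` \<Omega>" for c
      unfolding M_def using that finite_grid_image[OF \<Omega>(2)] by (intro Max_ge) auto
    have "(\<integral>\<^sup>+x. ennreal (\<bar>u (r n) x - u (r l) x\<bar> powr p) \<partial>lebesgue) \<le> ennreal \<eta>" if nl: "n \<ge> M" "l \<ge> M" for n l
    proof -
      define w where "w x = v (r n) x - v (r l) x" for x
      have [measurable]: "w \<in> borel_measurable borel" unfolding w_def by measurable
      have wint: "integrable lborel w" unfolding w_def using vint by auto
      have gw: "gagliardo s p w \<le> ennreal G"
      proof -
        have "gagliardo s p w \<le> ennreal (2 powr p) * (gagliardo s p (v (r n)) + gagliardo s p (v (r l)))"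
          unfolding w_def using p by (intro gagliardo_diff_le vl) auto
        also have "\<dots> \<le> ennreal (2 powr p) * (ennreal B + ennreal B)"
          by (intro mult_left_mono add_mono gv) auto
        also have "ennreal B + ennreal B = ennreal (B + B)" by (intro ennreal_plus[symmetric] B(1))
        also have "ennreal (2 powr p) * ennreal (B + B) = ennreal G"
          using B(1) unfolding G_def by (intro ennreal_mult[symmetric]) auto
        finally show ?thesis .
      qed
      have means: "\<bar>\<integral>y. indicator {y. grid k y = c} y * w y \<partial>lborel\<bar> \<le> e * ((1/2)^k) ^ DIM('a)"
        if c: "c \<in> grid k ` \<Omega>" for c
      proof -
        have i: "integrable lborel (\<lambda>y. indicator {y. grid k y = c} y * v n y)" for n
          using integrable_mult_indicator[OF _ vint, of "{y. grid k y = c}"] by simp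
        have "(\<integral>y. indicator {y. grid k y = c} y * w y \<partial>lborel) = a (r n) (k, c) - a (r l) (k, c)"
          unfolding a_def w_def fst_conv snd_conv right_diff_distrib using i by (intro Bochner_Integration.integral_diff) auto
        then show ?thesis using N[OF c, of n l] M[OF c] nl by (simp add: m_def)
      qed
      have "(\<integral>\<^sup>+x. ennreal (\<bar>u (r n) x - u (r l) x\<bar> powr p) \<partial>lebesgue) = (\<integral>\<^sup>+x. ennreal (\<bar>w x\<bar> powr p) \<partial>lebesgue)"
        using uv[of "r n"] uv[of "r l"] by (intro nn_integral_cong_AE) (auto simp: w_def elim!: eventually_elim2)
      also have "\<dots> = (\<integral>\<^sup>+x. ennreal (\<bar>w x\<bar> powr p) \<partial>lborel)" by (rule nn_integral_completion)
      also have "\<dots> \<le> ennreal (2 powr p) * (ennreal (D * \<theta> ^ k) * gagliardo s p w + ennreal (e powr p) * emeasure lborel \<Omega>)"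
        unfolding D_def \<theta>_def
        using e means v0 by (intro powr_integral_le_grid_means[OF \<Omega> p s _ wint]) (auto simp: w_def)
      also have "\<dots> \<le> ennreal (2 powr p) * (ennreal (D * \<theta> ^ k) * ennreal G + ennreal (e powr p) * ennreal V)"
        unfolding emV by (intro mult_left_mono add_mono gw) auto
      also have "\<dots> = ennreal (2 powr p * (D * \<theta> ^ k * G) + 2 powr p * (e powr p * V))"
        using \<theta> B V0 by (simp add: ennreal_mult[symmetric] D_def G_def distrib_left flip: ennreal_plus)
      also have "\<dots> \<le> ennreal \<eta>" using k ep by (intro ennreal_leI) linarith
      finally show ?thesis .
    qed
    then show ?thesis by blast
  qed
  with r that show ?thesis by blast
qed

lemma gagliardo_Fatou:
  assumes u: "\<And>n. u n \<in> borel_measurable lebesgue" and v: "v \<in> borel_measurable lebesgue" and p: "p > 0"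
    and lim: "AE x in lebesgue. (\<lambda>n. u n x) \<longlonglongrightarrow> v x"
  shows "gagliardo s p v \<le> liminf (\<lambda>n. gagliardo s p (u n))"
proof -
  define q where "q = real DIM('a) + p * s"
  let ?g = "\<lambda>u z. \<bar>u (fst z) - u (snd z)\<bar> powr p / norm (fst z - snd z) powr q"
  have "gagliardo s p v = (\<integral>\<^sup>+z. liminf (\<lambda>n. ennreal (?g (u n) z)) \<partial>lebesgue)"
    unfolding gagliardo_def q_def[symmetric]
  proof (rule nn_integral_cong_AE)
    show "AE z in lebesgue. ennreal (?g v z) = liminf (\<lambda>n. ennreal (?g (u n) z))"
      using AE_lebesgue_fst[OF lim] AE_lebesgue_snd[OF lim]
    proof eventually_elim
      case (elim z)
      have "(\<lambda>n. ennreal (?g (u n) z)) \<longlonglongrightarrow> ennreal (?g v z)"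
      proof (cases "fst z = snd z")
        case False
        then show ?thesis using p by (intro tendsto_ennrealI tendsto_divide tendsto_powr' tendsto_intros elim) auto
      qed simp
      then show ?case by (rule lim_imp_Liminf[OF trivial_limit_sequentially, symmetric])
    qed
  qed
  also have "\<dots> \<le> liminf (\<lambda>n. \<integral>\<^sup>+z. ennreal (?g (u n) z) \<partial>lebesgue)"
    using u by (intro nn_integral_liminf measurable_compose[OF _ measurable_ennreal] borel_measurable_gagliardo)
  finally show ?thesis by (simp add: gagliardo_def q_def)
qed

text \<open>Almost everywhere convergence is part of the conclusion because Fatou's lemma is applied
  twice along it: here to place the limit in the space, and later to the energy with kernel
  \<open>K\<close>.\<close>

theorem W0_compact:
  fixes \<Omega> :: "'a::euclidean_space set"
  assumes \<Omega>: "open \<Omega>" "bounded \<Omega>" and p: "p > 1" and s: "0 < s"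
    and u: "\<And>n::nat. u n \<in> W0 s p \<Omega>" and B: "B \<ge> 0" "\<And>n. gagliardo s p (u n) \<le> ennreal B"
  obtains r v where "strict_mono (r :: nat \<Rightarrow> nat)" "v \<in> W0 s p \<Omega>" "AE x in lebesgue. (\<lambda>n. u (r n) x) \<longlonglongrightarrow> v x"
    "(\<lambda>n. \<integral>\<^sup>+x. ennreal (\<bar>u (r n) x - v x\<bar> powr p) \<partial>lebesgue) \<longlonglongrightarrow> 0"
proof -
  have p0: "p > 0" using p by simp
  have um[measurable]: "u n \<in> borel_measurable lebesgue" for n using u by (rule W0_measurable)
  obtain r1 where r1: "strict_mono (r1 :: nat \<Rightarrow> nat)"
    "\<And>e. e > 0 \<Longrightarrow> \<exists>N. \<forall>n\<ge>N. \<forall>m\<ge>N. (\<integral>\<^sup>+x. ennreal (\<bar>u (r1 n) x - u (r1 m) x\<bar> powr p) \<partial>lebesgue) \<le> ennreal e"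
    by (rule W0_Cauchy_subsequence[where u=u, OF \<Omega> p s u B]) blast+
  obtain r2 v where r2: "strict_mono (r2 :: nat \<Rightarrow> nat)" and v[measurable]: "v \<in> borel_measurable lebesgue"
    and lim: "AE x in lebesgue. (\<lambda>n. u (r1 (r2 n)) x) \<longlonglongrightarrow> v x"
    and Lp: "(\<lambda>n. \<integral>\<^sup>+x. ennreal (\<bar>u (r1 (r2 n)) x - v x\<bar> powr p) \<partial>lebesgue) \<longlonglongrightarrow> 0"
    by (rule powr_mean_Cauchy_imp_AE_convergent[OF p0, of "\<lambda>n. u (r1 n)" lebesgue, OF um r1(2)]) blast
  define r where "r = r1 \<circ> r2"
  have r: "strict_mono r" unfolding r_def using r1(1) r2 by (rule strict_mono_o)
  have "\<forall>\<^sub>F n in sequentially. (\<integral>\<^sup>+x. ennreal (\<bar>u (r n) x - v x\<bar> powr p) \<partial>lebesgue) < 1"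
    using order_tendstoD(2)[OF Lp, of 1] by (simp add: r_def)
  then obtain n where n: "(\<integral>\<^sup>+x. ennreal (\<bar>u (r n) x - v x\<bar> powr p) \<partial>lebesgue) < 1"
    by (auto simp: eventually_sequentially)
  have "integrable lebesgue (\<lambda>x. \<bar>u (r n) x - v x\<bar> powr p)"
  proof (rule integrableI_bounded)
    show "(\<integral>\<^sup>+x. ennreal (norm (\<bar>u (r n) x - v x\<bar> powr p)) \<partial>lebesgue) < \<infinity>"
      using less_trans[OF n, of \<infinity>] by simp
  qed measurable
  moreover have "integrable lebesgue (\<lambda>x. \<bar>u (r n) x\<bar> powr p)" using u by (simp add: W0_iff)
  ultimately have "integrable lebesgue (\<lambda>x. 2 powr p * (\<bar>u (r n) x\<bar> powr p + \<bar>u (r n) x - v x\<bar> powr p))" by simp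
  then have "integrable lebesgue (\<lambda>x. \<bar>v x\<bar> powr p)"
  proof (rule Bochner_Integration.integrable_bound)
    have "\<bar>v x\<bar> powr p \<le> 2 powr p * (\<bar>u (r n) x\<bar> powr p + \<bar>u (r n) x - v x\<bar> powr p)" for x
    proof -
      have "\<bar>v x\<bar> powr p \<le> (\<bar>u (r n) x\<bar> + \<bar>u (r n) x - v x\<bar>) powr p" using p by (intro powr_mono2) auto
      also have "\<dots> \<le> 2 powr p * (\<bar>u (r n) x\<bar> powr p + \<bar>u (r n) x - v x\<bar> powr p)" using p by (intro powr_add_le) auto
      finally show ?thesis .
    qed
    then show "AE x in lebesgue. norm (\<bar>v x\<bar> powr p) \<le> norm (2 powr p * (\<bar>u (r n) x\<bar> powr p + \<bar>u (r n) x - v x\<bar> powr p))"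
      by (intro AE_I2) simp
  qed measurable
  moreover have "gagliardo s p v < \<infinity>"
  proof -
    have "gagliardo s p v \<le> liminf (\<lambda>n. gagliardo s p (u (r n)))"
      using um v p0 lim unfolding r_def comp_def by (intro gagliardo_Fatou) auto
    also have "\<dots> \<le> liminf (\<lambda>n. ennreal B)" by (intro Liminf_mono always_eventually allI B(2))
    finally show ?thesis by (simp add: Liminf_const le_less_trans)
  qed
  moreover have "AE x in lebesgue. x \<notin> \<Omega> \<longrightarrow> v x = 0"
  proof -
    have "AE x in lebesgue. x \<notin> \<Omega> \<longrightarrow> u n x = 0" for n using u[of n] by (simp add: W0_iff)
    then have "AE x in lebesgue. \<forall>n. x \<notin> \<Omega> \<longrightarrow> u n x = 0" unfolding AE_all_countable ..
    with lim show ?thesis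
    proof eventually_elim
      case (elim x)
      show ?case
      proof
        assume "x \<notin> \<Omega>"
        then have "(\<lambda>n. u (r1 (r2 n)) x) = (\<lambda>n. 0)" using elim(2) by auto
        then show "v x = 0" using elim(1) by (simp add: LIMSEQ_const_iff)
      qed
    qed
  qed
  ultimately have "v \<in> W0 s p \<Omega>" by (simp add: W0_iff)
  then show ?thesis using that[OF r] lim Lp by (simp add: r_def)
qed

section \<open>The bathtub principle\<close>

text \<open>A generalized inverse of the distribution function: at the supremum of the levels with
  measure at most \<open>m\<close>, continuity of the measure from below and above brackets
  \<open>m\<close> between the two one-sided limits.\<close>

lemma (in finite_measure) measure_jump:
  fixes S :: "real \<Rightarrow> 'a set"
  assumes mono: "\<And>s t. s \<le> t \<Longrightarrow> S s \<subseteq> S t" and S: "\<And>t. S t \<in> sets M"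
    and t1: "measure M (S t1) \<le> m" and t2: "m < measure M (S t2)"
  obtains t where "measure M (\<Union>n. S (t - 1 / Suc n)) \<le> m" "m \<le> measure M (\<Inter>n. S (t + 1 / Suc n))"
proof -
  define T where "T = {t. measure M (S t) \<le> m}"
  have mm: "measure M (S s) \<le> measure M (S t)" if "s \<le> t" for s t
    using mono[OF that] S by (intro finite_measure_mono) auto
  have ne: "T \<noteq> {}" using t1 by (auto simp: T_def)
  have bdd: "bdd_above T"
    unfolding bdd_above_def T_def using t2 mm[of t2] by (intro exI[of _ t2]) (auto simp: not_le intro!: leI, smt (verit))
  define t where "t = Sup T"
  have lo: "measure M (S (t - 1 / Suc n)) \<le> m" for n
  proof -
    have "t - 1 / Suc n < Sup T" by (simp add: t_def)
    then obtain s where "s \<in> T" "t - 1 / Suc n < s" using less_cSup_iff[OF ne bdd] by auto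
    then show ?thesis using mm[of "t - 1 / Suc n" s] by (auto simp: T_def)
  qed
  have hi: "m \<le> measure M (S (t + 1 / Suc n))" for n
  proof (rule ccontr)
    assume "\<not> ?thesis"
    then have "t + 1 / Suc n \<in> T" by (simp add: T_def)
    then have "t + 1 / Suc n \<le> t" unfolding t_def using bdd by (rule cSup_upper)
    then show False by (simp add: field_simps)
  qed
  have "incseq (\<lambda>n. S (t - 1 / Suc n))"
    by (intro incseq_SucI mono) (simp add: field_simps)
  then have "(\<lambda>n. measure M (S (t - 1 / Suc n))) \<longlonglongrightarrow> measure M (\<Union>n. S (t - 1 / Suc n))"
    using S by (intro finite_Lim_measure_incseq) auto
  then have 1: "measure M (\<Union>n. S (t - 1 / Suc n)) \<le> m" by (rule LIMSEQ_le_const2) (use lo in auto)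
  have "decseq (\<lambda>n. S (t + 1 / Suc n))"
    by (intro decseq_SucI mono) (simp add: field_simps)
  then have "(\<lambda>n. measure M (S (t + 1 / Suc n))) \<longlonglongrightarrow> measure M (\<Inter>n. S (t + 1 / Suc n))"
    using S by (intro finite_Lim_measure_decseq) auto
  then have 2: "m \<le> measure M (\<Inter>n. S (t + 1 / Suc n))" by (rule LIMSEQ_le_const) (use hi in auto)
  from 1 2 show ?thesis by (rule that)
qed

text \<open>Cutting the level sets of \<open>f\<close> by balls, whose boundaries are null sets, gives a chain of sets that
  attains every measure even when level sets of \<open>f\<close> have positive measure.\<close>

definition upper_set :: "('a::real_normed_vector) set \<Rightarrow> ('a \<Rightarrow> real) \<Rightarrow> real \<Rightarrow> real \<Rightarrow> 'a set" where
  "upper_set \<Omega> f a b = {x \<in> \<Omega>. f x > a \<or> (f x = a \<and> norm x < b)}"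

definition upper_chain :: "('a::real_normed_vector) set \<Rightarrow> ('a \<Rightarrow> real) \<Rightarrow> 'a set set" where
  "upper_chain \<Omega> f = {{}, \<Omega>} \<union> {upper_set \<Omega> f a b |a b. True}"

lemma upper_chain_subset: "E \<in> upper_chain \<Omega> f \<Longrightarrow> E \<subseteq> \<Omega>"
  by (auto simp: upper_chain_def upper_set_def)

text \<open>The sets are ordered lexicographically: a smaller level gives a larger set, and at equal
  levels a larger radius does.\<close>

lemma upper_chain_linear:
  assumes "E \<in> upper_chain \<Omega> f" "F \<in> upper_chain \<Omega> f"
  shows "E \<subseteq> F \<or> F \<subseteq> E"
proof -
  have "upper_set \<Omega> f a b \<subseteq> upper_set \<Omega> f c d \<or> upper_set \<Omega> f c d \<subseteq> upper_set \<Omega> f a b" for a b c d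
    by (cases a c rule: linorder_cases; cases b d rule: linorder_cases) (auto simp: upper_set_def)
  then show ?thesis using assms unfolding upper_chain_def by (auto simp: upper_set_def)
qed

lemma upper_set_measurable:
  fixes \<Omega> :: "'a::euclidean_space set"
  assumes [measurable]: "f \<in> borel_measurable (lebesgue_on \<Omega>)"
  shows "upper_set \<Omega> f a b \<in> sets (lebesgue_on \<Omega>)"
proof -
  have "(\<lambda>x::'a. norm x) \<in> borel_measurable (lebesgue_on \<Omega>)"
    by (intro measurable_restrict_space1 measurable_completion) simp
  then have "{x \<in> space (lebesgue_on \<Omega>). f x > a \<or> (f x = a \<and> norm x < b)} \<in> sets (lebesgue_on \<Omega>)"
    by measurable
  then show ?thesis by (simp add: upper_set_def)
qed

lemma upper_chain_measurable:
  assumes "f \<in> borel_measurable (lebesgue_on \<Omega>)" "E \<in> upper_chain \<Omega> f"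
  shows "E \<in> sets (lebesgue_on \<Omega>)"
  using assms upper_set_measurable[OF assms(1)] by (auto simp: upper_chain_def)

text \<open>\<open>measure_jump\<close> is applied twice, first to find the level and then the
  radius. The second bracket closes because its two sides differ by a part of a sphere.\<close>

lemma upper_chain_attains:
  fixes \<Omega> :: "'a::euclidean_space set"
  assumes \<Omega>: "\<Omega> \<in> lmeasurable" and bdd: "bounded \<Omega>" and f[measurable]: "f \<in> borel_measurable (lebesgue_on \<Omega>)"
    and m: "0 \<le> m" "m \<le> measure (lebesgue_on \<Omega>) \<Omega>"
  shows "\<exists>E\<in>upper_chain \<Omega> f. measure (lebesgue_on \<Omega>) E = m"
proof -
  interpret finite_measure "lebesgue_on \<Omega>" using \<Omega> by (rule finite_measure_lebesgue_on)
  let ?\<mu> = "measure (lebesgue_on \<Omega>)"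
  consider "m = 0" | "m = ?\<mu> \<Omega>" | "0 < m" "m < ?\<mu> \<Omega>" using m by linarith
  then show ?thesis
  proof cases
    case 1 then show ?thesis by (intro bexI[of _ "{}"]) (auto simp: upper_chain_def)
  next
    case 2 then show ?thesis by (intro bexI[of _ "\<Omega>"]) (auto simp: upper_chain_def)
  next
    case 3
    \<comment> \<open>The sign of \<open>t\<close> is reversed because \<open>measure_jump\<close>
      asks for an increasing family.\<close>
    define S where "S t = {x \<in> \<Omega>. f x > - t}" for t
    have Sm: "S t \<in> sets (lebesgue_on \<Omega>)" for t
      using measurable_sets[OF f, of "{- t<..}"] by (simp add: S_def vimage_def Int_def conj_commute)
    have Smono: "S s \<subseteq> S t" if "s \<le> t" for s t using that by (auto simp: S_def)
    have "decseq (\<lambda>n. S (- real n))" by (intro decseq_SucI Smono) simp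
    then have "(\<lambda>n. ?\<mu> (S (- real n))) \<longlonglongrightarrow> ?\<mu> (\<Inter>n. S (- real n))"
      using Sm by (intro finite_Lim_measure_decseq) auto
    moreover have "(\<Inter>n. S (- real n)) = {}"
    proof -
      have "\<exists>n. f x \<le> real n" for x by (rule real_arch_simple)
      then show ?thesis by (auto simp: S_def not_less[symmetric])
    qed
    ultimately have "(\<lambda>n. ?\<mu> (S (- real n))) \<longlonglongrightarrow> 0" by simp
    then have "\<forall>\<^sub>F n in sequentially. ?\<mu> (S (- real n)) < m" using 3(1) by (rule order_tendstoD)
    then obtain n1 where n1: "?\<mu> (S (- real n1)) < m" by (auto simp: eventually_sequentially)
    have "incseq (\<lambda>n. S (real n))" by (intro incseq_SucI Smono) simp
    then have "(\<lambda>n. ?\<mu> (S (real n))) \<longlonglongrightarrow> ?\<mu> (\<Union>n. S (real n))"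
      using Sm by (intro finite_Lim_measure_incseq) auto
    moreover have "(\<Union>n. S (real n)) = \<Omega>"
    proof -
      have "\<exists>n. - f x < real n" for x by (rule reals_Archimedean2)
      then show ?thesis by (auto simp: S_def minus_less_iff)
    qed
    ultimately have "(\<lambda>n. ?\<mu> (S (real n))) \<longlonglongrightarrow> ?\<mu> \<Omega>" by simp
    then have "\<forall>\<^sub>F n in sequentially. m < ?\<mu> (S (real n))" using 3(2) by (rule order_tendstoD)
    then obtain n2 where n2: "m < ?\<mu> (S (real n2))" by (auto simp: eventually_sequentially)
    obtain t where t: "?\<mu> (\<Union>n. S (t - 1 / Suc n)) \<le> m" "m \<le> ?\<mu> (\<Inter>n. S (t + 1 / Suc n))"
      using measure_jump[of S, OF Smono Sm less_imp_le[OF n1] n2] by blast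
    define a where "a = - t"
    define U where "U b = upper_set \<Omega> f a b" for b
    have Um: "U b \<in> sets (lebesgue_on \<Omega>)" for b unfolding U_def by (rule upper_set_measurable[OF f])
    have Umono: "U b \<subseteq> U c" if "b \<le> c" for b c using that by (auto simp: U_def upper_set_def)
    have "(\<Union>n. S (t - 1 / Suc n)) = U 0"
    proof (intro equalityI subsetI)
      fix x assume "x \<in> U 0"
      then have x: "x \<in> \<Omega>" "f x + t > 0" by (auto simp: U_def upper_set_def a_def)
      then obtain n where "inverse (real (Suc n)) < f x + t" using reals_Archimedean by blast
      then have "x \<in> S (t - 1 / Suc n)" using x by (auto simp: S_def inverse_eq_divide)
      then show "x \<in> (\<Union>n. S (t - 1 / Suc n))" by blast
    qed (auto simp: S_def U_def upper_set_def a_def, smt (verit) divide_pos_pos of_nat_0_less_iff zero_less_Suc of_nat_Suc)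
    with t have U0: "?\<mu> (U 0) \<le> m" by simp
    \<comment> \<open>With a radius beyond all of \<open>\<Omega>\<close> the cut is vacuous, so
      \<open>U R\<close> is the full set where \<open>f\<close> is at least
      \<open>a\<close>.\<close>
    obtain R where R: "\<Omega> \<subseteq> ball 0 R" using bdd bounded_subset_ballD by blast
    have "(\<Inter>n. S (t + 1 / Suc n)) \<subseteq> U R"
    proof
      fix x assume x: "x \<in> (\<Inter>n. S (t + 1 / Suc n))"
      then have x\<Omega>: "x \<in> \<Omega>" by (auto simp: S_def)
      have "a \<le> f x"
      proof (rule ccontr)
        assume "\<not> a \<le> f x"
        then obtain n where "inverse (real (Suc n)) < a - f x" using reals_Archimedean[of "a - f x"] by auto
        moreover have "f x > - (t + 1 / Suc n)" using x by (auto simp: S_def)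
        ultimately show False by (simp add: a_def inverse_eq_divide)
      qed
      then show "x \<in> U R" using x\<Omega> R by (auto simp: U_def upper_set_def)
    qed
    then have UR: "m \<le> ?\<mu> (U R)" using t(2) Um by (meson finite_measure_mono order_trans)
    show ?thesis
    \<comment> \<open>\<open>measure_jump\<close> needs a member of measure strictly above
      \<open>m\<close>, so equality at the largest radius is treated separately.\<close>
    proof (cases "?\<mu> (U R) = m")
      case True then show ?thesis by (intro bexI[of _ "U R"]) (auto simp: upper_chain_def U_def)
    next
      case False
      then have "m < ?\<mu> (U R)" using UR by simp
      then obtain b where b: "?\<mu> (\<Union>n. U (b - 1 / Suc n)) \<le> m" "m \<le> ?\<mu> (\<Inter>n. U (b + 1 / Suc n))"
        using measure_jump[of U, OF Umono Um U0] by blast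
      have lower: "U b \<subseteq> (\<Union>n. U (b - 1 / Suc n))"
      proof
        fix x assume x: "x \<in> U b"
        show "x \<in> (\<Union>n. U (b - 1 / Suc n))"
        proof (cases "f x > a")
          case True then show ?thesis using x by (auto simp: U_def upper_set_def)
        next
          case False
          then have "norm x < b" using x by (auto simp: U_def upper_set_def)
          then obtain n where "inverse (real (Suc n)) < b - norm x" using reals_Archimedean[of "b - norm x"] by auto
          then have "x \<in> U (b - 1 / Suc n)" using x by (auto simp: U_def upper_set_def inverse_eq_divide)
          then show ?thesis by blast
        qed
      qed
      have 1: "?\<mu> (U b) \<le> m"
        using finite_measure_mono[OF lower] Um b(1) by (meson order_trans sets.countable_UN image_subset_iff)
      have upper: "(\<Inter>n. U (b + 1 / Suc n)) \<subseteq> U b \<union> (sphere 0 b \<inter> \<Omega>)"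
      proof
        fix x assume x: "x \<in> (\<Inter>n. U (b + 1 / Suc n))"
        then have x\<Omega>: "x \<in> \<Omega>" by (auto simp: U_def upper_set_def)
        show "x \<in> U b \<union> (sphere 0 b \<inter> \<Omega>)"
        proof (cases "f x > a")
          case True then show ?thesis using x\<Omega> by (auto simp: U_def upper_set_def)
        next
          case False
          have fa: "f x = a" and lt: "norm x < b + 1 / Suc n" for n using False x by (auto simp: U_def upper_set_def)
          have "norm x \<le> b"
          proof (rule ccontr)
            assume "\<not> norm x \<le> b"
            then obtain n where "inverse (real (Suc n)) < norm x - b" using reals_Archimedean[of "norm x - b"] by auto
            then show False using lt[of n] by (simp add: inverse_eq_divide)
          qed
          then show ?thesis using fa x\<Omega> by (auto simp: U_def upper_set_def)
        qed
      qed
      have "sphere (0::'a) b \<in> null_sets lebesgue" using negligible_sphere by (simp add: negligible_iff_null_sets)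
      then have "sphere 0 b \<inter> \<Omega> \<in> null_sets lebesgue" using \<Omega> by (intro null_set_Int2) auto
      then have null: "sphere 0 b \<inter> \<Omega> \<in> null_sets (lebesgue_on \<Omega>)" using \<Omega> by (subst null_sets_restrict_space) auto
      have "?\<mu> (\<Inter>n. U (b + 1 / Suc n)) \<le> ?\<mu> (U b \<union> (sphere 0 b \<inter> \<Omega>))"
        using upper Um null by (intro finite_measure_mono) auto
      also have "\<dots> = ?\<mu> (U b)" using measure_Un_null_set[OF Um null] .
      finally have "?\<mu> (U b) = m" using 1 b(2) by simp
      then show ?thesis by (intro bexI[of _ "U b"]) (auto simp: upper_chain_def U_def)
    qed
  qed
qed

text \<open>\<open>A - E\<close> and \<open>E - A\<close> have the same measure, while
  \<open>f\<close> is at most \<open>a\<close> on the first and at least \<open>a\<close> on the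
  second.\<close>

lemma upper_chain_bathtub:
  fixes \<Omega> :: "'a::euclidean_space set"
  assumes \<Omega>: "\<Omega> \<in> lmeasurable" and f[measurable]: "f \<in> borel_measurable (lebesgue_on \<Omega>)" and f0: "\<And>x. 0 \<le> f x"
    and E: "E \<in> upper_chain \<Omega> f" and A[measurable]: "A \<in> sets (lebesgue_on \<Omega>)"
    and eq: "measure (lebesgue_on \<Omega>) A = measure (lebesgue_on \<Omega>) E"
  shows "(\<integral>\<^sup>+x. indicator A x * ennreal (f x) \<partial>lebesgue_on \<Omega>) \<le> (\<integral>\<^sup>+x. indicator E x * ennreal (f x) \<partial>lebesgue_on \<Omega>)"
proof -
  interpret finite_measure "lebesgue_on \<Omega>" using \<Omega> by (rule finite_measure_lebesgue_on)
  let ?\<mu> = "measure (lebesgue_on \<Omega>)"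
  have Em[measurable]: "E \<in> sets (lebesgue_on \<Omega>)" by (rule upper_chain_measurable[OF f E])
  have A\<Omega>: "A \<subseteq> \<Omega>" using sets.sets_into_space[OF A] by simp
  consider "E = {}" | "E = \<Omega>" | a b where "E = upper_set \<Omega> f a b" using E by (auto simp: upper_chain_def)
  then show ?thesis
  proof cases
    case 1
    then have "A \<in> null_sets (lebesgue_on \<Omega>)" using eq by (auto simp: null_sets_def emeasure_eq_measure)
    then have "AE x in lebesgue_on \<Omega>. indicator A x * ennreal (f x) = 0"
      by (rule AE_I') (auto simp: indicator_def split: if_splits)
    then have "(\<integral>\<^sup>+x. indicator A x * ennreal (f x) \<partial>lebesgue_on \<Omega>) = 0"
      by (subst nn_integral_0_iff_AE) measurable
    then show ?thesis by simp
  next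
    case 2
    then show ?thesis using A\<Omega> by (intro nn_integral_mono) (auto simp: indicator_def)
  next
    case 3
    have up: "x \<in> E \<Longrightarrow> a \<le> f x" and low: "x \<in> \<Omega> - E \<Longrightarrow> f x \<le> a" for x
      using 3 by (auto simp: upper_set_def)
    have m: "?\<mu> (A - E) = ?\<mu> (E - A)"
      using eq finite_measure_Diff'[OF A Em] finite_measure_Diff'[OF Em A] by (simp add: Int_commute)
    have split: "(\<integral>\<^sup>+x. indicator B x * ennreal (f x) \<partial>lebesgue_on \<Omega>)
       = (\<integral>\<^sup>+x. indicator (B \<inter> C) x * ennreal (f x) \<partial>lebesgue_on \<Omega>)
       + (\<integral>\<^sup>+x. indicator (B - C) x * ennreal (f x) \<partial>lebesgue_on \<Omega>)"
      if [measurable]: "B \<in> sets (lebesgue_on \<Omega>)" "C \<in> sets (lebesgue_on \<Omega>)" for B C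
      by (subst nn_integral_add[symmetric]) (auto intro!: nn_integral_cong simp: indicator_def)
    have "(\<integral>\<^sup>+x. indicator (A - E) x * ennreal (f x) \<partial>lebesgue_on \<Omega>) \<le> (\<integral>\<^sup>+x. ennreal a * indicator (A - E) x \<partial>lebesgue_on \<Omega>)"
      using A\<Omega> low by (intro nn_integral_mono) (auto simp: indicator_def intro!: ennreal_leI)
    also have "\<dots> = ennreal a * emeasure (lebesgue_on \<Omega>) (A - E)"
      by (rule nn_integral_cmult_indicator) measurable
    also have "\<dots> = ennreal a * emeasure (lebesgue_on \<Omega>) (E - A)" by (simp add: emeasure_eq_measure m)
    also have "\<dots> = (\<integral>\<^sup>+x. ennreal a * indicator (E - A) x \<partial>lebesgue_on \<Omega>)"
      by (rule nn_integral_cmult_indicator[symmetric]) measurable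
    also have "\<dots> \<le> (\<integral>\<^sup>+x. indicator (E - A) x * ennreal (f x) \<partial>lebesgue_on \<Omega>)"
      using up by (intro nn_integral_mono) (auto simp: indicator_def intro!: ennreal_leI)
    finally show ?thesis unfolding split[OF A Em] split[OF Em A]
      by (simp add: Int_commute add_left_mono)
  qed
qed

lemma nn_integral_layer_cake:
  assumes "finite_measure M" and [measurable]: "g \<in> borel_measurable M" "f \<in> borel_measurable M"
  shows "(\<integral>\<^sup>+x. ennreal (g x) * f x \<partial>M) = (\<integral>\<^sup>+t. indicator {0..} t * (\<integral>\<^sup>+x. indicator {x. t < g x} x * f x \<partial>M) \<partial>lborel)"
proof -
  interpret M: finite_measure M by fact
  interpret pair_sigma_finite lborel M ..
  have "(\<integral>\<^sup>+x. ennreal (g x) * f x \<partial>M) = (\<integral>\<^sup>+x. \<integral>\<^sup>+t. indicator {0..<g x} t * f x \<partial>lborel \<partial>M)"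
  proof (rule nn_integral_cong)
    fix x
    show "ennreal (g x) * f x = (\<integral>\<^sup>+t. indicator {0..<g x} t * f x \<partial>lborel)"
      by (cases "0 \<le> g x") (auto simp: nn_integral_multc ennreal_neg)
  qed
  also have "\<dots> = (\<integral>\<^sup>+t. \<integral>\<^sup>+x. indicator {0..<g x} t * f x \<partial>M \<partial>lborel)"
  proof -
    have "(\<lambda>(t, x). (if 0 \<le> t \<and> t < g x then f x else 0)) \<in> borel_measurable (lborel \<Otimes>\<^sub>M M)" by measurable
    moreover have "(\<lambda>(t, x). (if 0 \<le> t \<and> t < g x then f x else 0)) = (\<lambda>(t, x). indicator {0..<g x} t * f x)"
      by (auto simp: indicator_def fun_eq_iff)
    ultimately show ?thesis by (intro Fubini') simp
  qed
  also have "\<dots> = (\<integral>\<^sup>+t. indicator {0..} t * (\<integral>\<^sup>+x. indicator {x. t < g x} x * f x \<partial>M) \<partial>lborel)"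
    by (intro nn_integral_cong) (auto simp: indicator_def intro!: nn_integral_cong)
  finally show ?thesis .
qed

lemma emeasure_lebesgue_on_superlevel:
  "\<Omega> \<in> sets lebesgue \<Longrightarrow> emeasure (lebesgue_on \<Omega>) {x \<in> \<Omega>. P x} = emeasure lebesgue {x \<in> \<Omega>. P x}"
  by (rule emeasure_restrict_space) auto

text \<open>Replace each superlevel set of \<open>g0\<close> by a chain set of the same measure and
  let \<open>h\<close> have these as superlevel sets up to null sets. The layer cake formula reduces
  the maximality of \<open>h\<close> to the bathtub inequality at each level.\<close>

theorem rearrangement_maximizer:
  fixes \<Omega> :: "'a::euclidean_space set"
  assumes \<Omega>: "\<Omega> \<in> lmeasurable" and bdd: "bounded \<Omega>" and f[measurable]: "f \<in> borel_measurable (lebesgue_on \<Omega>)"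
    and f0: "\<And>x. 0 \<le> f x" and g0: "g0 \<in> Linf \<Omega>"
  obtains h where "h \<in> rearrangement_class \<Omega> g0"
    "\<And>g. g \<in> rearrangement_class \<Omega> g0 \<Longrightarrow>
      (\<integral>\<^sup>+x. ennreal (g x) * ennreal (f x) \<partial>lebesgue_on \<Omega>) \<le> (\<integral>\<^sup>+x. ennreal (h x) * ennreal (f x) \<partial>lebesgue_on \<Omega>)"
proof -
  interpret finite_measure "lebesgue_on \<Omega>" using \<Omega> by (rule finite_measure_lebesgue_on)
  let ?\<mu> = "measure (lebesgue_on \<Omega>)"
  have g0m[measurable]: "g0 \<in> borel_measurable (lebesgue_on \<Omega>)" using g0 by (simp add: Linf_def)
  obtain B where B: "AE x in lebesgue_on \<Omega>. \<bar>g0 x\<bar> \<le> B" using g0 by (auto simp: Linf_def)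
  have lev[measurable]: "{x \<in> \<Omega>. t < g x} \<in> sets (lebesgue_on \<Omega>)" if [measurable]: "g \<in> borel_measurable (lebesgue_on \<Omega>)" for g :: "'a \<Rightarrow> real" and t
  proof -
    have "{x \<in> space (lebesgue_on \<Omega>). t < g x} \<in> sets (lebesgue_on \<Omega>)" by measurable
    then show ?thesis by simp
  qed
  define \<mu> where "\<mu> t = ?\<mu> {x \<in> \<Omega>. t < g0 x}" for t
  have \<mu>mono: "\<mu> t \<le> \<mu> s" if "s \<le> t" for s t
    unfolding \<mu>_def using that by (intro finite_measure_mono lev) auto
  have \<mu>B: "\<mu> t = 0" if "B \<le> t" for t
  proof -
    have "{x \<in> \<Omega>. t < g0 x} \<in> null_sets (lebesgue_on \<Omega>)"
      using B that by (subst AE_iff_null_sets[OF lev[OF g0m]]) (auto elim!: eventually_mono)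
    then show ?thesis by (auto simp: \<mu>_def null_sets_def measure_def)
  qed
  \<comment> \<open>The chain set is chosen as a function of the measure alone. Levels with equal
    measure thus receive the same set, without which the family could fail to be nested; measure
    zero receives the empty set, which keeps \<open>h\<close> bounded.\<close>
  have "\<forall>m. \<exists>E. 0 \<le> m \<and> m \<le> ?\<mu> \<Omega> \<longrightarrow> E \<in> upper_chain \<Omega> f \<and> ?\<mu> E = m \<and> (m = 0 \<longrightarrow> E = {})"
  proof
    fix m
    show "\<exists>E. 0 \<le> m \<and> m \<le> ?\<mu> \<Omega> \<longrightarrow> E \<in> upper_chain \<Omega> f \<and> ?\<mu> E = m \<and> (m = 0 \<longrightarrow> E = {})"
    proof (cases "m = 0")
      case True then show ?thesis by (intro exI[of _ "{}"]) (auto simp: upper_chain_def)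
    next
      case False then show ?thesis using upper_chain_attains[OF \<Omega> bdd f, of m] by auto
    qed
  qed
  then obtain E where E: "\<And>m. 0 \<le> m \<Longrightarrow> m \<le> ?\<mu> \<Omega> \<Longrightarrow> E m \<in> upper_chain \<Omega> f"
    "\<And>m. 0 \<le> m \<Longrightarrow> m \<le> ?\<mu> \<Omega> \<Longrightarrow> ?\<mu> (E m) = m" "E 0 = {}"
    by (metis order_refl measure_nonneg)
  have \<mu>range: "0 \<le> \<mu> t" "\<mu> t \<le> ?\<mu> \<Omega>" for t
    unfolding \<mu>_def by (auto intro: finite_measure_mono)
  define F where "F t = E (\<mu> t)" for t
  have Fc: "F t \<in> upper_chain \<Omega> f" and F\<mu>: "?\<mu> (F t) = \<mu> t" for t
    using E \<mu>range by (auto simp: F_def)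
  have Fm[measurable]: "F t \<in> sets (lebesgue_on \<Omega>)" for t using upper_chain_measurable[OF f Fc] .
  have Fmono: "F t \<subseteq> F s" if "s \<le> t" for s t
  proof (cases "\<mu> s = \<mu> t")
    case True then show ?thesis by (simp add: F_def)
  next
    case False
    then have "\<mu> t < \<mu> s" using \<mu>mono[OF that] by simp
    then have "\<not> F s \<subseteq> F t" using finite_measure_mono[of "F s" "F t"] F\<mu> by auto
    then show ?thesis using upper_chain_linear[OF Fc Fc] by blast
  qed
  have FB: "F t = {}" if "B \<le> t" for t using \<mu>B[OF that] E(3) by (simp add: F_def)
  \<comment> \<open>Inserting \<open>0\<close> makes the supremum meaningful and nonnegative at
    points that belong to no \<open>F t\<close>.\<close>
  define h where "h x = Sup (insert 0 {t. 0 \<le> t \<and> x \<in> F t})" for x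
  have le: "t \<le> max 0 B" if "t \<in> insert 0 {t. 0 \<le> t \<and> x \<in> F t}" for t x
    using that FB[of t] by (cases "B \<le> t") auto
  have hb: "bdd_above (insert 0 {t. 0 \<le> t \<and> x \<in> F t})" for x
    using le by (rule bdd_aboveI)
  have h0: "0 \<le> h x" for x unfolding h_def by (rule cSup_upper[OF _ hb]) simp
  have hB: "h x \<le> max 0 B" for x unfolding h_def
    using le by (intro cSup_least) auto
  have hgt: "t < h x \<longleftrightarrow> (\<exists>n. x \<in> F (t + 1 / Suc n))" if t: "0 \<le> t" for t x
  proof
    assume "t < h x"
    then obtain s where s: "s \<in> insert 0 {t. 0 \<le> t \<and> x \<in> F t}" "t < s"
      unfolding h_def using less_cSup_iff[OF _ hb] by auto
    then have "x \<in> F s" using t by auto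
    obtain n where "inverse (real (Suc n)) < s - t" using reals_Archimedean[of "s - t"] s by auto
    then have "t + 1 / Suc n \<le> s" by (simp add: inverse_eq_divide)
    then show "\<exists>n. x \<in> F (t + 1 / Suc n)" using Fmono \<open>x \<in> F s\<close> by blast
  next
    assume "\<exists>n. x \<in> F (t + 1 / Suc n)"
    then obtain n where "x \<in> F (t + 1 / Suc n)" by blast
    then have "t + 1 / Suc n \<le> h x" unfolding h_def using t by (intro cSup_upper[OF _ hb]) auto
    moreover have "t < t + 1 / Suc n" by simp
    ultimately show "t < h x" by linarith
  qed
  have hset: "{x \<in> \<Omega>. t < h x} = (\<Union>n. F (t + 1 / Suc n))" if t: "0 \<le> t" for t
    using hgt[OF t] upper_chain_subset[OF Fc] by blast
  have hm[measurable]: "h \<in> borel_measurable (lebesgue_on \<Omega>)"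
  proof (rule borel_measurableI_greater)
    fix t
    show "{x \<in> space (lebesgue_on \<Omega>). t < h x} \<in> sets (lebesgue_on \<Omega>)"
    proof (cases "0 \<le> t")
      case True then show ?thesis using hset by simp
    next
      case False
      then have "{x \<in> space (lebesgue_on \<Omega>). t < h x} = \<Omega>" using h0 by (auto simp: not_le intro: less_le_trans[of t 0])
      then show ?thesis by simp
    qed
  qed
  \<comment> \<open>A superlevel set of \<open>h\<close> is the union of \<open>F\<close> over
    levels just above \<open>t\<close>; right-continuity of the distribution function of
    \<open>g0\<close> identifies its measure.\<close>
  have h\<mu>: "?\<mu> {x \<in> \<Omega>. t < h x} = \<mu> t" if t: "0 \<le> t" for t
  proof -
    have "incseq (\<lambda>n. F (t + 1 / Suc n))" by (intro incseq_SucI Fmono) (simp add: field_simps)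
    then have "(\<lambda>n. ?\<mu> (F (t + 1 / Suc n))) \<longlonglongrightarrow> ?\<mu> {x \<in> \<Omega>. t < h x}"
      unfolding hset[OF t] by (intro finite_Lim_measure_incseq) auto
    moreover have "(\<lambda>n. \<mu> (t + 1 / Suc n)) \<longlonglongrightarrow> ?\<mu> (\<Union>n. {x \<in> \<Omega>. t + 1 / Suc n < g0 x})"
      unfolding \<mu>_def
    proof (rule finite_Lim_measure_incseq)
      show "incseq (\<lambda>n. {x \<in> \<Omega>. t + 1 / Suc n < g0 x})"
      proof (rule incseq_SucI)
        fix n
        have "1 / real (Suc (Suc n)) \<le> 1 / real (Suc n)" by (simp add: field_simps)
        then show "{x \<in> \<Omega>. t + 1 / Suc n < g0 x} \<subseteq> {x \<in> \<Omega>. t + 1 / Suc (Suc n) < g0 x}"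
          by (auto simp del: of_nat_Suc)
      qed
    qed auto
    moreover have "(\<Union>n. {x \<in> \<Omega>. t + 1 / Suc n < g0 x}) = {x \<in> \<Omega>. t < g0 x}"
    proof (intro equalityI subsetI)
      fix x assume x: "x \<in> {x \<in> \<Omega>. t < g0 x}"
      then obtain n where "inverse (real (Suc n)) < g0 x - t" using reals_Archimedean[of "g0 x - t"] by auto
      then show "x \<in> (\<Union>n. {x \<in> \<Omega>. t + 1 / Suc n < g0 x})" using x by (auto simp: inverse_eq_divide intro!: exI[of _ n])
    next
      fix x assume "x \<in> (\<Union>n. {x \<in> \<Omega>. t + 1 / Suc n < g0 x})"
      then obtain n where "x \<in> \<Omega>" "t + 1 / Suc n < g0 x" by blast
      moreover have "t < t + 1 / Suc n" by simp
      ultimately have "t < g0 x" by linarith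
      with \<open>x \<in> \<Omega>\<close> show "x \<in> {x \<in> \<Omega>. t < g0 x}" by simp
    qed
    ultimately show ?thesis unfolding F\<mu> using LIMSEQ_unique by (auto simp: \<mu>_def)
  qed
  have hG: "h \<in> rearrangement_class \<Omega> g0"
    unfolding rearrangement_class_def Linf_def
  proof (intro CollectI conjI allI impI)
    show "\<exists>B. AE x in lebesgue_on \<Omega>. \<bar>h x\<bar> \<le> B" using h0 hB by (intro exI[of _ "max 0 B"]) auto
    show "AE x in lebesgue_on \<Omega>. 0 \<le> h x" using h0 by simp
    fix t :: real assume "0 \<le> t"
    then have "emeasure (lebesgue_on \<Omega>) {x \<in> \<Omega>. t < h x} = emeasure (lebesgue_on \<Omega>) {x \<in> \<Omega>. t < g0 x}"
      using h\<mu> by (simp add: emeasure_eq_measure \<mu>_def)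
    then show "emeasure lebesgue {x \<in> \<Omega>. t < h x} = emeasure lebesgue {x \<in> \<Omega>. t < g0 x}"
      using \<Omega> by (simp add: emeasure_lebesgue_on_superlevel fmeasurableD)
  qed (rule hm)
  show ?thesis
  proof (rule that[OF hG])
    fix g assume g: "g \<in> rearrangement_class \<Omega> g0"
    then have gm[measurable]: "g \<in> borel_measurable (lebesgue_on \<Omega>)" by (auto simp: rearrangement_class_def Linf_def)
    have "(\<integral>\<^sup>+x. indicator {x. t < g x} x * ennreal (f x) \<partial>lebesgue_on \<Omega>)
      \<le> (\<integral>\<^sup>+x. indicator {x. t < h x} x * ennreal (f x) \<partial>lebesgue_on \<Omega>)" if t: "0 \<le> t" for t
    proof -
      have e: "(\<integral>\<^sup>+x. indicator {x. t < k x} x * ennreal (f x) \<partial>lebesgue_on \<Omega>)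
          = (\<integral>\<^sup>+x. indicator {x \<in> \<Omega>. t < k x} x * ennreal (f x) \<partial>lebesgue_on \<Omega>)" for k :: "'a \<Rightarrow> real"
        by (intro nn_integral_cong) (auto simp: indicator_def)
      have "emeasure (lebesgue_on \<Omega>) {x \<in> \<Omega>. t < g x} = emeasure (lebesgue_on \<Omega>) {x \<in> \<Omega>. t < g0 x}"
        using g t \<Omega> by (simp add: rearrangement_class_def emeasure_lebesgue_on_superlevel fmeasurableD)
      then have "?\<mu> {x \<in> \<Omega>. t < g x} = \<mu> t" by (simp add: \<mu>_def measure_def)
      then have "?\<mu> {x \<in> \<Omega>. t < g x} = ?\<mu> (F t)" by (simp only: F\<mu>)
      then have "(\<integral>\<^sup>+x. indicator {x \<in> \<Omega>. t < g x} x * ennreal (f x) \<partial>lebesgue_on \<Omega>)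
        \<le> (\<integral>\<^sup>+x. indicator (F t) x * ennreal (f x) \<partial>lebesgue_on \<Omega>)"
        using f0 by (intro upper_chain_bathtub[OF \<Omega> f _ Fc lev]) auto
      also have "\<dots> = (\<integral>\<^sup>+x. indicator {x \<in> \<Omega>. t < h x} x * ennreal (f x) \<partial>lebesgue_on \<Omega>)"
      proof (rule nn_integral_cong_AE)
        have sub: "{x \<in> \<Omega>. t < h x} \<subseteq> F t"
        proof -
          have "F (t + 1 / Suc n) \<subseteq> F t" for n by (intro Fmono) simp
          then show ?thesis unfolding hset[OF t] by blast
        qed
        \<comment> \<open>The two sets are nested with equal measure, so passing from the chain set
          to the superlevel set of \<open>h\<close> changes no integral.\<close>
        have "?\<mu> (F t - {x \<in> \<Omega>. t < h x}) = 0"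
          using finite_measure_Diff[OF Fm lev[OF hm] sub] F\<mu> h\<mu>[OF t] by simp
        then have "F t - {x \<in> \<Omega>. t < h x} \<in> null_sets (lebesgue_on \<Omega>)"
          by (auto simp: null_sets_def emeasure_eq_measure)
        then show "AE x in lebesgue_on \<Omega>. indicator (F t) x * ennreal (f x) = indicator {x \<in> \<Omega>. t < h x} x * ennreal (f x)"
          by (rule AE_I') (use sub in \<open>auto simp: indicator_def\<close>)
      qed
      finally show ?thesis unfolding e .
    qed
    then have "indicator {0..} t * (\<integral>\<^sup>+x. indicator {x. t < g x} x * ennreal (f x) \<partial>lebesgue_on \<Omega>)
      \<le> indicator {0..} t * (\<integral>\<^sup>+x. indicator {x. t < h x} x * ennreal (f x) \<partial>lebesgue_on \<Omega>)" for t
      by (cases "0 \<le> t") (auto simp del: indicator_simps intro: mult_left_mono simp: indicator_def[of "{0..}"])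
    then have "(\<integral>\<^sup>+t. indicator {0..} t * (\<integral>\<^sup>+x. indicator {x. t < g x} x * ennreal (f x) \<partial>lebesgue_on \<Omega>) \<partial>lborel)
      \<le> (\<integral>\<^sup>+t. indicator {0..} t * (\<integral>\<^sup>+x. indicator {x. t < h x} x * ennreal (f x) \<partial>lebesgue_on \<Omega>) \<partial>lborel)"
      by (intro nn_integral_mono)
    then show "(\<integral>\<^sup>+x. ennreal (g x) * ennreal (f x) \<partial>lebesgue_on \<Omega>) \<le> (\<integral>\<^sup>+x. ennreal (h x) * ennreal (f x) \<partial>lebesgue_on \<Omega>)"
      using nn_integral_layer_cake[OF finite_measure_axioms gm, of "\<lambda>x. ennreal (f x)"]
        nn_integral_layer_cake[OF finite_measure_axioms hm, of "\<lambda>x. ennreal (f x)"] by simp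
  qed
qed

section \<open>Euler-Lagrange equation and test functions\<close>

lemma abs_spow: "p > 1 \<Longrightarrow> \<bar>spow p t\<bar> = \<bar>t\<bar> powr (p - 1)"
  by (auto simp: spow_def abs_mult sgn_if)

text \<open>The dominating function for differentiation under the integral. The tangents at
  \<open>a\<close> and at \<open>a + t * b\<close> enclose the increment, and both slopes are
  controlled by \<open>|a| + |b|\<close> when \<open>|t| \<le> 1\<close>.\<close>

lemma abs_powr_diff_quotient_bound:
  fixes a b t :: real
  assumes p: "p > 1" and t: "\<bar>t\<bar> \<le> 1" "t \<noteq> 0"
  shows "\<bar>(\<bar>a + t * b\<bar> powr p - \<bar>a\<bar> powr p) / t\<bar> \<le> p * 2 powr p * (\<bar>a\<bar> powr p + \<bar>b\<bar> powr p)"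
proof -
  define c where "c = \<bar>a\<bar> + \<bar>b\<bar>"
  have sp: "\<bar>p * spow p x * b\<bar> \<le> p * c powr p" if "\<bar>x\<bar> \<le> c" for x
  proof -
    have "\<bar>spow p x\<bar> * \<bar>b\<bar> \<le> c powr (p - 1) * c"
      unfolding abs_spow[OF p] using that p by (intro mult_mono powr_mono2) (auto simp: c_def)
    also have "\<dots> = c powr p"
    proof (cases "c = 0")
      case False
      then have "c > 0" by (simp add: c_def)
      then show ?thesis by (simp add: powr_diff)
    qed simp
    finally show ?thesis using p by (simp add: abs_mult mult.assoc)
  qed
  have "\<bar>t * b\<bar> \<le> 1 * \<bar>b\<bar>" unfolding abs_mult using t by (intro mult_right_mono) auto
  then have ab: "\<bar>a + t * b\<bar> \<le> c" unfolding c_def by linarith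
  define X where "X = \<bar>a + t * b\<bar> powr p - \<bar>a\<bar> powr p"
  have lo: "t * (p * spow p a * b) \<le> X"
    using abs_powr_tangent[OF p, of a "a + t * b"] by (simp add: X_def mult_ac)
  have hi: "X \<le> t * (p * spow p (a + t * b) * b)"
    using abs_powr_tangent[OF p, of "a + t * b" a] by (simp add: X_def mult_ac)
  have "\<bar>X\<bar> \<le> \<bar>t\<bar> * (p * c powr p)"
  proof -
    have 1: "\<bar>t * (p * spow p a * b)\<bar> \<le> \<bar>t\<bar> * (p * c powr p)"
      unfolding abs_mult[of t] by (intro mult_left_mono sp) (auto simp: c_def)
    have 2: "\<bar>t * (p * spow p (a + t * b) * b)\<bar> \<le> \<bar>t\<bar> * (p * c powr p)"
      unfolding abs_mult[of t] by (intro mult_left_mono sp ab) auto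
    show ?thesis using lo hi 1 2 by linarith
  qed
  then have "\<bar>X / t\<bar> \<le> p * c powr p" using t by (simp add: field_simps abs_mult)
  also have "\<dots> \<le> p * (2 powr p * (\<bar>a\<bar> powr p + \<bar>b\<bar> powr p))"
    unfolding c_def using p by (intro mult_left_mono powr_add_le) auto
  finally show ?thesis by (simp add: X_def mult.assoc)
qed

lemma integrable_weighted_powr_add:
  fixes a b w :: "'a \<Rightarrow> real"
  assumes p: "p > 0" and [measurable]: "a \<in> borel_measurable M" "b \<in> borel_measurable M" "w \<in> borel_measurable M"
    and int: "integrable M (\<lambda>x. w x * \<bar>a x\<bar> powr p)" "integrable M (\<lambda>x. w x * \<bar>b x\<bar> powr p)"
  shows "integrable M (\<lambda>x. w x * \<bar>a x + t * b x\<bar> powr p)"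
proof (rule Bochner_Integration.integrable_bound)
  show "integrable M (\<lambda>x. 2 powr p * (\<bar>w x * \<bar>a x\<bar> powr p\<bar> + \<bar>t\<bar> powr p * \<bar>w x * \<bar>b x\<bar> powr p\<bar>))"
    using int by (auto intro!: integrable_abs)
  show "AE x in M. norm (w x * \<bar>a x + t * b x\<bar> powr p)
    \<le> norm (2 powr p * (\<bar>w x * \<bar>a x\<bar> powr p\<bar> + \<bar>t\<bar> powr p * \<bar>w x * \<bar>b x\<bar> powr p\<bar>))"
  proof (intro AE_I2)
    fix x
    have "\<bar>a x + t * b x\<bar> powr p \<le> (\<bar>a x\<bar> + \<bar>t * b x\<bar>) powr p" using p by (intro powr_mono2) auto
    also have "\<dots> \<le> 2 powr p * (\<bar>a x\<bar> powr p + \<bar>t * b x\<bar> powr p)" using p by (intro powr_add_le) auto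
    finally have "\<bar>w x\<bar> * \<bar>a x + t * b x\<bar> powr p \<le> \<bar>w x\<bar> * (2 powr p * (\<bar>a x\<bar> powr p + \<bar>t * b x\<bar> powr p))"
      by (intro mult_left_mono) auto
    then show "norm (w x * \<bar>a x + t * b x\<bar> powr p)
      \<le> norm (2 powr p * (\<bar>w x * \<bar>a x\<bar> powr p\<bar> + \<bar>t\<bar> powr p * \<bar>w x * \<bar>b x\<bar> powr p\<bar>))"
      by (simp add: abs_mult powr_mult algebra_simps)
  qed
qed measurable

lemma spow_measurable [measurable]: "spow p \<in> borel_measurable borel"
  unfolding spow_def[abs_def] by measurable

text \<open>Stated for an abstract measure and a weight of any sign so that it serves both the
  energy, on pairs with the kernel as weight, and the mass, on \<open>\<Omega>\<close> with weight
  \<open>g\<close>.\<close>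

lemma deriv_integral_powr:
  fixes a b w :: "'a \<Rightarrow> real"
  assumes p: "p > 1" and [measurable]: "a \<in> borel_measurable M" "b \<in> borel_measurable M" "w \<in> borel_measurable M"
    and int: "integrable M (\<lambda>x. w x * \<bar>a x\<bar> powr p)" "integrable M (\<lambda>x. w x * \<bar>b x\<bar> powr p)"
  shows "integrable M (\<lambda>x. w x * (p * spow p (a x) * b x))" (is ?int)
    and "((\<lambda>t. \<integral>x. w x * \<bar>a x + t * b x\<bar> powr p \<partial>M) has_real_derivative (\<integral>x. w x * (p * spow p (a x) * b x) \<partial>M)) (at 0)" (is ?der)
proof -
  define W where "W x = p * 2 powr p * (\<bar>w x * \<bar>a x\<bar> powr p\<bar> + \<bar>w x * \<bar>b x\<bar> powr p\<bar>)" for x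
  have W: "integrable M W" unfolding W_def using int by (auto intro!: integrable_abs)
  define q where "q t x = w x * ((\<bar>a x + t * b x\<bar> powr p - \<bar>a x\<bar> powr p) / t)" for t x
  have qb: "norm (q t x) \<le> W x" if t: "\<bar>t\<bar> \<le> 1" "t \<noteq> 0" for t x
  proof -
    have "\<bar>w x\<bar> * \<bar>(\<bar>a x + t * b x\<bar> powr p - \<bar>a x\<bar> powr p) / t\<bar> \<le> \<bar>w x\<bar> * (p * 2 powr p * (\<bar>a x\<bar> powr p + \<bar>b x\<bar> powr p))"
      by (intro mult_left_mono abs_powr_diff_quotient_bound p t) auto
    moreover have "W x = \<bar>w x\<bar> * (p * 2 powr p * (\<bar>a x\<bar> powr p + \<bar>b x\<bar> powr p))"
      unfolding W_def by (simp add: abs_mult algebra_simps)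
    ultimately show ?thesis unfolding q_def real_norm_def abs_mult by simp
  qed
  have [measurable]: "q t \<in> borel_measurable M" for t unfolding q_def by measurable
  have qlim: "((\<lambda>t. q t x) \<longlongrightarrow> w x * (p * spow p (a x) * b x)) (at 0)" for x
  proof -
    have "((\<lambda>t. a x + t * b x) has_real_derivative b x) (at 0)" by (auto intro!: derivative_eq_intros)
    moreover have "((\<lambda>y. \<bar>y\<bar> powr p) has_real_derivative p * spow p (a x)) (at (a x + 0 * b x))"
      using abs_powr_deriv[OF p, of "a x"] by simp
    ultimately have "((\<lambda>t. \<bar>a x + t * b x\<bar> powr p) has_real_derivative p * spow p (a x) * b x) (at 0)"
      by (rule DERIV_chain2[rotated])
    then have "((\<lambda>t. (\<bar>a x + t * b x\<bar> powr p - \<bar>a x\<bar> powr p) / t) \<longlongrightarrow> p * spow p (a x) * b x) (at 0)"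
      by (simp add: DERIV_def)
    then show ?thesis unfolding q_def by (intro tendsto_mult tendsto_const)
  qed
  have seq: "(\<lambda>n. \<integral>x. q (X n) x \<partial>M) \<longlonglongrightarrow> (\<integral>x. w x * (p * spow p (a x) * b x) \<partial>M) \<and> ?int"
    if X: "\<And>n. X n \<noteq> 0" "\<And>n. \<bar>X n\<bar> \<le> 1" "X \<longlonglongrightarrow> 0" for X
  proof -
    have lim: "(\<lambda>n. q (X n) x) \<longlonglongrightarrow> w x * (p * spow p (a x) * b x)" for x
      using qlim[of x] X unfolding tendsto_at_iff_sequentially by (auto simp: comp_def)
    have [measurable]: "(\<lambda>x. w x * (p * spow p (a x) * b x)) \<in> borel_measurable M" by measurable
    show ?thesis
    proof
      show "(\<lambda>n. \<integral>x. q (X n) x \<partial>M) \<longlonglongrightarrow> (\<integral>x. w x * (p * spow p (a x) * b x) \<partial>M)"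
        by (rule integral_dominated_convergence[where w=W]) (use W qb X lim in auto)
      show ?int
        by (rule integrable_dominated_convergence[where w=W and s="\<lambda>n. q (X n)"]) (use W qb X lim in auto)
    qed
  qed
  \<comment> \<open>Any null sequence would do; this one extracts integrability of the derivative
    from dominated convergence.\<close>
  have "(\<lambda>n. 1 / real (Suc n)) \<longlonglongrightarrow> 0" by (rule lim_1_over_n[THEN LIMSEQ_Suc])
  then show ?int using seq[of "\<lambda>n. 1 / real (Suc n)"] by auto
  have i0: "integrable M (\<lambda>x. w x * \<bar>a x + t * b x\<bar> powr p)" for t
    using p int by (intro integrable_weighted_powr_add) auto
  have quot: "((\<integral>x. w x * \<bar>a x + t * b x\<bar> powr p \<partial>M) - (\<integral>x. w x * \<bar>a x + 0 * b x\<bar> powr p \<partial>M)) / t = (\<integral>x. q t x \<partial>M)" for t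
    unfolding q_def using i0[of t] int(1) by (simp add: right_diff_distrib)
  show ?der
    unfolding DERIV_def add_0 quot
    unfolding tendsto_at_iff_sequentially
  proof (intro allI impI)
    fix X :: "nat \<Rightarrow> real" assume X: "\<forall>i. X i \<in> UNIV - {0}" "X \<longlonglongrightarrow> 0"
    have "\<forall>\<^sub>F n in sequentially. \<bar>X n\<bar> < 1" using tendsto_rabs[OF X(2)] by (intro order_tendstoD(2)) auto
    then obtain N where N: "\<And>n. n \<ge> N \<Longrightarrow> \<bar>X n\<bar> < 1" by (auto simp: eventually_sequentially)
    have "(\<lambda>n. \<integral>x. q (X (n + N)) x \<partial>M) \<longlonglongrightarrow> (\<integral>x. w x * (p * spow p (a x) * b x) \<partial>M)"
      using seq[of "\<lambda>n. X (n + N)"] X less_imp_le[OF N] LIMSEQ_ignore_initial_segment[OF X(2), of N] by auto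
    then show "((\<lambda>t. \<integral>x. q t x \<partial>M) \<circ> X) \<longlonglongrightarrow> (\<integral>x. w x * (p * spow p (a x) * b x) \<partial>M)"
      unfolding comp_def by (rule LIMSEQ_offset)
  qed
qed

text \<open>A truncated multiple of the distance to the complement: Lipschitz with constant
  \<open>c\<close>, and increasing to the indicator of an open \<open>U\<close> as \<open>c\<close>
  grows. Later lemmas exclude \<open>U = UNIV\<close> because \<open>infdist\<close> to the empty
  set is zero.\<close>

definition bump :: "real \<Rightarrow> 'a::euclidean_space set \<Rightarrow> 'a \<Rightarrow> real" where
  "bump c U x = min 1 (c * infdist x (- U))"

lemma bump_W0:
  fixes \<Omega> :: "'a::euclidean_space set"
  assumes \<Omega>: "open \<Omega>" "bounded \<Omega>" and p: "p > 1" and s: "0 < s" "s < 1"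
    and U: "U \<subseteq> \<Omega>" and c: "c \<ge> 0"
  shows "bump c U \<in> W0 s p \<Omega>"
proof (rule W0_lipschitz[OF \<Omega> p s])
  show "0 \<le> bump c U x" "bump c U x \<le> 1" for x
    using c by (auto simp: bump_def infdist_nonneg)
  show "bump c U x = 0" if "x \<notin> \<Omega>" for x
  proof -
    have "infdist x (- U) = 0" using that U by (intro infdist_zero) auto
    then show ?thesis by (simp add: bump_def)
  qed
  show "\<bar>bump c U x - bump c U y\<bar> \<le> c * norm (x - y)" for x y
  proof -
    have "\<bar>infdist x (-U) - infdist y (-U)\<bar> \<le> dist x y"
      using infdist_triangle[of x "-U" y] infdist_triangle[of y "-U" x] by (simp add: dist_commute abs_le_iff)
    then have "\<bar>c * infdist x (-U) - c * infdist y (-U)\<bar> \<le> c * dist x y"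
      using c by (simp add: right_diff_distrib[symmetric] abs_mult mult_left_mono)
    then show ?thesis by (auto simp: bump_def dist_norm min_def)
  qed
qed (rule c)

lemma bump_pos:
  fixes U :: "'a::euclidean_space set"
  assumes "open U" "U \<noteq> UNIV" "x \<in> U" "c > 0"
  shows "bump c U x > 0"
proof -
  have "closed (-U)" "-U \<noteq> {}" "x \<notin> -U" using assms by auto
  then have "infdist x (-U) > 0" by (rule infdist_pos_not_in_closed)
  then show ?thesis using assms by (simp add: bump_def)
qed

lemma bump_tendsto:
  fixes U :: "'a::euclidean_space set"
  assumes "open U" "U \<noteq> UNIV"
  shows "(\<lambda>n. bump (real n) U x) \<longlonglongrightarrow> indicator U x"
proof (cases "x \<in> U")
  case False
  then have "infdist x (- U) = 0" by (intro infdist_zero) auto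
  then show ?thesis using False by (simp add: bump_def)
next
  case True
  then have d: "infdist x (-U) > 0" using assms by (intro infdist_pos_not_in_closed) auto
  obtain N :: nat where N: "1 / infdist x (-U) \<le> real N" using real_arch_simple by blast
  have "bump (real n) U x = 1" if "n \<ge> N" for n
  proof -
    have "1 / infdist x (-U) \<le> real n" using N that by linarith
    then have "1 \<le> real n * infdist x (-U)" using d by (simp add: field_simps)
    then show ?thesis by (simp add: bump_def)
  qed
  then have "\<forall>\<^sub>F n in sequentially. bump (real n) U x = 1" by (auto simp: eventually_sequentially)
  then show ?thesis using True by (simp add: tendsto_eventually)
qed

lemma bump_range: "c \<ge> 0 \<Longrightarrow> 0 \<le> bump c U x" "bump c U x \<le> 1"
  by (auto simp: bump_def infdist_nonneg)

text \<open>The fundamental lemma of the calculus of variations. Bumps converge to indicators of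
  open sets, and decreasing open sets approximate the set where \<open>h > 0\<close> up to a null
  set; so \<open>h\<close> has integral zero over a set on which it is positive.\<close>

lemma AE_nonpos_if_orthogonal_to_W0:
  fixes \<Omega> :: "'a::euclidean_space set"
  assumes \<Omega>: "open \<Omega>" "bounded \<Omega>" and p: "p > 1" and s: "0 < s" "s < 1"
    and h: "integrable (lebesgue_on \<Omega>) h"
    and zero: "\<And>\<phi>. \<phi> \<in> W0 s p \<Omega> \<Longrightarrow> (\<integral>x. h x * \<phi> x \<partial>lebesgue_on \<Omega>) = 0"
  shows "AE x in lebesgue_on \<Omega>. h x \<le> 0"
proof -
  have hm[measurable]: "h \<in> borel_measurable (lebesgue_on \<Omega>)" using h by auto
  have \<Omega>s: "\<Omega> \<in> sets lebesgue" using \<Omega> by auto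
  have nU: "U \<noteq> UNIV" if "U \<subseteq> \<Omega>" for U
    using \<Omega>(2) bounded_subset[of \<Omega> UNIV] that not_bounded_UNIV by blast
  have indm: "(\<lambda>x. h x * indicator A x) \<in> borel_measurable (lebesgue_on \<Omega>)" if "A \<in> sets lebesgue" for A
  proof -
    have "(indicator A :: 'a \<Rightarrow> real) \<in> borel_measurable (lebesgue_on \<Omega>)"
      using that by (intro measurable_restrict_space1) simp
    then show ?thesis by measurable
  qed
  have openint: "(\<integral>x. h x * indicator U x \<partial>lebesgue_on \<Omega>) = 0" if U: "open U" "U \<subseteq> \<Omega>" for U
  proof -
    have "(\<lambda>n. \<integral>x. h x * bump (real n) U x \<partial>lebesgue_on \<Omega>) \<longlonglongrightarrow> (\<integral>x. h x * indicator U x \<partial>lebesgue_on \<Omega>)"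
    proof (rule integral_dominated_convergence[where w="\<lambda>x. \<bar>h x\<bar>"])
      show "(\<lambda>x. h x * indicator U x) \<in> borel_measurable (lebesgue_on \<Omega>)" using U by (intro indm) auto
      show "(\<lambda>x. h x * bump (real n) U x) \<in> borel_measurable (lebesgue_on \<Omega>)" for n
        using W0_measurable[OF bump_W0[OF \<Omega> p s U(2), of "real n"]]
        by (intro borel_measurable_times hm measurable_restrict_space1) simp
      show "integrable (lebesgue_on \<Omega>) (\<lambda>x. \<bar>h x\<bar>)" using h by simp
      show "AE x in lebesgue_on \<Omega>. (\<lambda>n. h x * bump (real n) U x) \<longlonglongrightarrow> h x * indicator U x"
        using bump_tendsto[OF U(1) nU[OF U(2)]] by (intro AE_I2 tendsto_mult tendsto_const)
      show "AE x in lebesgue_on \<Omega>. norm (h x * bump (real n) U x) \<le> \<bar>h x\<bar>" for n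
        using bump_range[of "real n" U] by (intro AE_I2) (simp add: abs_mult mult_left_le)
    qed
    moreover have "(\<integral>x. h x * bump (real n) U x \<partial>lebesgue_on \<Omega>) = 0" for n
      by (intro zero bump_W0 \<Omega> p s U) simp
    ultimately show ?thesis by (simp add: LIMSEQ_const_iff)
  qed
  define A where "A = {x \<in> \<Omega>. h x > 0}"
  have "{x \<in> space (lebesgue_on \<Omega>). h x > 0} \<in> sets (lebesgue_on \<Omega>)" by measurable
  then have As: "A \<in> sets lebesgue" using \<Omega>s unfolding A_def by (simp add: sets_restrict_space_iff)
  obtain C T where C: "gdelta C" "T \<in> null_sets lebesgue" "A \<union> T = C" "disjnt A T"
    using lebesgue_set_almost_gdelta[OF As] by metis
  obtain F :: "nat \<Rightarrow> 'a set" where F: "\<And>n. open (F n)" "C = \<Inter>(range F)"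
    using C(1) by (auto elim!: gdelta.cases)
  \<comment> \<open>Intersecting with \<open>\<Omega>\<close> keeps the bumps admissible, and finite
    intersections make the open sets decrease to the intersection of all \<open>F k\<close> within
    \<open>\<Omega>\<close>.\<close>
  define V where "V n = \<Omega> \<inter> (\<Inter>k\<le>n. F k)" for n
  have V: "open (V n)" "V n \<subseteq> \<Omega>" for n unfolding V_def using \<Omega> F by (auto intro!: open_Int open_INT)
  have "(\<lambda>n. \<integral>x. h x * indicator (V n) x \<partial>lebesgue_on \<Omega>) \<longlonglongrightarrow> (\<integral>x. h x * indicator A x \<partial>lebesgue_on \<Omega>)"
  proof (rule integral_dominated_convergence[where w="\<lambda>x. \<bar>h x\<bar>"])
    show "(\<lambda>x. h x * indicator A x) \<in> borel_measurable (lebesgue_on \<Omega>)" by (rule indm[OF As])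
    show "(\<lambda>x. h x * indicator (V n) x) \<in> borel_measurable (lebesgue_on \<Omega>)" for n using V by (intro indm) auto
    show "integrable (lebesgue_on \<Omega>) (\<lambda>x. \<bar>h x\<bar>)" using h by simp
    show "AE x in lebesgue_on \<Omega>. norm (h x * indicator (V n) x) \<le> \<bar>h x\<bar>" for n
      by (intro AE_I2) (simp add: indicator_def)
    have "AE x in lebesgue. x \<notin> T" using C(2) by (rule AE_not_in)
    then have "AE x in lebesgue_on \<Omega>. x \<notin> T" using \<Omega>s by (subst AE_restrict_space_iff) auto
    then show "AE x in lebesgue_on \<Omega>. (\<lambda>n. h x * indicator (V n) x) \<longlonglongrightarrow> h x * indicator A x"
    proof (rule AE_mp, intro AE_I2 impI)
      fix x assume x: "x \<in> space (lebesgue_on \<Omega>)" "x \<notin> T"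
      have "(\<lambda>n. indicator (V n) x :: real) \<longlonglongrightarrow> indicator A x"
      proof (cases "x \<in> A")
        case True
        then have "x \<in> V n" for n using C F x by (auto simp: V_def)
        then show ?thesis using True by simp
      next
        case False
        then have "x \<notin> C" using C x by auto
        then obtain k where "x \<notin> F k" using F by auto
        then have "x \<notin> V n" if "n \<ge> k" for n using that by (auto simp: V_def)
        then have "\<forall>\<^sub>F n in sequentially. indicator (V n) x = (0::real)" by (auto simp: eventually_sequentially intro!: exI[of _ k])
        then show ?thesis using False by (simp add: tendsto_eventually)
      qed
      then show "(\<lambda>n. h x * indicator (V n) x) \<longlonglongrightarrow> h x * indicator A x" by (intro tendsto_mult tendsto_const)
    qed
  qed
  then have "(\<integral>x. h x * indicator A x \<partial>lebesgue_on \<Omega>) = 0" using openint[OF V] by (simp add: LIMSEQ_const_iff)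
  moreover have "integrable (lebesgue_on \<Omega>) (\<lambda>x. h x * indicator A x)"
    by (rule Bochner_Integration.integrable_bound[OF h indm[OF As]]) (auto simp: indicator_def)
  ultimately have "AE x in lebesgue_on \<Omega>. h x * indicator A x = 0"
    by (subst integral_nonneg_eq_0_iff_AE[symmetric]) (auto simp: A_def indicator_def)
  then show ?thesis
    by (rule AE_mp) (auto intro!: AE_I2 simp: A_def indicator_def not_less split: if_splits)
qed

lemma AE_zero_if_orthogonal_to_W0:
  fixes \<Omega> :: "'a::euclidean_space set"
  assumes \<Omega>: "open \<Omega>" "bounded \<Omega>" and p: "p > 1" and s: "0 < s" "s < 1"
    and h: "integrable (lebesgue_on \<Omega>) h"
    and zero: "\<And>\<phi>. \<phi> \<in> W0 s p \<Omega> \<Longrightarrow> (\<integral>x. h x * \<phi> x \<partial>lebesgue_on \<Omega>) = 0"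
  shows "AE x in lebesgue_on \<Omega>. h x = 0"
proof -
  have "AE x in lebesgue_on \<Omega>. h x \<le> 0" by (rule AE_nonpos_if_orthogonal_to_W0[OF \<Omega> p s h zero])
  moreover have "AE x in lebesgue_on \<Omega>. - h x \<le> 0"
    using h zero by (intro AE_nonpos_if_orthogonal_to_W0[OF \<Omega> p s]) auto
  ultimately show ?thesis by eventually_elim auto
qed

section \<open>Extremal functions\<close>

lemma AE_lebesgue_pair:
  assumes "AE z in (lebesgue :: ('a::euclidean_space \<times> 'b::euclidean_space) measure). P (fst z) (snd z)"
  shows "AE x in lebesgue. AE y in lebesgue. P x y"
proof -
  have "AE z in (lborel \<Otimes>\<^sub>M lborel :: ('a \<times> 'b) measure). P (fst z) (snd z)"
    using assms unfolding AE_completion_iff lborel_prod .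
  then have "AE x in lborel. AE y in lborel. P x y"
    by (rule lborel_pair.AE_pair[where Q="\<lambda>z. P (fst z) (snd z)", simplified])
  then show ?thesis unfolding AE_completion_iff .
qed

text \<open>Here \<open>a\<close>, \<open>b\<close> are values of a function at two points and
  \<open>c\<close>, \<open>d\<close> those of a competitor bounded by \<open>e\<close>. The maximum
  is 1-Lipschitz for the larger of the two differences, which gives the estimate without gain. If
  \<open>a = 0\<close> and \<open>b \<ge> e\<close>, the maximum only lifts the lower value, and the
  power falls by at least \<open>c * b powr (p - 1)\<close>.\<close>

lemma max_energy_pointwise:
  fixes a b c d :: real
  assumes p: "p > 1" and nn: "0 \<le> c" "c \<le> e" "0 \<le> d" "d \<le> e"
  shows "\<bar>max a c - max b d\<bar> powr p + (if a = 0 \<and> e \<le> b then c * b powr (p - 1) else 0)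
    \<le> \<bar>a - b\<bar> powr p + \<bar>c - d\<bar> powr p"
proof (cases "a = 0 \<and> e \<le> b")
  case False
  have "\<bar>max a c - max b d\<bar> \<le> max \<bar>a - b\<bar> \<bar>c - d\<bar>" by linarith
  then have "\<bar>max a c - max b d\<bar> powr p \<le> max \<bar>a - b\<bar> \<bar>c - d\<bar> powr p" using p by (intro powr_mono2) auto
  also have "\<dots> \<le> \<bar>a - b\<bar> powr p + \<bar>c - d\<bar> powr p" by (simp add: max_def)
  finally show ?thesis using False by auto
next
  case True
  show ?thesis
  proof (cases "b = 0")
    case True
    then have "c = 0" "d = 0" using \<open>a = 0 \<and> e \<le> b\<close> nn by auto
    then show ?thesis using True p \<open>a = 0 \<and> e \<le> b\<close> by auto
  next
    case False
    then have b: "b > 0" using True nn by linarith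
    have "(b - c) powr p \<le> b powr p - c * b powr (p - 1)"
    proof (cases "c = b")
      case True
      then show ?thesis using b p by (simp add: powr_diff)
    next
      case False
      then have bc: "b - c > 0" using \<open>a = 0 \<and> e \<le> b\<close> nn by linarith
      have "(b - c) powr p = (b - c) * (b - c) powr (p - 1)" using bc by (simp add: powr_diff)
      also have "\<dots> \<le> (b - c) * b powr (p - 1)"
        using bc nn p by (intro mult_left_mono powr_mono2) auto
      also have "\<dots> = b * b powr (p - 1) - c * b powr (p - 1)" by (rule left_diff_distrib)
      also have "b * b powr (p - 1) = b powr p" using b by (simp add: powr_diff)
      finally show ?thesis .
    qed
    moreover have "max a c = c" "max b d = b" using True nn by auto
    moreover have "\<bar>c - b\<bar> = b - c" "\<bar>a - b\<bar> = b" using True nn b by auto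
    ultimately have "\<bar>max a c - max b d\<bar> powr p + c * b powr (p - 1) \<le> \<bar>a - b\<bar> powr p"
      using True by (simp add: abs_minus_commute)
    then have "\<bar>max a c - max b d\<bar> powr p + c * b powr (p - 1) \<le> \<bar>a - b\<bar> powr p + \<bar>c - d\<bar> powr p"
      using powr_ge_zero[of "\<bar>c - d\<bar>" p] by linarith
    then show ?thesis using True by simp
  qed
qed

section \<open>The energy with kernel, the weighted mass, and functions that are extremal for their
  ratio\<close>

locale nonlocal_energy =
  fixes \<Omega> :: "'a::euclidean_space set" and p s C1 C2 :: real and K :: "'a \<Rightarrow> 'a \<Rightarrow> real"
  assumes \<Omega>: "open \<Omega>" "bounded \<Omega>"
    and p: "p > 1" and s: "0 < s" "s < 1"
    and K: "(\<lambda>(x, y). K x y) \<in> borel_measurable lebesgue" and C: "0 < C1" "C1 \<le> C2"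
    and Kbnd: "AE (x, y) in lebesgue. C1 \<le> K x y * norm (x - y) powr (real DIM('a) + p * s) \<and>
           K x y * norm (x - y) powr (real DIM('a) + p * s) \<le> C2"
begin

abbreviation "k z \<equiv> K (fst z) (snd z)"
abbreviation "df u z \<equiv> (u (fst z) - u (snd z) :: real)"
abbreviation "W \<equiv> W0 s p \<Omega>"

definition energy :: "('a \<Rightarrow> real) \<Rightarrow> real" where
  "energy u = (\<integral>z. k z * \<bar>df u z\<bar> powr p \<partial>lebesgue)"

definition mass :: "('a \<Rightarrow> real) \<Rightarrow> ('a \<Rightarrow> real) \<Rightarrow> real" where
  "mass g u = (\<integral>x. g x * \<bar>u x\<bar> powr p \<partial>lebesgue_on \<Omega>)"

lemma p0: "p > 0" using p by simp

lemma \<Omega>_sets: "\<Omega> \<in> sets lebesgue" using \<Omega> by auto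

lemma \<Omega>_lmeasurable: "\<Omega> \<in> lmeasurable" using \<Omega> by (simp add: lmeasurable_open)

lemma \<Omega>_not_UNIV: "\<Omega> \<noteq> UNIV" using \<Omega>(2) not_bounded_UNIV by auto

lemma finite_\<Omega>: "finite_measure (lebesgue_on \<Omega>)"
  using \<Omega>_lmeasurable by (rule finite_measure_lebesgue_on)

lemma k_measurable [measurable]: "(\<lambda>z. k z) \<in> borel_measurable lebesgue"
  using K by (simp add: case_prod_beta')

lemma df_measurable: "u \<in> W \<Longrightarrow> (\<lambda>z. df u z) \<in> borel_measurable lebesgue"
  using W0_measurable[of u s p \<Omega>] by measurable

lemma k_bounds: "AE z in lebesgue. fst z \<noteq> snd z \<longrightarrow> C1 / norm (fst z - snd z) powr (real DIM('a) + p * s) \<le> k z \<and>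
   k z \<le> C2 / norm (fst z - snd z) powr (real DIM('a) + p * s) \<and> 0 < k z"
proof -
  have "AE z in lebesgue. C1 \<le> k z * norm (fst z - snd z) powr (real DIM('a) + p * s) \<and> k z * norm (fst z - snd z) powr (real DIM('a) + p * s) \<le> C2"
    using Kbnd by (simp add: case_prod_beta')
  then show ?thesis
  proof (rule AE_mp, intro AE_I2 impI)
    fix z :: "'a \<times> 'a"
    assume *: "C1 \<le> k z * norm (fst z - snd z) powr (real DIM('a) + p * s) \<and> k z * norm (fst z - snd z) powr (real DIM('a) + p * s) \<le> C2" and "fst z \<noteq> snd z"
    then have n: "norm (fst z - snd z) powr (real DIM('a) + p * s) > 0" by simp
    have "0 < k z * norm (fst z - snd z) powr (real DIM('a) + p * s)" using * C by linarith
    then have "0 < k z" using n by (simp add: zero_less_mult_iff)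
    then show "C1 / norm (fst z - snd z) powr (real DIM('a) + p * s) \<le> k z \<and> k z \<le> C2 / norm (fst z - snd z) powr (real DIM('a) + p * s) \<and> 0 < k z"
      using n * by (simp add: field_simps)
  qed
qed

lemma density_bounds: "AE z in lebesgue.
   C1 * (\<bar>df u z\<bar> powr p / norm (fst z - snd z) powr (real DIM('a) + p * s)) \<le> k z * \<bar>df u z\<bar> powr p \<and>
   k z * \<bar>df u z\<bar> powr p \<le> C2 * (\<bar>df u z\<bar> powr p / norm (fst z - snd z) powr (real DIM('a) + p * s))"
  using k_bounds
proof (rule AE_mp, intro AE_I2 impI)
  fix z :: "'a \<times> 'a"
  assume *: "fst z \<noteq> snd z \<longrightarrow> C1 / norm (fst z - snd z) powr (real DIM('a) + p * s) \<le> k z \<and> k z \<le> C2 / norm (fst z - snd z) powr (real DIM('a) + p * s) \<and> 0 < k z"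
  show "C1 * (\<bar>df u z\<bar> powr p / norm (fst z - snd z) powr (real DIM('a) + p * s)) \<le> k z * \<bar>df u z\<bar> powr p \<and>
   k z * \<bar>df u z\<bar> powr p \<le> C2 * (\<bar>df u z\<bar> powr p / norm (fst z - snd z) powr (real DIM('a) + p * s))"
  proof (cases "fst z = snd z")
    case True then show ?thesis by simp
  next
    case False
    then have "C1 / norm (fst z - snd z) powr (real DIM('a) + p * s) \<le> k z"
      "k z \<le> C2 / norm (fst z - snd z) powr (real DIM('a) + p * s)" using * by blast+
    from this[THEN mult_right_mono, OF powr_ge_zero, of "\<bar>df u z\<bar>" p]
    show ?thesis by (simp only: times_divide_eq_left times_divide_eq_right)
  qed
qed

lemma density_nonneg: "AE z in lebesgue. 0 \<le> k z * \<bar>df u z\<bar> powr p"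
  using density_bounds[of u]
proof eventually_elim
  case (elim z)
  have "0 \<le> C1 * (\<bar>df u z\<bar> powr p / norm (fst z - snd z) powr (real DIM('a) + p * s))" using C by simp
  then show ?case using elim by linarith
qed

lemma density_measurable:
  assumes "u \<in> borel_measurable lebesgue"
  shows "(\<lambda>z. k z * \<bar>df u z\<bar> powr p) \<in> borel_measurable lebesgue"
  by (intro borel_measurable_times k_measurable borel_measurable_lebesgue_diff_powr assms)

lemma nn_energy_bounds:
  assumes u: "u \<in> borel_measurable lebesgue"
  shows "(\<integral>\<^sup>+z. ennreal (k z * \<bar>df u z\<bar> powr p) \<partial>lebesgue) \<le> ennreal C2 * gagliardo s p u"
    and "ennreal C1 * gagliardo s p u \<le> (\<integral>\<^sup>+z. ennreal (k z * \<bar>df u z\<bar> powr p) \<partial>lebesgue)"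
proof -
  let ?g = "\<lambda>z. \<bar>df u z\<bar> powr p / norm (fst z - snd z) powr (real DIM('a) + p * s)"
  have gm: "(\<lambda>z. ennreal (?g z)) \<in> borel_measurable lebesgue"
    by (intro measurable_compose[OF _ measurable_ennreal] borel_measurable_gagliardo u)
  have mult: "(\<integral>\<^sup>+z. ennreal (c * ?g z) \<partial>lebesgue) = ennreal c * gagliardo s p u" if "c \<ge> 0" for c
    unfolding gagliardo_def nn_integral_cmult[OF gm, symmetric] using that
    by (simp add: ennreal_mult del: times_divide_eq_right)
  have "(\<integral>\<^sup>+z. ennreal (k z * \<bar>df u z\<bar> powr p) \<partial>lebesgue) \<le> (\<integral>\<^sup>+z. ennreal (C2 * ?g z) \<partial>lebesgue)"
    using density_bounds[of u] by (intro nn_integral_mono_AE) (elim eventually_mono, blast intro: ennreal_leI)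
  then show "(\<integral>\<^sup>+z. ennreal (k z * \<bar>df u z\<bar> powr p) \<partial>lebesgue) \<le> ennreal C2 * gagliardo s p u"
    using mult[of C2] C by simp
  have "(\<integral>\<^sup>+z. ennreal (C1 * ?g z) \<partial>lebesgue) \<le> (\<integral>\<^sup>+z. ennreal (k z * \<bar>df u z\<bar> powr p) \<partial>lebesgue)"
    using density_bounds[of u] by (intro nn_integral_mono_AE) (elim eventually_mono, blast intro: ennreal_leI)
  then show "ennreal C1 * gagliardo s p u \<le> (\<integral>\<^sup>+z. ennreal (k z * \<bar>df u z\<bar> powr p) \<partial>lebesgue)"
    using mult[of C1] C by simp
qed

lemma density_integrable: "u \<in> W \<Longrightarrow> integrable lebesgue (\<lambda>z. k z * \<bar>df u z\<bar> powr p)"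
proof (rule integrableI_bounded)
  assume u: "u \<in> W"
  show "(\<lambda>z. k z * \<bar>df u z\<bar> powr p) \<in> borel_measurable lebesgue" using W0_measurable[OF u] by (rule density_measurable)
  have "(\<integral>\<^sup>+z. ennreal (norm (k z * \<bar>df u z\<bar> powr p)) \<partial>lebesgue) = (\<integral>\<^sup>+z. ennreal (k z * \<bar>df u z\<bar> powr p) \<partial>lebesgue)"
    using density_nonneg[of u] by (intro nn_integral_cong_AE) (auto elim!: eventually_mono)
  also have "\<dots> \<le> ennreal C2 * gagliardo s p u" using W0_measurable[OF u] by (rule nn_energy_bounds(1))
  also have "\<dots> < \<infinity>" using u by (simp add: W0_iff ennreal_mult_less_top)
  finally show "(\<integral>\<^sup>+z. ennreal (norm (k z * \<bar>df u z\<bar> powr p)) \<partial>lebesgue) < \<infinity>" .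
qed

lemma nn_energy: "u \<in> W \<Longrightarrow> (\<integral>\<^sup>+z. ennreal (k z * \<bar>df u z\<bar> powr p) \<partial>lebesgue) = ennreal (energy u)"
  unfolding energy_def using density_integrable density_nonneg by (intro nn_integral_eq_integral) auto

lemma energy_nonneg: "energy u \<ge> 0"
  unfolding energy_def using density_nonneg by (rule integral_nonneg_AE)

lemma gagliardo_le_energy: assumes u: "u \<in> W" shows "gagliardo s p u \<le> ennreal (energy u / C1)"
proof -
  have "ennreal C1 * gagliardo s p u \<le> (\<integral>\<^sup>+z. ennreal (k z * \<bar>df u z\<bar> powr p) \<partial>lebesgue)"
    using W0_measurable[OF u] by (rule nn_energy_bounds(2))
  then have "ennreal (1/C1) * (ennreal C1 * gagliardo s p u) \<le> ennreal (1/C1) * ennreal (energy u)"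
    unfolding nn_energy[OF u] by (rule mult_left_mono) simp
  then show ?thesis using C energy_nonneg unfolding mult.assoc[symmetric] by (simp add: ennreal_mult[symmetric])
qed

lemma K_norm_powr: "K_norm p K u powr p = energy u"
proof -
  have "K_norm p K u = energy u powr (1 / p)"
    by (simp add: K_norm_def energy_def case_prod_beta' mult.commute)
  then show ?thesis using p energy_nonneg[of u] by (simp add: powr_powr)
qed

text \<open>The weak eigenvalue equation enters part (iii) through this identity: tested with the
  eigenfunction itself, it determines its energy.\<close>

lemma L_K_self: "L_K p K u u = energy u"
proof -
  have "\<bar>t\<bar> powr (p - 2) * t * t = \<bar>t\<bar> powr p" for t :: real
  proof (cases "t = 0")
    case False
    have "t * t = \<bar>t\<bar> powr 2" using False by (simp add: powr_numeral power2_eq_square)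
    then have "\<bar>t\<bar> powr (p - 2) * t * t = \<bar>t\<bar> powr (p - 2) * \<bar>t\<bar> powr 2" by (simp only: mult.assoc)
    also have "\<dots> = \<bar>t\<bar> powr (p - 2 + 2)" by (simp only: powr_add)
    finally show ?thesis by simp
  qed simp
  then show ?thesis by (simp add: L_K_def energy_def case_prod_beta' mult.commute)
qed

lemma energy_scale: "energy (\<lambda>x. c * u x) = \<bar>c\<bar> powr p * energy u"
proof -
  have eq: "k z * \<bar>c * u (fst z) - c * u (snd z)\<bar> powr p = \<bar>c\<bar> powr p * (k z * \<bar>df u z\<bar> powr p)" for z
    by (simp add: right_diff_distrib[symmetric] abs_mult powr_mult)
  show ?thesis unfolding energy_def eq by (rule integral_mult_right_zero)
qed

lemma energy_abs: assumes u: "u \<in> W" shows "energy (\<lambda>x. \<bar>u x\<bar>) \<le> energy u"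
  unfolding energy_def
proof (rule integral_mono_AE)
  show "integrable lebesgue (\<lambda>z. k z * \<bar>\<bar>u (fst z)\<bar> - \<bar>u (snd z)\<bar>\<bar> powr p)"
    using density_integrable[OF W0_abs[OF u p0]] by simp
  show "integrable lebesgue (\<lambda>z. k z * \<bar>df u z\<bar> powr p)" by (rule density_integrable[OF u])
  show "AE z in lebesgue. k z * \<bar>\<bar>u (fst z)\<bar> - \<bar>u (snd z)\<bar>\<bar> powr p \<le> k z * \<bar>df u z\<bar> powr p"
    using k_bounds
  proof eventually_elim
    case (elim z)
    show ?case
    proof (cases "fst z = snd z")
      case False
      have "\<bar>\<bar>u (fst z)\<bar> - \<bar>u (snd z)\<bar>\<bar> powr p \<le> \<bar>df u z\<bar> powr p"
        using p by (intro powr_mono2 abs_triangle_ineq3) auto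
      then show ?thesis using elim False by (intro mult_left_mono) auto
    qed simp
  qed
qed

lemma mass_abs: "mass g (\<lambda>x. \<bar>u x\<bar>) = mass g u" by (simp add: mass_def)

lemma mass_scale: "mass g (\<lambda>x. c * u x) = \<bar>c\<bar> powr p * mass g u"
proof -
  have eq: "g x * \<bar>c * u x\<bar> powr p = \<bar>c\<bar> powr p * (g x * \<bar>u x\<bar> powr p)" for x
    by (simp add: abs_mult powr_mult)
  show ?thesis unfolding mass_def eq by (rule integral_mult_right_zero)
qed

lemma powr_integrable_\<Omega>: "u \<in> W \<Longrightarrow> integrable (lebesgue_on \<Omega>) (\<lambda>x. \<bar>u x\<bar> powr p)"
  using \<Omega>_sets integrable_mult_indicator[of \<Omega> lebesgue "\<lambda>x. \<bar>u x\<bar> powr p"]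
  by (subst integrable_restrict_space) (auto simp: W0_iff)

lemma Linf_mult_integrable:
  assumes g: "g \<in> Linf \<Omega>" and f: "integrable (lebesgue_on \<Omega>) f"
  shows "integrable (lebesgue_on \<Omega>) (\<lambda>x. g x * f x :: real)"
proof -
  obtain B where B: "AE x in lebesgue_on \<Omega>. \<bar>g x\<bar> \<le> B" and gm[measurable]: "g \<in> borel_measurable (lebesgue_on \<Omega>)"
    using g by (auto simp: Linf_def)
  have [measurable]: "f \<in> borel_measurable (lebesgue_on \<Omega>)" using f by auto
  show ?thesis
  proof (rule Bochner_Integration.integrable_bound)
    show "integrable (lebesgue_on \<Omega>) (\<lambda>x. B * f x)" using f by simp
    show "AE x in lebesgue_on \<Omega>. norm (g x * f x) \<le> norm (B * f x)"
      using B by eventually_elim (auto simp: abs_mult intro!: mult_right_mono)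
  qed measurable
qed

lemma mass_integrable: "g \<in> Linf \<Omega> \<Longrightarrow> u \<in> W \<Longrightarrow> integrable (lebesgue_on \<Omega>) (\<lambda>x. g x * \<bar>u x\<bar> powr p)"
  by (intro Linf_mult_integrable powr_integrable_\<Omega>)

lemma W_measurable_\<Omega>: "u \<in> W \<Longrightarrow> u \<in> borel_measurable (lebesgue_on \<Omega>)"
  using W0_measurable[of u s p \<Omega>] by (intro measurable_restrict_space1) auto

lemma mass_nonneg: "AE x in lebesgue_on \<Omega>. 0 \<le> g x \<Longrightarrow> mass g u \<ge> 0"
  unfolding mass_def by (intro integral_nonneg_AE) (auto elim!: eventually_mono)

text \<open>For nonzero mass this says that \<open>u\<close> minimizes the Rayleigh quotient, with minimum \<open>1 / m\<close>.\<close>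

definition extremal :: "real \<Rightarrow> ('a \<Rightarrow> real) \<Rightarrow> ('a \<Rightarrow> real) \<Rightarrow> bool" where
  "extremal m g u \<longleftrightarrow> g \<in> Linf \<Omega> \<and> u \<in> W \<and> mass g u = m * energy u \<and> (\<forall>v\<in>W. mass g v \<le> m * energy v)"

text \<open>\<open>m * energy - mass g\<close> is nonnegative on the whole space and vanishes at
  \<open>u\<close>, so its derivative in every direction is zero. Using the difference in place of
  the quotient avoids dividing by a mass that may vanish.\<close>

lemma extremal_Euler_Lagrange:
  assumes ex: "extremal m g u" and \<phi>: "\<phi> \<in> W"
  shows "integrable (lebesgue_on \<Omega>) (\<lambda>x. g x * (p * spow p (u x) * \<phi> x))"
    and "(\<integral>x. g x * (p * spow p (u x) * \<phi> x) \<partial>lebesgue_on \<Omega>)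
      = m * (\<integral>z. k z * (p * spow p (df u z) * df \<phi> z) \<partial>lebesgue)"
proof -
  have g: "g \<in> Linf \<Omega>" and u: "u \<in> W" and eq: "mass g u = m * energy u"
    and le: "\<And>v. v \<in> W \<Longrightarrow> mass g v \<le> m * energy v" using ex by (auto simp: extremal_def)
  have gm: "g \<in> borel_measurable (lebesgue_on \<Omega>)" using g by (simp add: Linf_def)
  note D1 = deriv_integral_powr[OF p df_measurable[OF u] df_measurable[OF \<phi>] k_measurable density_integrable[OF u] density_integrable[OF \<phi>]]
  note D2 = deriv_integral_powr[OF p W_measurable_\<Omega>[OF u] W_measurable_\<Omega>[OF \<phi>] gm mass_integrable[OF g u] mass_integrable[OF g \<phi>]]
  show "integrable (lebesgue_on \<Omega>) (\<lambda>x. g x * (p * spow p (u x) * \<phi> x))" by (rule D2(1))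
  define D where "D = m * (\<integral>z. k z * (p * spow p (df u z) * df \<phi> z) \<partial>lebesgue)
     - (\<integral>x. g x * (p * spow p (u x) * \<phi> x) \<partial>lebesgue_on \<Omega>)"
  define Q where "Q t = m * (\<integral>z. k z * \<bar>df u z + t * df \<phi> z\<bar> powr p \<partial>lebesgue)
     - (\<integral>x. g x * \<bar>u x + t * \<phi> x\<bar> powr p \<partial>lebesgue_on \<Omega>)" for t
  have Q: "Q t = m * energy (\<lambda>x. u x + t * \<phi> x) - mass g (\<lambda>x. u x + t * \<phi> x)" for t
    by (simp add: Q_def energy_def mass_def algebra_simps)
  have "(Q has_real_derivative D) (at 0)"
    unfolding Q_def D_def by (intro DERIV_diff DERIV_cmult D1(2) D2(2))
  moreover have "Q 0 \<le> Q t" for t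
  proof -
    have "(\<lambda>x. u x + t * \<phi> x) \<in> W" using W0_linear[OF u \<phi> p0, of 1 t] by simp
    then have "0 \<le> Q t" using le by (simp add: Q)
    then show ?thesis using eq by (simp add: Q)
  qed
  ultimately have "D = 0" by (intro DERIV_local_min[of Q D 0 1]) auto
  then show "(\<integral>x. g x * (p * spow p (u x) * \<phi> x) \<partial>lebesgue_on \<Omega>)
      = m * (\<integral>z. k z * (p * spow p (df u z) * df \<phi> z) \<partial>lebesgue)" by (simp add: D_def)
qed

text \<open>The energy side of the Euler-Lagrange equation does not involve the weight. Subtracting
  the two equations shows that \<open>(g - h) * spow p u\<close> is orthogonal to all test
  functions, hence zero.\<close>

lemma extremal_unique_weight:
  assumes g: "extremal m g u" and h: "extremal m h u" and pos: "AE x in lebesgue_on \<Omega>. u x \<noteq> 0"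
  shows "AE x in lebesgue_on \<Omega>. g x = h x"
proof -
  have u: "u \<in> W" using g by (simp add: extremal_def)
  have gi: "g \<in> Linf \<Omega>" and hi: "h \<in> Linf \<Omega>" using g h by (auto simp: extremal_def)
  have um[measurable]: "u \<in> borel_measurable (lebesgue_on \<Omega>)" by (rule W_measurable_\<Omega>[OF u])
  \<comment> \<open>Weights are bounded, so this is the integrability that the fundamental lemma
    asks of \<open>(g - h) * spow p u\<close>.\<close>
  have si: "integrable (lebesgue_on \<Omega>) (\<lambda>x. spow p (u x))"
  proof (rule Bochner_Integration.integrable_bound)
    show "integrable (lebesgue_on \<Omega>) (\<lambda>x. 1 + \<bar>u x\<bar> powr p)"
      using powr_integrable_\<Omega>[OF u] finite_measure.integrable_const[OF finite_\<Omega>, of 1] by auto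
    have "\<bar>t\<bar> powr (p - 1) \<le> 1 + \<bar>t\<bar> powr p" for t :: real
    proof (cases "\<bar>t\<bar> \<le> 1")
      case True
      then have "\<bar>t\<bar> powr (p - 1) \<le> 1" using p by (intro powr_le1) auto
      then show ?thesis by (simp add: add_increasing2)
    next
      case False
      then have "\<bar>t\<bar> powr (p - 1) \<le> \<bar>t\<bar> powr p" by (intro powr_mono) auto
      then show ?thesis by simp
    qed
    then show "AE x in lebesgue_on \<Omega>. norm (spow p (u x)) \<le> norm (1 + \<bar>u x\<bar> powr p)"
      by (simp add: abs_spow[OF p])
  qed measurable
  have "AE x in lebesgue_on \<Omega>. g x * spow p (u x) - h x * spow p (u x) = 0"
  proof (rule AE_zero_if_orthogonal_to_W0[OF \<Omega> p s])
    show "integrable (lebesgue_on \<Omega>) (\<lambda>x. g x * spow p (u x) - h x * spow p (u x))"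
      using Linf_mult_integrable[OF gi si] Linf_mult_integrable[OF hi si] by (rule Bochner_Integration.integrable_diff)
    fix \<phi> assume \<phi>: "\<phi> \<in> W"
    have "(\<integral>x. g x * (p * spow p (u x) * \<phi> x) - h x * (p * spow p (u x) * \<phi> x) \<partial>lebesgue_on \<Omega>) = 0"
      using extremal_Euler_Lagrange[OF g \<phi>] extremal_Euler_Lagrange[OF h \<phi>] by simp
    moreover have "g x * (p * spow p (u x) * \<phi> x) - h x * (p * spow p (u x) * \<phi> x)
       = p * ((g x * spow p (u x) - h x * spow p (u x)) * \<phi> x)" for x by (simp add: algebra_simps)
    ultimately show "(\<integral>x. (g x * spow p (u x) - h x * spow p (u x)) * \<phi> x \<partial>lebesgue_on \<Omega>) = 0"
      using p by simp
  qed
  then show ?thesis using pos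
  proof eventually_elim
    case (elim x)
    then have "(g x - h x) * spow p (u x) = 0" "spow p (u x) \<noteq> 0" by (auto simp: algebra_simps spow_def sgn_if)
    then show ?case by simp
  qed
qed

text \<open>Strong maximum principle, by comparison with \<open>max u (\<epsilon> \<phi>)\<close>: raising \<open>u\<close> on its zero set gains energy
  of order \<open>\<epsilon>\<close> but costs only \<open>\<epsilon>\<^sup>p\<close>.\<close>

lemma extremal_pos:
  assumes ex: "extremal m g u" and m: "m > 0" and g0: "AE x in lebesgue_on \<Omega>. 0 \<le> g x"
    and u0: "\<And>x. 0 \<le> u x" and nz: "\<not> (AE x in lebesgue. u x = 0)"
  shows "AE x in lebesgue_on \<Omega>. u x \<noteq> 0"
proof -
  have g: "g \<in> Linf \<Omega>" and u: "u \<in> W" and eq: "mass g u = m * energy u"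
    and le: "\<And>v. v \<in> W \<Longrightarrow> mass g v \<le> m * energy v" using ex by (auto simp: extremal_def)
  have um[measurable]: "u \<in> borel_measurable lebesgue" by (rule W0_measurable[OF u])
  define \<phi> where "\<phi> = bump 1 \<Omega>"
  have \<phi>: "\<phi> \<in> W" unfolding \<phi>_def using \<Omega> p s by (intro bump_W0) auto
  have \<phi>r: "0 \<le> \<phi> x" "\<phi> x \<le> 1" for x unfolding \<phi>_def by (auto simp: bump_range)
  have [measurable]: "\<phi> \<in> borel_measurable lebesgue" by (rule W0_measurable[OF \<phi>])
  \<comment> \<open>The pointwise energy gain from \<open>max_energy_pointwise\<close>, divided by
    \<open>e\<close>, on pairs joining a zero of \<open>u\<close> to a point where \<open>u\<close>
    is at least \<open>e\<close>.\<close>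
  define G where "G e z = k z * (if u (fst z) = 0 \<and> e \<le> u (snd z) then \<phi> (fst z) * u (snd z) powr (p - 1) else 0)" for e z
  have Gm[measurable]: "G e \<in> borel_measurable lebesgue" for e unfolding G_def by measurable
  have Gle: "(\<integral>\<^sup>+z. ennreal (G e z) \<partial>lebesgue) \<le> ennreal (e powr (p - 1) * energy \<phi>)" if e: "e > 0" for e
  proof -
    define v where "v x = max (u x) (e * \<phi> x)" for x
    have e\<phi>: "(\<lambda>x. e * \<phi> x) \<in> W" using W0_linear[OF \<phi> \<phi> p0, of e 0] by simp
    have v: "v \<in> W" unfolding v_def by (rule W0_max[OF u e\<phi> p0])
    have "mass g u \<le> mass g v"
      unfolding mass_def
    proof (rule integral_mono_AE[OF mass_integrable[OF g u] mass_integrable[OF g v]])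
      show "AE x in lebesgue_on \<Omega>. g x * \<bar>u x\<bar> powr p \<le> g x * \<bar>v x\<bar> powr p"
        using g0
      proof eventually_elim
        case (elim x)
        have "\<bar>u x\<bar> powr p \<le> \<bar>v x\<bar> powr p" using u0[of x] p by (intro powr_mono2) (auto simp: v_def)
        then show ?case using elim by (rule mult_left_mono)
      qed
    qed
    then have "m * energy u \<le> m * energy v" using eq le[OF v] by linarith
    then have uv: "energy u \<le> energy v" using m by simp
    have "ennreal (energy v) + ennreal e * (\<integral>\<^sup>+z. ennreal (G e z) \<partial>lebesgue)
      = (\<integral>\<^sup>+z. ennreal (k z * \<bar>df v z\<bar> powr p) + ennreal e * ennreal (G e z) \<partial>lebesgue)"
      unfolding nn_energy[OF v, symmetric] using density_measurable[OF W0_measurable[OF v]]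
      by (subst nn_integral_add) (auto simp: nn_integral_cmult)
    also have "\<dots> \<le> (\<integral>\<^sup>+z. ennreal (k z * \<bar>df u z\<bar> powr p) + ennreal (k z * \<bar>df (\<lambda>x. e * \<phi> x) z\<bar> powr p) \<partial>lebesgue)"
    proof (rule nn_integral_mono_AE)
      show "AE z in lebesgue. ennreal (k z * \<bar>df v z\<bar> powr p) + ennreal e * ennreal (G e z)
        \<le> ennreal (k z * \<bar>df u z\<bar> powr p) + ennreal (k z * \<bar>df (\<lambda>x. e * \<phi> x) z\<bar> powr p)"
        using k_bounds
      proof eventually_elim
        case (elim z)
        show ?case
        proof (cases "fst z = snd z")
          case True
          then show ?thesis using e by (auto simp: G_def v_def ennreal_eq_0_iff)
        next
          case False
          then have kz: "0 < k z" using elim by simp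
          have eb: "0 \<le> e * \<phi> x" "e * \<phi> x \<le> e" for x using \<phi>r[of x] e by (auto simp: mult_left_le)
          have "\<bar>df v z\<bar> powr p + (if u (fst z) = 0 \<and> e \<le> u (snd z) then e * \<phi> (fst z) * u (snd z) powr (p - 1) else 0)
            \<le> \<bar>df u z\<bar> powr p + \<bar>df (\<lambda>x. e * \<phi> x) z\<bar> powr p"
            unfolding v_def using eb by (intro max_energy_pointwise[OF p]) auto
          then have "k z * (\<bar>df v z\<bar> powr p + (if u (fst z) = 0 \<and> e \<le> u (snd z) then e * \<phi> (fst z) * u (snd z) powr (p - 1) else 0))
            \<le> k z * (\<bar>df u z\<bar> powr p + \<bar>df (\<lambda>x. e * \<phi> x) z\<bar> powr p)"
            using kz by (intro mult_left_mono) auto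
          moreover have "k z * (if u (fst z) = 0 \<and> e \<le> u (snd z) then e * \<phi> (fst z) * u (snd z) powr (p - 1) else 0) = e * G e z"
            by (simp add: G_def)
          ultimately have *: "k z * \<bar>df v z\<bar> powr p + e * G e z
            \<le> k z * \<bar>df u z\<bar> powr p + k z * \<bar>df (\<lambda>x. e * \<phi> x) z\<bar> powr p" unfolding distrib_left by simp
          have "0 \<le> G e z" using kz \<phi>r by (simp add: G_def)
          then show ?thesis using * kz e
            by (simp add: ennreal_mult[symmetric] ennreal_leI flip: ennreal_plus)
        qed
      qed
    qed
    also have "\<dots> = ennreal (energy u) + ennreal (energy (\<lambda>x. e * \<phi> x))"
      unfolding nn_energy[OF u, symmetric] nn_energy[OF e\<phi>, symmetric]
      using density_measurable[OF W0_measurable[OF u]] density_measurable[OF W0_measurable[OF e\<phi>]]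
      by (subst nn_integral_add) auto
    also have "energy (\<lambda>x. e * \<phi> x) = e powr p * energy \<phi>" using e by (simp add: energy_scale)
    finally have "ennreal (energy u) + ennreal e * (\<integral>\<^sup>+z. ennreal (G e z) \<partial>lebesgue)
      \<le> ennreal (energy u) + ennreal (e powr p * energy \<phi>)"
      using uv by (meson add_right_mono ennreal_leI order_trans)
    then have "ennreal e * (\<integral>\<^sup>+z. ennreal (G e z) \<partial>lebesgue) \<le> ennreal (e powr p * energy \<phi>)"
      by (simp add: ennreal_add_left_cancel_le)
    then have "ennreal (1/e) * (ennreal e * (\<integral>\<^sup>+z. ennreal (G e z) \<partial>lebesgue)) \<le> ennreal (1/e) * ennreal (e powr p * energy \<phi>)"
      by (rule mult_left_mono) simp
    moreover have "1 / e * (e powr p * energy \<phi>) = e powr (p - 1) * energy \<phi>" using e by (simp add: powr_diff)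
    ultimately show ?thesis using e energy_nonneg[of \<phi>] unfolding mult.assoc[symmetric]
      by (simp add: ennreal_mult[symmetric] powr_diff)
  qed
  \<comment> \<open>Lowering the threshold only enlarges the set of pairs, so \<open>G c\<close> is
    bounded by \<open>G e\<close> for all smaller \<open>e\<close>; the bound on the latter vanishes
    with \<open>e powr (p - 1)\<close>.\<close>
  have G0: "AE z in lebesgue. ennreal (G c z) = 0" if c: "c > 0" for c
  proof -
    have "(\<integral>\<^sup>+z. ennreal (G c z) \<partial>lebesgue) \<le> ennreal (e powr (p - 1) * energy \<phi>)" if e: "0 < e" "e \<le> c" for e
    proof -
      have "(\<integral>\<^sup>+z. ennreal (G c z) \<partial>lebesgue) \<le> (\<integral>\<^sup>+z. ennreal (G e z) \<partial>lebesgue)"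
      proof (rule nn_integral_mono_AE)
        show "AE z in lebesgue. ennreal (G c z) \<le> ennreal (G e z)"
          using k_bounds
        proof eventually_elim
          case (elim z)
          show ?case
          proof (cases "fst z = snd z")
            case True then show ?thesis using e by (auto simp: G_def)
          next
            case False then show ?thesis using elim e \<phi>r by (auto simp: G_def intro!: ennreal_leI)
          qed
        qed
      qed
      also have "\<dots> \<le> ennreal (e powr (p - 1) * energy \<phi>)" using e by (intro Gle) auto
      finally show ?thesis .
    qed
    then have ev: "\<forall>\<^sub>F e in at_right 0. (\<integral>\<^sup>+z. ennreal (G c z) \<partial>lebesgue) \<le> ennreal (e powr (p - 1) * energy \<phi>)"
      using c unfolding eventually_at_right_field by (intro exI[of _ c]) auto
    have "((\<lambda>e. e powr (p - 1) * energy \<phi>) \<longlongrightarrow> 0 powr (p - 1) * energy \<phi>) (at_right 0)"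
      using p by (intro tendsto_intros tendsto_powr') (auto simp: eventually_at_right_field intro!: exI[of _ 1])
    then have "((\<lambda>e. ennreal (e powr (p - 1) * energy \<phi>)) \<longlongrightarrow> ennreal 0) (at_right 0)"
      by (intro tendsto_ennrealI) simp
    then have "(\<integral>\<^sup>+z. ennreal (G c z) \<partial>lebesgue) \<le> ennreal 0"
      using ev by (intro tendsto_lowerbound) auto
    then have "(\<integral>\<^sup>+z. ennreal (G c z) \<partial>lebesgue) = 0" by simp
    then show ?thesis by (subst (asm) nn_integral_0_iff_AE) auto
  qed
  \<comment> \<open>The thresholds \<open>1 / Suc n\<close> exhaust the condition
    \<open>u (snd z) > 0\<close>.\<close>
  have "AE z in lebesgue. \<forall>n. ennreal (G (1 / Suc n) z) = 0" unfolding AE_all_countable using G0 by simp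
  then have "AE z in lebesgue. u (fst z) = 0 \<and> u (snd z) > 0 \<longrightarrow> \<phi> (fst z) = 0"
    using k_bounds
  proof eventually_elim
    case (elim z)
    show ?case
    proof (rule impI)
      assume a: "u (fst z) = 0 \<and> u (snd z) > 0"
      then obtain n where "inverse (real (Suc n)) < u (snd z)" using reals_Archimedean by blast
      then have n: "1 / Suc n \<le> u (snd z)" by (simp add: inverse_eq_divide)
      have "fst z \<noteq> snd z" using a by auto
      then have "0 < k z" using elim(2) by simp
      moreover have "ennreal (G (1 / Suc n) z) = 0" using elim(1) by blast
      moreover have "G (1 / Suc n) z = k z * (\<phi> (fst z) * u (snd z) powr (p - 1))"
        using a n by (simp add: G_def)
      ultimately have "k z * (\<phi> (fst z) * u (snd z) powr (p - 1)) \<le> 0" by (simp add: ennreal_eq_0_iff)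
      then have "\<phi> (fst z) \<le> 0" using \<open>0 < k z\<close> a by (simp add: mult_le_0_iff)
      then show "\<phi> (fst z) = 0" using \<phi>r(1)[of "fst z"] by simp
    qed
  qed
  \<comment> \<open>Fubini for null sets: at almost every zero \<open>x\<close> of \<open>u\<close>
    in \<open>\<Omega>\<close>, where \<open>\<phi> x > 0\<close>, the function \<open>u\<close>
    would vanish almost everywhere, against \<open>nz\<close>.\<close>
  then have "AE x in lebesgue. AE y in lebesgue. u x = 0 \<and> u y > 0 \<longrightarrow> \<phi> x = 0"
    by (rule AE_lebesgue_pair)
  then have "AE x in lebesgue. u x = 0 \<longrightarrow> x \<notin> \<Omega>"
  proof (rule AE_mp, intro AE_I2 impI)
    fix x assume a: "AE y in lebesgue. u x = 0 \<and> u y > 0 \<longrightarrow> \<phi> x = 0" and ux: "u x = 0"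
    show "x \<notin> \<Omega>"
    proof
      assume "x \<in> \<Omega>"
      then have "\<phi> x > 0" unfolding \<phi>_def using \<Omega> \<Omega>_not_UNIV by (intro bump_pos) auto
      then have "AE y in lebesgue. u y = 0" using a ux u0 by (auto elim!: eventually_mono simp: less_le)
      then show False using nz by simp
    qed
  qed
  then show ?thesis using \<Omega>_sets by (subst AE_restrict_space_iff) (auto elim!: eventually_mono)
qed

end

section \<open>Measure-preserving swaps\<close>

lemma translation_measurable_lebesgue: "(\<lambda>x. x + t :: 'a::euclidean_space) \<in> lebesgue \<rightarrow>\<^sub>M lebesgue"
proof (rule measurableI)
  fix S :: "'a set" assume "S \<in> sets lebesgue"
  then have "(\<lambda>x. - t + x) ` S \<in> sets lebesgue" by (rule lebesgue_sets_translation)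
  moreover have "(\<lambda>x. x + t) -` S \<inter> space lebesgue = (\<lambda>x. - t + x) ` S"
    by (auto intro!: image_eqI[of _ _ "_ + t"])
  ultimately show "(\<lambda>x. x + t) -` S \<inter> space lebesgue \<in> sets lebesgue" by simp
qed simp

lemma emeasure_lebesgue_vimage_translation:
  assumes "S \<in> sets lebesgue"
  shows "emeasure lebesgue ((\<lambda>x. x + t :: 'a::euclidean_space) -` S) = emeasure lebesgue S"
proof -
  have "(\<lambda>x. x + t) -` S = (\<lambda>x. - t + x) ` S" by (auto intro!: image_eqI[of _ _ "_ + t"])
  moreover have "emeasure lebesgue ((\<lambda>x. - t + x) ` S) = emeasure lebesgue S"
    using emeasure_lebesgue_affine[of 1 "- t" S] by simp
  ultimately show ?thesis by simp
qed

definition swap_map :: "'a set \<Rightarrow> 'a \<Rightarrow> 'a \<Rightarrow> 'a::euclidean_space" where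
  "swap_map A t x = (if x \<in> A then x + t else if x - t \<in> A then x - t else x)"

lemma swap_map_involution:
  assumes "\<And>x. x \<in> A \<Longrightarrow> x + t \<notin> A"
  shows "swap_map A t (swap_map A t x) = x"
  using assms[of x] assms[of "x - t"] by (auto simp: swap_map_def)

text \<open>Off \<open>A\<close> and its translate \<open>B\<close> the map is the identity, and on
  each of these it is a translation onto the other. A preimage thus splits into three disjoint
  pieces, measured by translation invariance.\<close>

lemma swap_map_measure_preserving:
  fixes A :: "'a::euclidean_space set"
  assumes A: "A \<in> sets lebesgue" and disj: "\<And>x. x \<in> A \<Longrightarrow> x + t \<notin> A"
  shows "swap_map A t \<in> lebesgue \<rightarrow>\<^sub>M lebesgue" "distr lebesgue lebesgue (swap_map A t) = lebesgue"
proof -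
  define B where "B = (\<lambda>x. x + (- t)) -` A"
  have B: "B \<in> sets lebesgue"
    using measurable_sets[OF translation_measurable_lebesgue A, of "- t"] by (simp add: B_def)
  have AB: "A \<inter> B = {}" using disj by (force simp: B_def)
  have parts: "swap_map A t -` S = (S - A - B) \<union> ((\<lambda>x. x + t) -` (S \<inter> B) \<union> (\<lambda>x. x + (- t)) -` (S \<inter> A))" for S
  proof -
    have "x - t \<notin> A" if "x \<in> A" for x using disj[of "x - t"] that by auto
    then show ?thesis by (auto simp: swap_map_def B_def split: if_splits)
  qed
  have tr: "(\<lambda>x. x + c) -` S \<in> sets lebesgue" if "S \<in> sets lebesgue" for S and c :: 'a
    using measurable_sets[OF translation_measurable_lebesgue that, of c] by simp
  have S: "swap_map A t -` S \<in> sets lebesgue" if "S \<in> sets lebesgue" for S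
    unfolding parts using that A B by (intro sets.Un tr sets.Diff sets.Int) auto
  show meas: "swap_map A t \<in> lebesgue \<rightarrow>\<^sub>M lebesgue"
    using S by (intro measurableI) auto
  show "distr lebesgue lebesgue (swap_map A t) = lebesgue"
  proof (rule measure_eqI)
    fix S assume "S \<in> sets (distr lebesgue lebesgue (swap_map A t))"
    then have Sm: "S \<in> sets lebesgue" by simp
    have sub: "(\<lambda>x. x + t) -` (S \<inter> B) \<subseteq> A" "(\<lambda>x. x + (- t)) -` (S \<inter> A) \<subseteq> B" by (auto simp: B_def)
    have "emeasure lebesgue (swap_map A t -` S) = emeasure lebesgue (S - A - B)
      + (emeasure lebesgue ((\<lambda>x. x + t) -` (S \<inter> B)) + emeasure lebesgue ((\<lambda>x. x + (- t)) -` (S \<inter> A)))"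
    proof -
      have 1: "(\<lambda>x. x + t) -` (S \<inter> B) \<in> sets lebesgue" "(\<lambda>x. x + (- t)) -` (S \<inter> A) \<in> sets lebesgue"
        using Sm A B by - (rule tr, rule sets.Int, assumption+)+
      have "(\<lambda>x. x + t) -` (S \<inter> B) \<inter> (\<lambda>x. x + (- t)) -` (S \<inter> A) = {}" using sub AB by blast
      note 2 = plus_emeasure[OF 1 this]
      have "(S - A - B) \<inter> ((\<lambda>x. x + t) -` (S \<inter> B) \<union> (\<lambda>x. x + (- t)) -` (S \<inter> A)) = {}" using sub by blast
      then show ?thesis unfolding parts 2
        using Sm A B 1 by (intro plus_emeasure[symmetric]) (auto simp del: vimage_Int)
    qed
    also have "\<dots> = emeasure lebesgue (S - A - B) + (emeasure lebesgue (S \<inter> B) + emeasure lebesgue (S \<inter> A))"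
      using Sm A B by (simp only: emeasure_lebesgue_vimage_translation sets.Int)
    also have "\<dots> = emeasure lebesgue S"
    proof -
      have "emeasure lebesgue (S \<inter> B) + emeasure lebesgue (S \<inter> A) = emeasure lebesgue (S \<inter> B \<union> S \<inter> A)"
        using Sm A B AB by (intro plus_emeasure) auto
      moreover have "emeasure lebesgue (S - A - B) + emeasure lebesgue (S \<inter> B \<union> S \<inter> A)
          = emeasure lebesgue ((S - A - B) \<union> (S \<inter> B \<union> S \<inter> A))"
        using Sm A B by (intro plus_emeasure) auto
      moreover have "(S - A - B) \<union> (S \<inter> B \<union> S \<inter> A) = S" by blast
      ultimately show ?thesis by simp
    qed
    finally show "emeasure (distr lebesgue lebesgue (swap_map A t)) S = emeasure lebesgue S"
      using Sm meas by (simp add: emeasure_distr)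
  qed simp
qed

text \<open>The measure of the points of \<open>P\<close> that the shift by \<open>t\<close> carries
  into \<open>Q\<close>, integrated over \<open>t\<close>, is the product of the two measures by
  Tonelli. If it vanished for every shift, one of the sets would be null.\<close>

lemma ex_translate_overlap:
  fixes P Q :: "'a::euclidean_space set"
  assumes P: "P \<in> sets lebesgue" "emeasure lebesgue P \<noteq> 0" and Q: "Q \<in> sets lebesgue" "emeasure lebesgue Q \<noteq> 0"
  obtains A t where "A \<in> sets lebesgue" "emeasure lebesgue A \<noteq> 0" "A \<subseteq> P" "\<And>x. x \<in> A \<Longrightarrow> x + t \<in> Q"
proof -
  \<comment> \<open>Borel parts of full measure, so that Tonelli applies.\<close>
  define P' where "P' = main_part lborel P"
  define Q' where "Q' = main_part lborel Q"
  have P'm[measurable]: "P' \<in> sets borel" and Q'm[measurable]: "Q' \<in> sets borel"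
    using main_part_sets[OF P(1)] main_part_sets[OF Q(1)] by (auto simp: P'_def Q'_def)
  have sub: "P' \<subseteq> P" "Q' \<subseteq> Q"
    using main_part_null_part_Un[OF P(1)] main_part_null_part_Un[OF Q(1)] by (auto simp: P'_def Q'_def)
  have ne: "emeasure lborel P' \<noteq> 0" "emeasure lborel Q' \<noteq> 0"
    using P Q by (auto simp: P'_def Q'_def)
  define A where "A t = {x \<in> P'. x + t \<in> Q'}" for t
  have Am: "A t \<in> sets borel" for t unfolding A_def by measurable
  have "\<exists>t. emeasure lborel (A t) \<noteq> 0"
  proof (rule ccontr)
    assume "\<nexists>t. emeasure lborel (A t) \<noteq> 0"
    then have z: "emeasure lborel (A t) = 0" for t by simp
    have "(\<lambda>z::'a\<times>'a. fst z + snd z) \<in> borel \<rightarrow>\<^sub>M borel" "(snd :: 'a\<times>'a \<Rightarrow> 'a) \<in> borel \<rightarrow>\<^sub>M borel"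
      by (intro borel_measurable_continuous_onI continuous_intros)+
    from measurable_compose[OF this(1), of "indicator Q' :: 'a \<Rightarrow> ennreal" borel] measurable_compose[OF this(2), of "indicator P' :: 'a \<Rightarrow> ennreal" borel]
    have fm: "(\<lambda>z::'a\<times>'a. indicator P' (snd z) * indicator Q' (fst z + snd z) :: ennreal) \<in> borel_measurable (lborel \<Otimes>\<^sub>M lborel)"
      unfolding lborel_prod by (simp add: borel_measurable_times_ennreal)
    have "0 = (\<integral>\<^sup>+t. emeasure lborel (A t) \<partial>lborel)" by (simp add: z)
    also have "\<dots> = (\<integral>\<^sup>+t. \<integral>\<^sup>+x. indicator P' x * indicator Q' (t + x) \<partial>lborel \<partial>lborel)"
    proof (rule nn_integral_cong)
      fix t
      have "emeasure lborel (A t) = (\<integral>\<^sup>+x. indicator (A t) x \<partial>lborel)" using Am by simp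
      also have "\<dots> = (\<integral>\<^sup>+x. indicator P' x * indicator Q' (t + x) \<partial>lborel)"
        by (intro nn_integral_cong) (auto simp: A_def indicator_def add.commute)
      finally show "emeasure lborel (A t) = (\<integral>\<^sup>+x. indicator P' x * indicator Q' (t + x) \<partial>lborel)" .
    qed
    also have "\<dots> = (\<integral>\<^sup>+x. \<integral>\<^sup>+t. indicator P' x * indicator Q' (t + x) \<partial>lborel \<partial>lborel)"
      using lborel_pair.Fubini[OF fm] by simp
    also have "\<dots> = (\<integral>\<^sup>+x. indicator P' x * emeasure lborel Q' \<partial>lborel)"
    proof (rule nn_integral_cong)
      fix x
      have "(\<integral>\<^sup>+t. indicator Q' (t - (- x)) \<partial>lborel) = (\<integral>\<^sup>+t. indicator Q' t \<partial>lborel)"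
        by (rule nn_integral_lborel_diff) simp
      then show "(\<integral>\<^sup>+t. indicator P' x * indicator Q' (t + x) \<partial>lborel) = indicator P' x * emeasure lborel Q'"
        by (cases "x \<in> P'") auto
    qed
    also have "\<dots> = emeasure lborel P' * emeasure lborel Q'" by (subst nn_integral_multc) auto
    finally show False using ne by simp
  qed
  then obtain t where "emeasure lborel (A t) \<noteq> 0" by blast
  then show ?thesis using that[of "A t" t] Am sub by (auto simp: A_def)
qed

text \<open>For the measure-preserving involution \<open>T\<close>, the integral of
  \<open>(G (T x) - G x) * (V x - V (T x))\<close> is twice the gain, and on both swapped sets the
  two factors have the same sign.\<close>

lemma swap_map_gain:
  fixes G V :: "'a::euclidean_space \<Rightarrow> real"
  assumes A: "A \<in> sets lebesgue" and disj: "\<And>x. x \<in> A \<Longrightarrow> x + t \<notin> A"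
    and V: "integrable lebesgue V" and G: "G \<in> borel_measurable lebesgue" "\<And>x. \<bar>G x\<bar> \<le> B"
    and ord: "\<And>x. x \<in> A \<Longrightarrow> G (x + t) \<le> G x \<and> V x \<le> V (x + t)"
  shows "(\<integral>x. G x * V x \<partial>lebesgue) \<le> (\<integral>x. G (swap_map A t x) * V x \<partial>lebesgue)"
proof -
  define T where "T = swap_map A t"
  have Tm[measurable]: "T \<in> lebesgue \<rightarrow>\<^sub>M lebesgue" and Td: "distr lebesgue lebesgue T = lebesgue"
    unfolding T_def by (rule swap_map_measure_preserving[OF A disj]; assumption)+
  have TT: "T (T x) = x" for x unfolding T_def by (rule swap_map_involution[OF disj])
  have [measurable]: "V \<in> borel_measurable lebesgue" "G \<in> borel_measurable lebesgue" using V G by auto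
  have inv: "(\<integral>x. f (T x) \<partial>lebesgue) = (\<integral>x. f x \<partial>lebesgue)" if "f \<in> borel_measurable lebesgue" for f :: "'a \<Rightarrow> real"
    using integral_distr[OF Tm, of f] that Td by simp
  have VT: "integrable lebesgue (\<lambda>x. V (T x))" using integrable_distr_eq[OF Tm, of V] V Td by simp
  have int: "integrable lebesgue (\<lambda>x. H x * U x)"
    if U: "integrable lebesgue U" and [measurable]: "H \<in> borel_measurable lebesgue" and "\<And>x. \<bar>H x\<bar> \<le> B" for H U :: "'a \<Rightarrow> real"
  proof (rule Bochner_Integration.integrable_bound)
    show "integrable lebesgue (\<lambda>x. B * U x)" using U by simp
    show "AE x in lebesgue. norm (H x * U x) \<le> norm (B * U x)"
      using that(3) order_trans[OF that(3) abs_ge_self] by (auto simp: abs_mult intro!: mult_right_mono)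
    have [measurable]: "U \<in> borel_measurable lebesgue" using U by auto
    show "(\<lambda>x. H x * U x) \<in> borel_measurable lebesgue" by measurable
  qed
  have GT[measurable]: "(\<lambda>x. G (T x)) \<in> borel_measurable lebesgue" by measurable
  have i: "integrable lebesgue (\<lambda>x. G x * V x)" "integrable lebesgue (\<lambda>x. G (T x) * V x)"
    "integrable lebesgue (\<lambda>x. G x * V (T x))" "integrable lebesgue (\<lambda>x. G (T x) * V (T x))"
    using V VT G GT by (auto intro!: int)
  have e1: "(\<integral>x. G (T x) * V (T x) \<partial>lebesgue) = (\<integral>x. G x * V x \<partial>lebesgue)"
    by (rule inv) measurable
  have e2: "(\<integral>x. G x * V (T x) \<partial>lebesgue) = (\<integral>x. G (T x) * V x \<partial>lebesgue)"
    using inv[of "\<lambda>x. G (T x) * V x"] by (simp add: TT)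
  have "0 \<le> (\<integral>x. (G (T x) - G x) * (V x - V (T x)) \<partial>lebesgue)"
  proof (rule integral_nonneg_AE, intro AE_I2)
    fix x
    consider "x \<in> A" | "x \<notin> A" "x - t \<in> A" | "x \<notin> A" "x - t \<notin> A" by blast
    then show "0 \<le> (G (T x) - G x) * (V x - V (T x))"
    proof cases
      case 1
      then show ?thesis using ord[OF 1] by (intro mult_nonpos_nonpos) (auto simp: T_def swap_map_def)
    next
      case 2
      then show ?thesis using ord[OF 2(2)] by (intro mult_nonneg_nonneg) (auto simp: T_def swap_map_def)
    qed (simp add: T_def swap_map_def)
  qed
  also have "\<dots> = (\<integral>x. G (T x) * V x - G (T x) * V (T x) - (G x * V x - G x * V (T x)) \<partial>lebesgue)"
    by (intro Bochner_Integration.integral_cong) (auto simp: algebra_simps)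
  also have "\<dots> = 2 * ((\<integral>x. G (T x) * V x \<partial>lebesgue) - (\<integral>x. G x * V x \<partial>lebesgue))"
    using i e1 e2 by simp
  finally show ?thesis by (simp add: T_def)
qed

text \<open>Reduces conditions for a continuum of thresholds to countably many, so that almost
  everywhere statements can be combined. Rationals alone could miss a greatest element of
  \<open>D\<close>, which is therefore added.\<close>

lemma down_closed_countable_cofinal:
  fixes D :: "real set"
  assumes "\<And>s t. s \<le> t \<Longrightarrow> t \<in> D \<Longrightarrow> s \<in> D"
  obtains C where "countable C" "C \<subseteq> D" "\<And>t. t \<in> D \<Longrightarrow> \<exists>c\<in>C. t \<le> c"
proof -
  define C where "C = (D \<inter> \<rat>) \<union> {t \<in> D. \<forall>d\<in>D. d \<le> t}"
  have "a = b" if "a \<in> {t \<in> D. \<forall>d\<in>D. d \<le> t}" "b \<in> {t \<in> D. \<forall>d\<in>D. d \<le> t}" for a b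
    using that by (simp add: antisym)
  then have "{t \<in> D. \<forall>d\<in>D. d \<le> t} = {} \<or> (\<exists>a. {t \<in> D. \<forall>d\<in>D. d \<le> t} = {a})" by blast
  then have "countable {t \<in> D. \<forall>d\<in>D. d \<le> t}"
  proof (elim disjE exE)
    fix a assume "{t \<in> D. \<forall>d\<in>D. d \<le> t} = {a}"
    then show ?thesis by (simp only: countable_insert countable_empty)
  qed (simp only: countable_empty)
  then have "countable C" unfolding C_def by (intro countable_Un countable_Int2 countable_rat)
  moreover have "\<exists>c\<in>C. t \<le> c" if t: "t \<in> D" for t
  proof (cases "\<forall>d\<in>D. d \<le> t")
    case True then show ?thesis using t by (intro bexI[of _ t]) (auto simp: C_def)
  next
    case False
    then obtain d where d: "d \<in> D" "t < d" by auto
    obtain r where r: "r \<in> \<rat>" "t < r" "r < d" using Rats_dense_in_real[OF d(2)] by auto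
    then have "r \<in> D" using assms[of r d] d by auto
    then show ?thesis using r by (intro bexI[of _ r]) (auto simp: C_def)
  qed
  ultimately show ?thesis using that[of C] by (auto simp: C_def)
qed

lemma up_closed_countable_coinitial:
  fixes D :: "real set"
  assumes "\<And>s t. s \<le> t \<Longrightarrow> s \<in> D \<Longrightarrow> t \<in> D"
  obtains C where "countable C" "C \<subseteq> D" "\<And>t. t \<in> D \<Longrightarrow> \<exists>c\<in>C. c \<le> t"
proof -
  obtain C where C: "countable C" "C \<subseteq> uminus ` D" "\<And>t. t \<in> uminus ` D \<Longrightarrow> \<exists>c\<in>C. t \<le> c"
  proof (rule down_closed_countable_cofinal[of "uminus ` D"])
    show "s \<in> uminus ` D" if "s \<le> t" "t \<in> uminus ` D" for s t :: real
      using that assms[of "- t" "- s"] by (auto intro!: image_eqI[of _ _ "- s"])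
  qed blast
  show ?thesis
  proof (rule that[of "uminus ` C"])
    show "\<exists>c\<in>uminus ` C. c \<le> t" if "t \<in> D" for t using C(3)[of "- t"] that by (auto simp: minus_le_iff)
  qed (use C in auto)
qed

text \<open>\<open>\<eta> c\<close> is the least essential upper bound of \<open>g\<close> on the
  set \<open>u \<le> c\<close>, hence monotone in \<open>c\<close>. If some \<open>b\<close> fails
  to be such a bound at \<open>c\<close>, comonotonicity bounds \<open>g\<close> from below on
  \<open>c \<le> u\<close> by every \<open>a < b\<close>; this forces equality. The bounds on
  \<open>g\<close> keep the infimum over a nonempty set bounded below.\<close>

lemma AE_comonotone_imp_function:
  fixes u g :: "'a \<Rightarrow> real"
  assumes bnd: "AE x in M. 0 \<le> g x" "AE x in M. g x \<le> B" "0 \<le> B"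
    and como: "\<And>a b c. a < b \<Longrightarrow> (AE x in M. u x \<le> c \<longrightarrow> g x \<le> b) \<or> (AE x in M. c \<le> u x \<longrightarrow> a \<le> g x)"
  shows "\<exists>\<eta>::real \<Rightarrow> real. mono \<eta> \<and> (AE x in M. g x = \<eta> (u x))"
proof -
  define N where "N b c \<longleftrightarrow> (AE x in M. u x \<le> c \<longrightarrow> g x \<le> b)" for b c
  define S where "S c = {b. 0 \<le> b \<and> N b c}" for c
  define \<eta> where "\<eta> c = Inf (S c)" for c
  have SB: "B \<in> S c" for c using bnd(2,3) by (auto simp: S_def N_def elim!: eventually_mono)
  have Sb: "bdd_below (S c)" for c by (intro bdd_belowI[of _ 0]) (auto simp: S_def)
  have Ndown: "N b s" if "s \<le> t" "N b t" for b s t using that unfolding N_def by (auto elim!: eventually_mono)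
  have Nup: "N b' c" if "b \<le> b'" "N b c" for b b' c using that unfolding N_def by (auto elim!: eventually_mono)
  have mono: "mono \<eta>"
  proof (rule monoI)
    fix s t :: real assume "s \<le> t"
    then have "S t \<subseteq> S s" using Ndown by (auto simp: S_def)
    then show "\<eta> s \<le> \<eta> t" unfolding \<eta>_def using SB[of t] Sb by (intro cInf_superset_mono) auto
  qed
  have "AE x in M. \<forall>b\<in>\<rat>. N b (u x) \<longrightarrow> g x \<le> b"
    unfolding AE_ball_countable[OF countable_rat]
  proof
    fix b :: real
    have "\<And>s t. s \<le> t \<Longrightarrow> t \<in> {t. N b t} \<Longrightarrow> s \<in> {t. N b t}" using Ndown by blast
    then obtain C where C: "countable C" "C \<subseteq> {t. N b t}" "\<And>t. t \<in> {t. N b t} \<Longrightarrow> \<exists>c\<in>C. t \<le> c"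
      using down_closed_countable_cofinal[of "{t. N b t}"] by metis
    have "AE x in M. \<forall>c\<in>C. u x \<le> c \<longrightarrow> g x \<le> b"
      unfolding AE_ball_countable[OF C(1)] using C(2) by (auto simp: N_def)
    then show "AE x in M. N b (u x) \<longrightarrow> g x \<le> b"
      by (elim eventually_mono) (metis C(3) mem_Collect_eq)
  qed
  \<comment> \<open>The levels where \<open>b\<close> fails form an upward closed set, so a
    countable coinitial subset carries all instances of the second alternative.\<close>
  moreover have "AE x in M. \<forall>a\<in>\<rat>. \<forall>b\<in>\<rat>. a < b \<longrightarrow> \<not> N b (u x) \<longrightarrow> a \<le> g x"
    unfolding AE_ball_countable[OF countable_rat]
  proof (intro ballI)
    fix a b :: real
    have "\<And>s t. s \<le> t \<Longrightarrow> s \<in> {t. \<not> N b t} \<Longrightarrow> t \<in> {t. \<not> N b t}" using Ndown by blast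
    then obtain C where C: "countable C" "C \<subseteq> {t. \<not> N b t}" "\<And>t. t \<in> {t. \<not> N b t} \<Longrightarrow> \<exists>c\<in>C. c \<le> t"
      using up_closed_countable_coinitial[of "{t. \<not> N b t}"] by metis
    show "AE x in M. a < b \<longrightarrow> \<not> N b (u x) \<longrightarrow> a \<le> g x"
    proof (cases "a < b")
      case True
      have "AE x in M. \<forall>c\<in>C. c \<le> u x \<longrightarrow> a \<le> g x"
        unfolding AE_ball_countable[OF C(1)] using C(2) como[OF True] by (auto simp: N_def)
      then show ?thesis by (elim eventually_mono) (metis C(3) mem_Collect_eq)
    qed simp
  qed
  ultimately have "AE x in M. g x = \<eta> (u x)" using bnd(1)
  proof eventually_elim
    case (elim x)
    have "g x \<le> \<eta> (u x)"
    proof (rule ccontr)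
      assume "\<not> ?thesis"
      then have "Inf (S (u x)) < g x" by (simp add: \<eta>_def)
      then obtain b where b: "b \<in> S (u x)" "b < g x" using cInf_less_iff[OF _ Sb] SB by blast
      obtain r where r: "r \<in> \<rat>" "b < r" "r < g x" using Rats_dense_in_real[OF b(2)] by blast
      then have "N r (u x)" using b Nup[of b r "u x"] by (auto simp: S_def)
      then show False using elim(1) r by force
    qed
    moreover have "\<eta> (u x) \<le> g x"
    proof (rule ccontr)
      assume "\<not> ?thesis"
      then have gx: "g x < \<eta> (u x)" by simp
      obtain b where b: "b \<in> \<rat>" "g x < b" "b < \<eta> (u x)" using Rats_dense_in_real[OF gx] by blast
      obtain a where a: "a \<in> \<rat>" "g x < a" "a < b" using Rats_dense_in_real[OF b(2)] by blast
      have "\<not> N b (u x)"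
      proof
        assume "N b (u x)"
        then have "b \<in> S (u x)" using elim(3) b by (auto simp: S_def)
        then have "\<eta> (u x) \<le> b" unfolding \<eta>_def by (intro cInf_lower Sb)
        then show False using b by simp
      qed
      then show False using elim(2) a b by force
    qed
    ultimately show ?case by simp
  qed
  with mono show ?thesis by blast
qed

section \<open>Existence of extremals\<close>

text \<open>Quantitative stability of \<open>|t| powr p\<close>: for a relative change of at most
  \<open>\<tau>\<close> the tangent inequality applies, otherwise \<open>|a|\<close> is itself at
  most \<open>|a - b| / \<tau>\<close>. It survives multiplication by a bounded nonnegative weight
  with constants that do not depend on the weight.\<close>

lemma abs_powr_perturb:
  fixes a b p \<tau> :: real
  assumes p: "p > 1" and \<tau>: "\<tau> > 0"
  shows "(1 - p * \<tau>) * \<bar>a\<bar> powr p \<le> \<bar>b\<bar> powr p + \<tau> powr - p * \<bar>a - b\<bar> powr p"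
proof (cases "\<bar>a - b\<bar> \<le> \<tau> * \<bar>a\<bar>")
  case True
  have "- (p * spow p a * (b - a)) \<le> \<bar>p * spow p a * (b - a)\<bar>" by linarith
  also have "\<dots> = p * (\<bar>a\<bar> powr (p - 1) * \<bar>a - b\<bar>)"
    using p by (simp add: abs_mult abs_spow abs_minus_commute)
  also have "\<dots> \<le> p * (\<bar>a\<bar> powr (p - 1) * (\<tau> * \<bar>a\<bar>))"
    using True p by (intro mult_left_mono) auto
  also have "\<dots> = p * \<tau> * \<bar>a\<bar> powr p" by (cases "a = 0") (auto simp: powr_diff)
  finally have "\<bar>a\<bar> powr p - p * \<tau> * \<bar>a\<bar> powr p \<le> \<bar>b\<bar> powr p"
    using abs_powr_tangent[OF p, of a b] by linarith
  moreover have "0 \<le> \<tau> powr - p * \<bar>a - b\<bar> powr p" by simp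
  ultimately show ?thesis unfolding left_diff_distrib by linarith
next
  case False
  have "\<bar>a\<bar> \<le> \<bar>a - b\<bar> / \<tau>" using False \<tau> by (simp add: field_simps)
  then have "\<bar>a\<bar> powr p \<le> (\<bar>a - b\<bar> / \<tau>) powr p" using p by (intro powr_mono2) auto
  also have "\<dots> = \<tau> powr - p * \<bar>a - b\<bar> powr p" using \<tau> by (simp add: powr_divide powr_minus_divide)
  finally have "\<bar>a\<bar> powr p \<le> \<tau> powr - p * \<bar>a - b\<bar> powr p" .
  moreover have "(1 - p * \<tau>) * \<bar>a\<bar> powr p \<le> 1 * \<bar>a\<bar> powr p"
    using p \<tau> by (intro mult_right_mono) auto
  moreover have "0 \<le> \<bar>b\<bar> powr p" by simp
  ultimately show ?thesis by linarith
qed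

text \<open>A half-space given by pairing with an integrable function is weak* closed, so a linear
  inequality that holds on the class passes to its closure.\<close>

lemma rearrangement_closure_pairing:
  assumes g: "g \<in> rearrangement_closure \<Omega> g0"
  shows "g \<in> Linf \<Omega>"
    and "\<And>\<phi> c. \<phi> \<in> L1 \<Omega> \<Longrightarrow> (\<And>h. h \<in> rearrangement_class \<Omega> g0 \<Longrightarrow> (\<integral>x. h x * \<phi> x \<partial>lebesgue_on \<Omega>) \<le> c) \<Longrightarrow>
      (\<integral>x. g x * \<phi> x \<partial>lebesgue_on \<Omega>) \<le> c"
proof -
  let ?F = "\<lambda>g. \<lambda>\<phi>\<in>L1 \<Omega>. \<integral>x. g x * \<phi> x \<partial>lebesgue_on \<Omega>"
  let ?P = "product_topology (\<lambda>_. euclideanreal) (L1 \<Omega>)"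
  have F: "?F h \<in> topspace ?P" for h by simp
  have g': "g \<in> topspace (weak_star_topology \<Omega>)"
    and cl: "\<And>T. g \<in> T \<Longrightarrow> openin (weak_star_topology \<Omega>) T \<Longrightarrow> \<exists>y\<in>rearrangement_class \<Omega> g0. y \<in> T"
    using g unfolding rearrangement_closure_def in_closure_of by auto
  show gL: "g \<in> Linf \<Omega>" using g' by (simp add: weak_star_topology_def topspace_pullback_topology)
  fix \<phi> c assume \<phi>: "\<phi> \<in> L1 \<Omega>" and le: "\<And>h. h \<in> rearrangement_class \<Omega> g0 \<Longrightarrow> (\<integral>x. h x * \<phi> x \<partial>lebesgue_on \<Omega>) \<le> c"
  show "(\<integral>x. g x * \<phi> x \<partial>lebesgue_on \<Omega>) \<le> c"
  proof (rule ccontr)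
    assume n: "\<not> ?thesis"
    define U where "U = {x \<in> topspace ?P. x \<phi> \<in> {c<..}}"
    have "openin ?P U" unfolding U_def
      by (rule openin_continuous_map_preimage[OF continuous_map_product_projection[OF \<phi>]]) simp
    then have "openin (weak_star_topology \<Omega>) (?F -` U \<inter> Linf \<Omega>)"
      unfolding weak_star_topology_def openin_pullback_topology by blast
    moreover have "g \<in> ?F -` U \<inter> Linf \<Omega>" using gL \<phi> n F[of g] by (simp add: U_def)
    ultimately have "\<exists>y\<in>rearrangement_class \<Omega> g0. y \<in> ?F -` U \<inter> Linf \<Omega>" by (intro cl)
    then obtain h where "h \<in> rearrangement_class \<Omega> g0" "h \<in> ?F -` U \<inter> Linf \<Omega>" ..
    then show False using le[of h] \<phi> by (simp add: U_def)
  qed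
qed

lemma rearrangement_class_bounded:
  assumes g0: "g0 \<in> Linf \<Omega>" and \<Omega>: "\<Omega> \<in> sets lebesgue"
  obtains B where "B > 0" "\<And>g. g \<in> rearrangement_class \<Omega> g0 \<Longrightarrow> AE x in lebesgue_on \<Omega>. g x \<le> B"
proof -
  obtain B0 where B0: "AE x in lebesgue_on \<Omega>. \<bar>g0 x\<bar> \<le> B0" using g0 by (auto simp: Linf_def)
  \<comment> \<open>The class fixes the measure of superlevel sets only at nonnegative levels, so
    the bound is made positive.\<close>
  define B where "B = max 1 B0"
  have set: "{x \<in> \<Omega>. B < g x} \<in> sets (lebesgue_on \<Omega>)" if "g \<in> Linf \<Omega>" for g
    using borel_measurable_less[of "\<lambda>_. B" "lebesgue_on \<Omega>" g] that by (auto simp: Linf_def)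
  have "AE x in lebesgue_on \<Omega>. g0 x \<le> B" using B0 by (auto simp: B_def elim!: eventually_mono)
  then have "{x \<in> \<Omega>. B < g0 x} \<in> null_sets (lebesgue_on \<Omega>)"
    by (subst AE_iff_null_sets[OF set[OF g0]]) (auto elim!: eventually_mono)
  then have z: "emeasure lebesgue {x \<in> \<Omega>. B < g0 x} = 0"
    using \<Omega> by (simp add: null_sets_def emeasure_lebesgue_on_superlevel)
  show ?thesis
  proof (rule that[of B])
    show "B > 0" by (simp add: B_def)
    fix g assume g: "g \<in> rearrangement_class \<Omega> g0"
    moreover have "0 \<le> B" by (simp add: B_def)
    ultimately have "emeasure lebesgue {x \<in> \<Omega>. B < g x} = 0" using z by (simp add: rearrangement_class_def)
    then have "{x \<in> \<Omega>. B < g x} \<in> null_sets (lebesgue_on \<Omega>)"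
      using g set[of g] \<Omega> by (auto simp: null_sets_def emeasure_lebesgue_on_superlevel rearrangement_class_def)
    then have "AE x in lebesgue_on \<Omega>. x \<notin> {x \<in> \<Omega>. B < g x}" by (rule AE_not_in)
    then show "AE x in lebesgue_on \<Omega>. g x \<le> B"
      by (rule AE_mp) (auto intro!: AE_I2)
  qed
qed

lemma rearrangement_class_cong_AE:
  assumes h: "h \<in> rearrangement_class \<Omega> g0" and g: "g \<in> Linf \<Omega>" and eq: "AE x in lebesgue_on \<Omega>. g x = h x"
    and \<Omega>: "\<Omega> \<in> sets lebesgue"
  shows "g \<in> rearrangement_class \<Omega> g0"
proof -
  have "AE x in lebesgue_on \<Omega>. 0 \<le> h x" using h by (simp add: rearrangement_class_def)
  then have "AE x in lebesgue_on \<Omega>. 0 \<le> g x" using eq by eventually_elim simp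
  moreover have "emeasure lebesgue {x \<in> \<Omega>. t < g x} = emeasure lebesgue {x \<in> \<Omega>. t < h x}" for t
  proof -
    have m: "{x \<in> \<Omega>. t < f x} \<in> sets (lebesgue_on \<Omega>)" if "f \<in> Linf \<Omega>" for f
      using borel_measurable_less[of "\<lambda>_. t" "lebesgue_on \<Omega>" f] that by (auto simp: Linf_def)
    have "emeasure (lebesgue_on \<Omega>) {x \<in> \<Omega>. t < g x} = emeasure (lebesgue_on \<Omega>) {x \<in> \<Omega>. t < h x}"
      using m[OF g] m[of h] h eq by (intro emeasure_eq_AE) (auto simp: rearrangement_class_def elim!: eventually_mono)
    then show ?thesis using \<Omega> by (simp add: emeasure_lebesgue_on_superlevel)
  qed
  ultimately show ?thesis using h g by (simp add: rearrangement_class_def)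
qed

context nonlocal_energy
begin

text \<open>\<open>W0_compact\<close> only places the limit in the space; the bound with the exact
  constant 1 comes from Fatou's lemma for the energy with kernel.\<close>

lemma energy_bounded_subsequence:
  assumes u: "\<And>n::nat. u n \<in> W" and E: "\<And>n. energy (u n) \<le> 1"
  obtains r v where "strict_mono (r :: nat \<Rightarrow> nat)" "v \<in> W" "energy v \<le> 1"
    "(\<lambda>n. \<integral>x. \<bar>u (r n) x - v x\<bar> powr p \<partial>lebesgue_on \<Omega>) \<longlonglongrightarrow> 0"
proof -
  have gb: "gagliardo s p (u n) \<le> ennreal (1 / C1)" for n
  proof -
    have "gagliardo s p (u n) \<le> ennreal (energy (u n) / C1)" by (rule gagliardo_le_energy[OF u])
    also have "\<dots> \<le> ennreal (1 / C1)" using E[of n] C by (intro ennreal_leI divide_right_mono) auto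
    finally show ?thesis .
  qed
  have C0: "1 / C1 \<ge> 0" using C by simp
  obtain r v where r: "strict_mono (r :: nat \<Rightarrow> nat)" and v: "v \<in> W"
    and lim: "AE x in lebesgue. (\<lambda>n. u (r n) x) \<longlonglongrightarrow> v x"
    and Lp: "(\<lambda>n. \<integral>\<^sup>+x. ennreal (\<bar>u (r n) x - v x\<bar> powr p) \<partial>lebesgue) \<longlonglongrightarrow> 0"
    by (rule W0_compact[where u=u, OF \<Omega> p s(1) u C0 gb]) blast
  have "ennreal (energy v) = (\<integral>\<^sup>+z. liminf (\<lambda>n. ennreal (k z * \<bar>df (u (r n)) z\<bar> powr p)) \<partial>lebesgue)"
    unfolding nn_energy[OF v, symmetric]
  proof (rule nn_integral_cong_AE)
    show "AE z in lebesgue. ennreal (k z * \<bar>df v z\<bar> powr p) = liminf (\<lambda>n. ennreal (k z * \<bar>df (u (r n)) z\<bar> powr p))"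
      using AE_lebesgue_fst[OF lim] AE_lebesgue_snd[OF lim]
    proof eventually_elim
      case (elim z)
      have "(\<lambda>n. ennreal (k z * \<bar>df (u (r n)) z\<bar> powr p)) \<longlonglongrightarrow> ennreal (k z * \<bar>df v z\<bar> powr p)"
        using p0 by (intro tendsto_ennrealI tendsto_mult tendsto_const tendsto_powr' tendsto_intros elim) auto
      then show ?case by (rule lim_imp_Liminf[OF trivial_limit_sequentially, symmetric])
    qed
  qed
  also have "\<dots> \<le> liminf (\<lambda>n. \<integral>\<^sup>+z. ennreal (k z * \<bar>df (u (r n)) z\<bar> powr p) \<partial>lebesgue)"
    using u W0_measurable by (intro nn_integral_liminf measurable_compose[OF _ measurable_ennreal] density_measurable) blast
  also have "\<dots> = liminf (\<lambda>n. ennreal (energy (u (r n))))" by (simp add: nn_energy[OF u])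
  also have "\<dots> \<le> liminf (\<lambda>n. ennreal 1)" using E by (intro Liminf_mono always_eventually allI ennreal_leI)
  finally have Ev: "energy v \<le> 1" by (simp add: Liminf_const del: ennreal_1)
  have di: "(\<lambda>x. u n x - v x) \<in> W" for n using W0_linear[OF u v p0, of 1 n "-1"] by simp
  have "(\<lambda>n. \<integral>x. \<bar>u (r n) x - v x\<bar> powr p \<partial>lebesgue_on \<Omega>) \<longlonglongrightarrow> 0"
  proof (rule tendsto_sandwich[OF _ _ tendsto_const])
    have nn: "(\<integral>\<^sup>+x. ennreal (\<bar>u (r n) x - v x\<bar> powr p) \<partial>lebesgue) = ennreal (\<integral>x. \<bar>u (r n) x - v x\<bar> powr p \<partial>lebesgue)" for n
      using di by (intro nn_integral_eq_integral) (auto simp: W0_iff)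
    show "(\<lambda>n. \<integral>x. \<bar>u (r n) x - v x\<bar> powr p \<partial>lebesgue) \<longlonglongrightarrow> 0"
      using Lp unfolding nn by (subst (asm) tendsto_ennreal_iff[of _ _ 0, simplified]) (auto intro!: always_eventually)
    show "\<forall>\<^sub>F n in sequentially. 0 \<le> (\<integral>x. \<bar>u (r n) x - v x\<bar> powr p \<partial>lebesgue_on \<Omega>)" by simp
    show "\<forall>\<^sub>F n in sequentially. (\<integral>x. \<bar>u (r n) x - v x\<bar> powr p \<partial>lebesgue_on \<Omega>) \<le> (\<integral>x. \<bar>u (r n) x - v x\<bar> powr p \<partial>lebesgue)"
    proof (intro always_eventually allI)
      fix n
      have i: "integrable lebesgue (\<lambda>x. \<bar>u (r n) x - v x\<bar> powr p)" using di by (simp add: W0_iff)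
      have "(\<integral>x. \<bar>u (r n) x - v x\<bar> powr p \<partial>lebesgue_on \<Omega>) = (\<integral>x. indicator \<Omega> x *\<^sub>R \<bar>u (r n) x - v x\<bar> powr p \<partial>lebesgue)"
        using \<Omega>_sets by (intro integral_restrict_space) auto
      also have "\<dots> \<le> (\<integral>x. \<bar>u (r n) x - v x\<bar> powr p \<partial>lebesgue)"
        using i integrable_mult_indicator[OF \<Omega>_sets i] by (intro integral_mono) (auto simp: indicator_def)
      finally show "(\<integral>x. \<bar>u (r n) x - v x\<bar> powr p \<partial>lebesgue_on \<Omega>) \<le> (\<integral>x. \<bar>u (r n) x - v x\<bar> powr p \<partial>lebesgue)" .
    qed
  qed
  with r v Ev show ?thesis by (rule that)
qed

lemma mass_perturb:
  assumes g: "g \<in> Linf \<Omega>" "AE x in lebesgue_on \<Omega>. 0 \<le> g x" "AE x in lebesgue_on \<Omega>. g x \<le> B"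
    and u: "u \<in> W" and v: "v \<in> W" and \<tau>: "\<tau> > 0"
  shows "(1 - p * \<tau>) * mass g u \<le> mass g v + \<tau> powr - p * B * (\<integral>x. \<bar>u x - v x\<bar> powr p \<partial>lebesgue_on \<Omega>)"
proof -
  have d: "(\<lambda>x. u x - v x) \<in> W" using W0_linear[OF u v p0, of 1 "-1"] by simp
  note i = mass_integrable[OF g(1) u] mass_integrable[OF g(1) v] powr_integrable_\<Omega>[OF d]
  have "(1 - p * \<tau>) * mass g u = (\<integral>x. (1 - p * \<tau>) * (g x * \<bar>u x\<bar> powr p) \<partial>lebesgue_on \<Omega>)"
    by (simp add: mass_def)
  also have "\<dots> \<le> (\<integral>x. g x * \<bar>v x\<bar> powr p + \<tau> powr - p * B * \<bar>u x - v x\<bar> powr p \<partial>lebesgue_on \<Omega>)"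
  proof (rule integral_mono_AE)
    show "AE x in lebesgue_on \<Omega>. (1 - p * \<tau>) * (g x * \<bar>u x\<bar> powr p) \<le> g x * \<bar>v x\<bar> powr p + \<tau> powr - p * B * \<bar>u x - v x\<bar> powr p"
      using g(2,3)
    proof eventually_elim
      case (elim x)
      have "g x * ((1 - p * \<tau>) * \<bar>u x\<bar> powr p) \<le> g x * (\<bar>v x\<bar> powr p + \<tau> powr - p * \<bar>u x - v x\<bar> powr p)"
        using elim by (intro mult_left_mono abs_powr_perturb p \<tau>)
      also have "\<dots> = g x * \<bar>v x\<bar> powr p + g x * (\<tau> powr - p * \<bar>u x - v x\<bar> powr p)" by (rule distrib_left)
      also have "\<dots> \<le> g x * \<bar>v x\<bar> powr p + B * (\<tau> powr - p * \<bar>u x - v x\<bar> powr p)"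
        using elim by (intro add_left_mono mult_right_mono) auto
      finally show ?case by (simp add: mult_ac)
    qed
  qed (use i in auto)
  also have "\<dots> = mass g v + \<tau> powr - p * B * (\<integral>x. \<bar>u x - v x\<bar> powr p \<partial>lebesgue_on \<Omega>)"
    using i by (simp add: mass_def)
  finally show ?thesis .
qed

text \<open>The weights need not converge: \<open>H\<close> dominates all of them at the limit
  \<open>v\<close>, and mass stability is uniform over the weights. It is applied with
  \<open>H\<close> the mass for one fixed weight and with \<open>H\<close> the maximal mass over the
  class.\<close>

lemma sup_mass_attained:
  assumes g: "\<And>n. g n \<in> Linf \<Omega>" "\<And>n. AE x in lebesgue_on \<Omega>. 0 \<le> g n x" "\<And>n. AE x in lebesgue_on \<Omega>. g n x \<le> B"
    and u: "\<And>n::nat. u n \<in> W" "\<And>n. energy (u n) \<le> 1" and lim: "(\<lambda>n. mass (g n) (u n)) \<longlonglongrightarrow> m"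
    and H: "\<And>n v. v \<in> W \<Longrightarrow> mass (g n) v \<le> H v"
  obtains v where "v \<in> W" "energy v \<le> 1" "m \<le> H v"
proof -
  obtain r v where r: "strict_mono (r :: nat \<Rightarrow> nat)" and v: "v \<in> W" "energy v \<le> 1"
    and Lp: "(\<lambda>n. \<integral>x. \<bar>u (r n) x - v x\<bar> powr p \<partial>lebesgue_on \<Omega>) \<longlonglongrightarrow> 0"
    by (rule energy_bounded_subsequence[where u=u, OF u]) blast
  have lim': "(\<lambda>n. mass (g (r n)) (u (r n))) \<longlonglongrightarrow> m"
    using LIMSEQ_subseq_LIMSEQ[OF lim r] by (simp add: comp_def)
  \<comment> \<open>For fixed \<open>\<tau>\<close> the error, despite its large constant, vanishes
    along the sequence; \<open>\<tau>\<close> tends to zero only afterwards.\<close>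
  have *: "(1 - p * \<tau>) * m \<le> H v" if \<tau>: "\<tau> > 0" for \<tau>
  proof -
    have "(1 - p * \<tau>) * mass (g (r n)) (u (r n)) \<le> H v + \<tau> powr - p * B * (\<integral>x. \<bar>u (r n) x - v x\<bar> powr p \<partial>lebesgue_on \<Omega>)" for n
      using mass_perturb[OF g u(1) v(1) \<tau>, of "r n" "r n"] H[OF v(1), of "r n"] by linarith
    moreover have "(\<lambda>n. (1 - p * \<tau>) * mass (g (r n)) (u (r n))) \<longlonglongrightarrow> (1 - p * \<tau>) * m"
      by (intro tendsto_intros lim')
    moreover have "(\<lambda>n. H v + \<tau> powr - p * B * (\<integral>x. \<bar>u (r n) x - v x\<bar> powr p \<partial>lebesgue_on \<Omega>)) \<longlonglongrightarrow> H v + \<tau> powr - p * B * 0"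
      by (intro tendsto_intros Lp)
    ultimately have "(1 - p * \<tau>) * m \<le> H v + \<tau> powr - p * B * 0" by (intro LIMSEQ_le) auto
    then show ?thesis by simp
  qed
  have "(\<lambda>n. (1 - p * (1 / real (Suc n))) * m) \<longlonglongrightarrow> (1 - p * 0) * m"
    by (intro tendsto_intros LIMSEQ_Suc lim_1_over_n)
  moreover have "(1 - p * (1 / real (Suc n))) * m \<le> H v" for n by (intro *) simp
  ultimately have "(1 - p * 0) * m \<le> H v" by (intro LIMSEQ_le_const2) blast+
  then show ?thesis using that[of v] v by simp
qed

lemma energy_normalize:
  assumes u: "u \<in> W" and E: "energy u > 0"
  obtains w where "w \<in> W" "energy w = 1" "\<And>g. mass g w = mass g u / energy u"
proof -
  define c where "c = energy u powr (- 1 / p)"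
  have "c powr p = energy u powr - 1" using p by (simp add: c_def powr_powr)
  also have "\<dots> = 1 / energy u" using E by (simp add: powr_minus_divide)
  finally have c: "\<bar>c\<bar> powr p = 1 / energy u" by (simp add: c_def)
  have "(\<lambda>x. c * u x) \<in> W" using W0_linear[OF u u p0, of c 0] by simp
  moreover have "energy (\<lambda>x. c * u x) = 1" using E by (simp add: energy_scale c)
  moreover have "mass g (\<lambda>x. c * u x) = mass g u / energy u" for g by (simp add: mass_scale c)
  ultimately show ?thesis by (rule that)
qed

lemma mass_bound:
  obtains M where "M \<ge> 0" "\<And>g u. g \<in> Linf \<Omega> \<Longrightarrow> AE x in lebesgue_on \<Omega>. g x \<le> B \<Longrightarrow> u \<in> W \<Longrightarrow> mass g u \<le> M * energy u"
proof -
  obtain A where A: "A \<ge> 0" "\<And>u. u \<in> W \<Longrightarrow> (\<integral>\<^sup>+x. ennreal (\<bar>u x\<bar> powr p) \<partial>lebesgue) \<le> ennreal A * gagliardo s p u"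
    using fractional_poincare[OF \<Omega> p s(1)] by metis
  \<comment> \<open>The bound \<open>B\<close> on the weight may be negative, in which case
    \<open>0\<close> replaces it.\<close>
  define M where "M = max 0 B * (A / C1)"
  have "mass g u \<le> M * energy u"
    if g: "g \<in> Linf \<Omega>" "AE x in lebesgue_on \<Omega>. g x \<le> B" and u: "u \<in> W" for g u
  proof -
    have i: "integrable lebesgue (\<lambda>x. \<bar>u x\<bar> powr p)" using u by (simp add: W0_iff)
    have "ennreal (\<integral>x. \<bar>u x\<bar> powr p \<partial>lebesgue) \<le> ennreal A * gagliardo s p u"
      using A(2)[OF u] i by (subst nn_integral_eq_integral[symmetric]) auto
    also have "\<dots> \<le> ennreal A * ennreal (energy u / C1)" by (intro mult_left_mono gagliardo_le_energy u) simp
    also have "\<dots> = ennreal (A / C1 * energy u)" using A C energy_nonneg[of u] by (simp add: ennreal_mult[symmetric])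
    finally have 1: "(\<integral>x. \<bar>u x\<bar> powr p \<partial>lebesgue) \<le> A / C1 * energy u"
      using A C energy_nonneg[of u] by (subst (asm) ennreal_le_iff) auto
    have "(\<integral>x. \<bar>u x\<bar> powr p \<partial>lebesgue_on \<Omega>) = (\<integral>x. indicator \<Omega> x *\<^sub>R \<bar>u x\<bar> powr p \<partial>lebesgue)"
      using \<Omega>_sets by (intro integral_restrict_space) auto
    also have "\<dots> \<le> (\<integral>x. \<bar>u x\<bar> powr p \<partial>lebesgue)"
      using i integrable_mult_indicator[OF \<Omega>_sets i] by (intro integral_mono) (auto simp: indicator_def)
    finally have 2: "(\<integral>x. \<bar>u x\<bar> powr p \<partial>lebesgue_on \<Omega>) \<le> A / C1 * energy u" using 1 by linarith
    have "mass g u \<le> (\<integral>x. max 0 B * \<bar>u x\<bar> powr p \<partial>lebesgue_on \<Omega>)"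
      unfolding mass_def
    proof (rule integral_mono_AE[OF mass_integrable[OF g(1) u]])
      show "integrable (lebesgue_on \<Omega>) (\<lambda>x. max 0 B * \<bar>u x\<bar> powr p)" using powr_integrable_\<Omega>[OF u] by simp
      show "AE x in lebesgue_on \<Omega>. g x * \<bar>u x\<bar> powr p \<le> max 0 B * \<bar>u x\<bar> powr p"
        using g(2) by eventually_elim (intro mult_right_mono, auto)
    qed
    also have "\<dots> = max 0 B * (\<integral>x. \<bar>u x\<bar> powr p \<partial>lebesgue_on \<Omega>)" by simp
    also have "\<dots> \<le> max 0 B * (A / C1 * energy u)" using 2 by (intro mult_left_mono) auto
    finally show ?thesis by (simp add: M_def mult.assoc)
  qed
  moreover have "M \<ge> 0" using A C by (simp add: M_def)
  ultimately show ?thesis using that by blast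
qed

section \<open>Translation between the principal eigenvalue and bounds of the mass by the
  energy\<close>

lemma principal_eigenvalue_eq:
  "principal_eigenvalue s p \<Omega> K g =
     (INF u \<in> W0_nonzero s p \<Omega>. if mass g u = 0 then \<infinity> else ereal (energy u / mass g u))"
  by (simp add: principal_eigenvalue_def Let_def K_norm_powr mass_def)

lemma principal_eigenvalue_ge:
  assumes m: "m > 0" and g: "AE x in lebesgue_on \<Omega>. 0 \<le> g x" and le: "\<And>v. v \<in> W \<Longrightarrow> mass g v \<le> m * energy v"
  shows "ereal (1 / m) \<le> principal_eigenvalue s p \<Omega> K g"
  unfolding principal_eigenvalue_eq
proof (rule INF_greatest)
  fix u assume "u \<in> W0_nonzero s p \<Omega>"
  then have u: "u \<in> W" by (simp add: W0_nonzero_def)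
  show "ereal (1 / m) \<le> (if mass g u = 0 then \<infinity> else ereal (energy u / mass g u))"
  proof (cases "mass g u = 0")
    case False
    then have "mass g u > 0" using mass_nonneg[OF g, of u] by simp
    then show ?thesis using le[OF u] m by (simp add: field_simps)
  qed simp
qed

lemma mass_pos_nonzero: "u \<in> W \<Longrightarrow> mass g u \<noteq> 0 \<Longrightarrow> u \<in> W0_nonzero s p \<Omega>"
proof -
  assume u: "u \<in> W" and m: "mass g u \<noteq> 0"
  have "\<not> (AE x in lebesgue. u x = 0)"
  proof
    assume "AE x in lebesgue. u x = 0"
    then have "AE x in lebesgue_on \<Omega>. u x = 0" using \<Omega>_sets by (subst AE_restrict_space_iff) (auto elim!: eventually_mono)
    then have "AE x in lebesgue_on \<Omega>. g x * \<bar>u x\<bar> powr p = 0" using p by (auto elim!: eventually_mono)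
    then have "mass g u = 0" unfolding mass_def by (rule integral_eq_zero_AE)
    then show False using m by simp
  qed
  then show ?thesis using u by (simp add: W0_nonzero_def)
qed

lemma principal_eigenvalue_extremal:
  assumes m: "m > 0" and ex: "extremal m g u" and pos: "mass g u > 0"
  shows "principal_eigenvalue s p \<Omega> K g \<le> ereal (1 / m)"
proof -
  have u: "u \<in> W" and eq: "mass g u = m * energy u" using ex by (auto simp: extremal_def)
  have "u \<in> W0_nonzero s p \<Omega>" using pos by (intro mass_pos_nonzero[OF u, of g]) simp
  then have "principal_eigenvalue s p \<Omega> K g \<le> (if mass g u = 0 then \<infinity> else ereal (energy u / mass g u))"
    unfolding principal_eigenvalue_eq by (rule INF_lower)
  also have "\<dots> = ereal (1 / m)" using pos eq by auto
  finally show ?thesis .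
qed

text \<open>The direct method for one weight. Together with the mass bound, the eigenvalue bound
  says that the infimum is exactly \<open>1 / m\<close>; a normalized minimizing sequence then has
  mass tending to \<open>m\<close>.\<close>

lemma extremal_exists:
  assumes m: "m > 0" and g: "g \<in> Linf \<Omega>" "AE x in lebesgue_on \<Omega>. 0 \<le> g x" "AE x in lebesgue_on \<Omega>. g x \<le> B"
    and le: "\<And>v. v \<in> W \<Longrightarrow> mass g v \<le> m * energy v"
    and ev: "principal_eigenvalue s p \<Omega> K g \<le> ereal (1 / m)"
  obtains v where "extremal m g v" "energy v = 1"
proof -
  \<comment> \<open>Scaling a function with quotient below \<open>1 / m + 1 / Suc n\<close> to
    energy one turns its mass into the reciprocal of the quotient.\<close>
  have "\<exists>w. w \<in> W \<and> energy w \<le> 1 \<and> 1 / (1 / m + 1 / Suc n) \<le> mass g w" for n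
  proof -
    have "principal_eigenvalue s p \<Omega> K g < ereal (1 / m + 1 / Suc n)"
      using ev by (rule le_less_trans) simp
    then obtain u where u: "u \<in> W0_nonzero s p \<Omega>"
      and lt: "(if mass g u = 0 then \<infinity> else ereal (energy u / mass g u)) < ereal (1 / m + 1 / Suc n)"
      unfolding principal_eigenvalue_eq INF_less_iff by blast
    have uW: "u \<in> W" using u by (simp add: W0_nonzero_def)
    have mu: "mass g u > 0" using lt mass_nonneg[OF g(2), of u] by (cases "mass g u = 0") auto
    then have quot: "energy u / mass g u < 1 / m + 1 / Suc n" using lt by simp
    have E: "energy u > 0" using le[OF uW] mu m by (metis less_le_trans zero_less_mult_pos)
    obtain w where w: "w \<in> W" "energy w = 1" "\<And>g. mass g w = mass g u / energy u"
      using energy_normalize[OF uW E] by metis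
    have "1 / (1 / m + 1 / Suc n) \<le> 1 / (energy u / mass g u)"
      using quot E mu m by (intro divide_left_mono mult_pos_pos add_pos_pos) auto
    also have "\<dots> = mass g w" by (simp add: w)
    finally show ?thesis using w by auto
  qed
  then obtain w where w: "\<And>n. w n \<in> W" "\<And>n. energy (w n) \<le> 1" "\<And>n. 1 / (1 / m + 1 / Suc n) \<le> mass g (w n)"
    by metis
  have "(\<lambda>n. mass g (w n)) \<longlonglongrightarrow> m"
  proof (rule tendsto_sandwich[OF _ _ _ tendsto_const])
    have "(\<lambda>n. 1 / (1 / m + 1 / real (Suc n))) \<longlonglongrightarrow> 1 / (1 / m + 0)"
      using m by (intro tendsto_intros LIMSEQ_Suc lim_1_over_n) auto
    then show "(\<lambda>n. 1 / (1 / m + 1 / real (Suc n))) \<longlonglongrightarrow> m" by simp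
    show "\<forall>\<^sub>F n in sequentially. mass g (w n) \<le> m"
    proof (intro always_eventually allI)
      fix n
      have "mass g (w n) \<le> m * energy (w n)" by (rule le[OF w(1)])
      also have "\<dots> \<le> m * 1" using m w(2) by (intro mult_left_mono) auto
      finally show "mass g (w n) \<le> m" by simp
    qed
  qed (use w(3) in simp)
  then obtain v where v: "v \<in> W" "energy v \<le> 1" "m \<le> mass g v"
    by (rule sup_mass_attained[of "\<lambda>_. g" B w m "mass g", OF g w(1,2)]) auto
  have "m * energy v \<le> m * 1" using v m by (intro mult_left_mono) auto
  then have "mass g v = m * energy v" "m * energy v = m" using v(3) le[OF v(1)] by linarith+
  then show ?thesis using that[of v] g le v m by (simp add: extremal_def)
qed

end

section \<open>Optimal weights\<close>

context nonlocal_energy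
begin

lemma mass_maximizer:
  assumes g0: "g0 \<in> Linf \<Omega>" and v: "v \<in> W"
  shows "\<exists>h\<in>rearrangement_class \<Omega> g0. \<forall>g\<in>rearrangement_class \<Omega> g0. mass g v \<le> mass h v"
proof -
  have [measurable]: "v \<in> borel_measurable (lebesgue_on \<Omega>)" by (rule W_measurable_\<Omega>[OF v])
  have fm: "(\<lambda>x. \<bar>v x\<bar> powr p) \<in> borel_measurable (lebesgue_on \<Omega>)" by measurable
  obtain h where h: "h \<in> rearrangement_class \<Omega> g0"
    and le: "\<And>g. g \<in> rearrangement_class \<Omega> g0 \<Longrightarrow>
      (\<integral>\<^sup>+x. ennreal (g x) * ennreal (\<bar>v x\<bar> powr p) \<partial>lebesgue_on \<Omega>) \<le> (\<integral>\<^sup>+x. ennreal (h x) * ennreal (\<bar>v x\<bar> powr p) \<partial>lebesgue_on \<Omega>)"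
    by (rule rearrangement_maximizer[OF \<Omega>_lmeasurable \<Omega>(2) fm _ g0]) auto
  have eq: "(\<integral>\<^sup>+x. ennreal (g x) * ennreal (\<bar>v x\<bar> powr p) \<partial>lebesgue_on \<Omega>) = ennreal (mass g v)"
    and nn: "mass g v \<ge> 0" if g: "g \<in> rearrangement_class \<Omega> g0" for g
  proof -
    have g': "g \<in> Linf \<Omega>" "AE x in lebesgue_on \<Omega>. 0 \<le> g x" using g by (auto simp: rearrangement_class_def)
    show "mass g v \<ge> 0" by (rule mass_nonneg[OF g'(2)])
    have "(\<integral>\<^sup>+x. ennreal (g x) * ennreal (\<bar>v x\<bar> powr p) \<partial>lebesgue_on \<Omega>) = (\<integral>\<^sup>+x. ennreal (g x * \<bar>v x\<bar> powr p) \<partial>lebesgue_on \<Omega>)"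
      using g'(2) by (intro nn_integral_cong_AE) (auto elim!: eventually_mono simp: ennreal_mult)
    also have "\<dots> = ennreal (mass g v)"
      unfolding mass_def using g' mass_integrable[OF g'(1) v]
      by (intro nn_integral_eq_integral) (auto elim!: eventually_mono)
    finally show "(\<integral>\<^sup>+x. ennreal (g x) * ennreal (\<bar>v x\<bar> powr p) \<partial>lebesgue_on \<Omega>) = ennreal (mass g v)" .
  qed
  have "mass g v \<le> mass h v" if g: "g \<in> rearrangement_class \<Omega> g0" for g
    using le[OF g] nn[OF h] unfolding eq[OF g] eq[OF h] by (simp add: ennreal_le_iff)
  then show ?thesis using h by blast
qed

lemma optimal_pair:
  assumes g0: "g0 \<in> Linf \<Omega>" "AE x in lebesgue_on \<Omega>. 0 \<le> g0 x" "\<not> (AE x in lebesgue_on \<Omega>. g0 x = 0)"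
  obtains m h v where "m > 0" "h \<in> rearrangement_class \<Omega> g0" "extremal m h v" "mass h v > 0"
    "\<And>g u. g \<in> rearrangement_class \<Omega> g0 \<Longrightarrow> u \<in> W \<Longrightarrow> mass g u \<le> m * energy u"
proof -
  let ?R = "rearrangement_class \<Omega> g0"
  have R: "g \<in> Linf \<Omega>" "AE x in lebesgue_on \<Omega>. 0 \<le> g x" if "g \<in> ?R" for g
    using that by (auto simp: rearrangement_class_def)
  have g0R: "g0 \<in> ?R" using g0 by (simp add: rearrangement_class_def)
  obtain B where B: "B > 0" "\<And>g. g \<in> ?R \<Longrightarrow> AE x in lebesgue_on \<Omega>. g x \<le> B"
    using rearrangement_class_bounded[OF g0(1) \<Omega>_sets] by metis
  obtain M1 where M1: "M1 \<ge> 0" "\<And>g u. g \<in> Linf \<Omega> \<Longrightarrow> AE x in lebesgue_on \<Omega>. g x \<le> B \<Longrightarrow> u \<in> W \<Longrightarrow> mass g u \<le> M1 * energy u"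
    using mass_bound[of B] by metis
  have bnd: "mass g u \<le> M1 * energy u" if "g \<in> ?R" "u \<in> W" for g u
    using M1(2) R B(2) that by blast
  define S where "S = {mass g u |g u. g \<in> ?R \<and> u \<in> W \<and> energy u \<le> 1}"
  have SI: "mass g u \<in> S" if "g \<in> ?R" "u \<in> W" "energy u \<le> 1" for g u
    unfolding S_def using that by blast
  define m where "m = Sup S"
  have bdd: "bdd_above S"
  proof (rule bdd_aboveI)
    fix x assume "x \<in> S"
    then obtain g u where gu: "x = mass g u" "g \<in> ?R" "u \<in> W" "energy u \<le> 1" by (auto simp: S_def)
    have "x \<le> M1 * energy u" using bnd gu by simp
    also have "\<dots> \<le> M1 * 1" using gu M1 by (intro mult_left_mono) auto
    finally show "x \<le> M1" by simp
  qed
  \<comment> \<open>Positive throughout \<open>\<Omega>\<close>, so its mass for the nonzero weight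
    \<open>g0\<close> is positive; this makes \<open>m\<close> positive.\<close>
  define \<phi> where "\<phi> = bump 1 \<Omega>"
  have \<phi>: "\<phi> \<in> W" unfolding \<phi>_def using \<Omega> p s by (intro bump_W0) auto
  have "mass g0 \<phi> \<noteq> 0"
  proof
    assume "mass g0 \<phi> = 0"
    then have "AE x in lebesgue_on \<Omega>. g0 x * \<bar>\<phi> x\<bar> powr p = 0"
      unfolding mass_def using g0(2) mass_integrable[OF g0(1) \<phi>]
      by (subst (asm) integral_nonneg_eq_0_iff_AE) (auto elim!: eventually_mono)
    then have "AE x in lebesgue_on \<Omega>. g0 x = 0"
    proof (rule AE_mp, intro AE_I2 impI)
      fix x assume x: "x \<in> space (lebesgue_on \<Omega>)" and z: "g0 x * \<bar>\<phi> x\<bar> powr p = 0"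
      have "\<phi> x > 0" unfolding \<phi>_def using x \<Omega> \<Omega>_not_UNIV by (intro bump_pos) auto
      then show "g0 x = 0" using z by auto
    qed
    then show False using g0(3) by simp
  qed
  then have m\<phi>: "mass g0 \<phi> > 0" using mass_nonneg[OF g0(2), of \<phi>] by simp
  then have "energy \<phi> > 0"
    using bnd[OF g0R \<phi>] energy_nonneg[of \<phi>] by (cases "energy \<phi> = 0") auto
  then obtain w where w: "w \<in> W" "energy w = 1" "\<And>g. mass g w = mass g \<phi> / energy \<phi>"
    using energy_normalize[OF \<phi>] by metis
  have wS: "mass g0 w \<in> S" using w(1,2) by (intro SI g0R) auto
  have "0 < mass g0 w" using w m\<phi> \<open>energy \<phi> > 0\<close> by simp
  also have "\<dots> \<le> m" unfolding m_def using wS bdd by (rule cSup_upper)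
  finally have m: "m > 0" .
  \<comment> \<open>By homogeneity the bound follows from the normalized case. At zero energy no
    scaling is possible, and the Poincare bound makes the mass vanish as well.\<close>
  have le: "mass g u \<le> m * energy u" if g: "g \<in> ?R" and u: "u \<in> W" for g u
  proof (cases "energy u = 0")
    case True then show ?thesis using bnd[OF g u] by simp
  next
    case False
    then have E: "energy u > 0" using energy_nonneg[of u] by simp
    obtain w where w: "w \<in> W" "energy w = 1" "\<And>g. mass g w = mass g u / energy u"
      using energy_normalize[OF u E] by metis
    have "mass g w \<in> S" using w(1,2) by (intro SI g) auto
    then have "mass g w \<le> m" unfolding m_def using bdd by (rule cSup_upper)
    then show ?thesis using w(3)[of g] E by (simp add: field_simps)
  qed
  have "\<exists>g u. g \<in> ?R \<and> u \<in> W \<and> energy u \<le> 1 \<and> m - 1 / Suc n < mass g u" for n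
  proof -
    have "m - 1 / Suc n < Sup S" by (simp add: m_def)
    then obtain x where "x \<in> S" "m - 1 / Suc n < x" using less_cSup_iff[of S, OF _ bdd] wS by blast
    then show ?thesis by (auto simp: S_def)
  qed
  then obtain g u where gu: "\<And>n. g n \<in> ?R" "\<And>n. u n \<in> W" "\<And>n. energy (u n) \<le> 1" "\<And>n. m - 1 / Suc n < mass (g n) (u n)"
    by metis
  have lim: "(\<lambda>n. mass (g n) (u n)) \<longlonglongrightarrow> m"
  proof (rule tendsto_sandwich[OF _ _ _ tendsto_const])
    have "(\<lambda>n. m - 1 / real (Suc n)) \<longlonglongrightarrow> m - 0"
      by (intro tendsto_intros LIMSEQ_Suc lim_1_over_n)
    then show "(\<lambda>n. m - 1 / real (Suc n)) \<longlonglongrightarrow> m" by simp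
    show "\<forall>\<^sub>F n in sequentially. m - 1 / real (Suc n) \<le> mass (g n) (u n)"
      using less_imp_le[OF gu(4)] by (intro always_eventually allI)
    show "\<forall>\<^sub>F n in sequentially. mass (g n) (u n) \<le> m"
    proof (intro always_eventually allI)
      fix n
      have "mass (g n) (u n) \<in> S" by (intro SI gu)
      then show "mass (g n) (u n) \<le> m" unfolding m_def using bdd by (rule cSup_upper)
    qed
  qed
  \<comment> \<open>A best weight for every function, so that \<open>mass (h v) v\<close> can serve
    as the dominating functional \<open>H\<close> and the extremal weight lies in the class.\<close>
  have "\<forall>v. \<exists>h. v \<in> W \<longrightarrow> h \<in> ?R \<and> (\<forall>g\<in>?R. mass g v \<le> mass h v)"
    using mass_maximizer[OF g0(1)] by blast
  then obtain h where h: "\<And>v. v \<in> W \<Longrightarrow> h v \<in> ?R" "\<And>v g. v \<in> W \<Longrightarrow> g \<in> ?R \<Longrightarrow> mass g v \<le> mass (h v) v"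
    by metis
  obtain v where v: "v \<in> W" "energy v \<le> 1" "m \<le> mass (h v) v"
    by (rule sup_mass_attained[where g=g and B=B and u=u and m=m and H="\<lambda>v. mass (h v) v"])
      (use gu R B h lim in auto)
  have hv: "h v \<in> ?R" using h v by simp
  have "m * energy v \<le> m * 1" using v m by (intro mult_left_mono) auto
  then have eq: "mass (h v) v = m * energy v" using v(3) le[OF hv v(1)] by linarith
  have "extremal m (h v) v" using R(1)[OF hv] v(1) eq le[OF hv] by (simp add: extremal_def)
  moreover have "mass (h v) v > 0" using v(3) m by linarith
  ultimately show ?thesis using that[OF m hv] le by blast
qed

lemma rearrangement_closure_mass:
  assumes g: "g \<in> rearrangement_closure \<Omega> g0" and g0: "g0 \<in> Linf \<Omega>"
  shows "g \<in> Linf \<Omega>" "AE x in lebesgue_on \<Omega>. 0 \<le> g x"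
    and "\<And>v c. v \<in> W \<Longrightarrow> (\<And>h. h \<in> rearrangement_class \<Omega> g0 \<Longrightarrow> mass h v \<le> c) \<Longrightarrow> mass g v \<le> c"
proof -
  show gL: "g \<in> Linf \<Omega>" by (rule rearrangement_closure_pairing(1)[OF g])
  then have gm[measurable]: "g \<in> borel_measurable (lebesgue_on \<Omega>)" by (simp add: Linf_def)
  show "mass g v \<le> c" if "v \<in> W" "\<And>h. h \<in> rearrangement_class \<Omega> g0 \<Longrightarrow> mass h v \<le> c" for v c
    using rearrangement_closure_pairing(2)[OF g, of "\<lambda>x. \<bar>v x\<bar> powr p" c] that powr_integrable_\<Omega>
    by (simp add: mass_def L1_def)
  \<comment> \<open>Pairing with this function integrates the negative part of \<open>g\<close>. The
    pairing is at most zero on the class, hence on the closure, so the negative part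
    vanishes.\<close>
  define \<phi> where "\<phi> x = (if g x < 0 then - 1 else 0 :: real)" for x
  have [measurable]: "\<phi> \<in> borel_measurable (lebesgue_on \<Omega>)" unfolding \<phi>_def by measurable
  have \<phi>: "integrable (lebesgue_on \<Omega>) \<phi>"
    by (rule finite_measure.integrable_const_bound[OF finite_\<Omega>, of _ 1]) (auto simp: \<phi>_def)
  have "(\<integral>x. g x * \<phi> x \<partial>lebesgue_on \<Omega>) \<le> 0"
  proof (rule rearrangement_closure_pairing(2)[OF g])
    show "\<phi> \<in> L1 \<Omega>" using \<phi> by (simp add: L1_def)
    fix h assume "h \<in> rearrangement_class \<Omega> g0"
    then have h0: "AE x in lebesgue_on \<Omega>. 0 \<le> h x" by (simp add: rearrangement_class_def)
    have "0 \<le> (\<integral>x. - (h x * \<phi> x) \<partial>lebesgue_on \<Omega>)"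
      using h0 by (intro integral_nonneg_AE) (auto elim!: eventually_mono simp: \<phi>_def)
    then show "(\<integral>x. h x * \<phi> x \<partial>lebesgue_on \<Omega>) \<le> 0" by simp
  qed
  moreover have nn: "0 \<le> g x * \<phi> x" for x by (simp add: \<phi>_def)
  moreover have "0 \<le> (\<integral>x. g x * \<phi> x \<partial>lebesgue_on \<Omega>)" by (intro integral_nonneg_AE AE_I2 nn)
  ultimately have "(\<integral>x. g x * \<phi> x \<partial>lebesgue_on \<Omega>) = 0" by linarith
  then have "AE x in lebesgue_on \<Omega>. g x * \<phi> x = 0"
    using nn Linf_mult_integrable[OF gL \<phi>] by (subst (asm) integral_nonneg_eq_0_iff_AE) auto
  then show "AE x in lebesgue_on \<Omega>. 0 \<le> g x"
    by (rule AE_mp) (auto intro!: AE_I2 simp: \<phi>_def split: if_splits)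
qed

text \<open>If \<open>g\<close> and \<open>u\<close> were not similarly ordered, swapping the values of \<open>g\<close> on two translates of a
  small set would give another maximizer of the mass.\<close>

lemma unique_maximizer_comonotone:
  assumes g: "g \<in> rearrangement_class \<Omega> g0" and gb: "\<And>x. 0 \<le> g x" "\<And>x. g x \<le> B"
    and u: "u \<in> W" and pos: "AE x in lebesgue_on \<Omega>. 0 < u x"
    and unique: "\<And>h. h \<in> rearrangement_class \<Omega> g0 \<Longrightarrow> mass g u \<le> mass h u \<Longrightarrow> AE x in lebesgue_on \<Omega>. h x = g x"
    and ab: "a < b"
  shows "(AE x in lebesgue_on \<Omega>. u x \<le> c \<longrightarrow> g x \<le> b) \<or> (AE x in lebesgue_on \<Omega>. c \<le> u x \<longrightarrow> a \<le> g x)"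
proof (rule ccontr)
  assume n: "\<not> ?thesis"
  have gm[measurable]: "g \<in> borel_measurable (lebesgue_on \<Omega>)" using g by (simp add: rearrangement_class_def Linf_def)
  have um[measurable]: "u \<in> borel_measurable (lebesgue_on \<Omega>)" by (rule W_measurable_\<Omega>[OF u])
  \<comment> \<open>The two sets violate the common order: on \<open>P\<close> the function is small
    and the weight large, on \<open>Q\<close> the reverse. Positivity of \<open>u\<close> on
    \<open>P\<close> makes \<open>u\<close> and \<open>|u|\<close> agree there when powers are
    compared.\<close>
  define P where "P = {x \<in> \<Omega>. 0 < u x \<and> u x \<le> c \<and> b < g x}"
  define Q where "Q = {x \<in> \<Omega>. c \<le> u x \<and> g x < a}"
  have "{x \<in> space (lebesgue_on \<Omega>). 0 < u x \<and> u x \<le> c \<and> b < g x} \<in> sets (lebesgue_on \<Omega>)"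
    "{x \<in> space (lebesgue_on \<Omega>). c \<le> u x \<and> g x < a} \<in> sets (lebesgue_on \<Omega>)" by measurable
  then have Ps: "P \<in> sets (lebesgue_on \<Omega>)" and Qs: "Q \<in> sets (lebesgue_on \<Omega>)" by (auto simp: P_def Q_def)
  then have Pl: "P \<in> sets lebesgue" and Ql: "Q \<in> sets lebesgue" using \<Omega>_sets by (auto simp: sets_restrict_space_iff)
  have AEnot: "AE x in lebesgue_on \<Omega>. x \<notin> A" if A: "A \<in> sets lebesgue" "A \<subseteq> \<Omega>" "emeasure lebesgue A = 0" for A
  proof -
    have "A \<in> null_sets (lebesgue_on \<Omega>)" using A \<Omega>_sets by (auto simp: null_sets_restrict_space)
    then show ?thesis by (rule AE_not_in)
  qed
  have Pn: "emeasure lebesgue P \<noteq> 0"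
  proof
    assume "emeasure lebesgue P = 0"
    then have "AE x in lebesgue_on \<Omega>. x \<notin> P" using Pl by (intro AEnot) (auto simp: P_def)
    then have "AE x in lebesgue_on \<Omega>. u x \<le> c \<longrightarrow> g x \<le> b" using pos
      by (rule AE_mp[OF _ AE_mp]) (auto intro!: AE_I2 simp: P_def)
    then show False using n by blast
  qed
  have Qn: "emeasure lebesgue Q \<noteq> 0"
  proof
    assume "emeasure lebesgue Q = 0"
    then have "AE x in lebesgue_on \<Omega>. x \<notin> Q" using Ql by (intro AEnot) (auto simp: Q_def)
    then have "AE x in lebesgue_on \<Omega>. c \<le> u x \<longrightarrow> a \<le> g x"
      by (rule AE_mp) (auto intro!: AE_I2 simp: Q_def)
    then show False using n by blast
  qed
  obtain A t where A: "A \<in> sets lebesgue" "emeasure lebesgue A \<noteq> 0" "A \<subseteq> P" and At: "\<And>x. x \<in> A \<Longrightarrow> x + t \<in> Q"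
    using ex_translate_overlap[OF Pl Pn Ql Qn] by metis
  have disj: "x + t \<notin> A" if "x \<in> A" for x
    using At[OF that] A(3) ab by (auto simp: P_def Q_def)
  define T where "T = swap_map A t"
  have Tm[measurable]: "T \<in> lebesgue \<rightarrow>\<^sub>M lebesgue" and Td: "distr lebesgue lebesgue T = lebesgue"
    unfolding T_def by (rule swap_map_measure_preserving[OF A(1) disj]; assumption)+
  \<comment> \<open>Extension by zero lets the swap act on the whole space. Both swapped sets lie in
    \<open>\<Omega>\<close>, so \<open>T\<close> maps \<open>\<Omega>\<close> to itself.\<close>
  define G where "G x = indicator \<Omega> x * g x" for x
  define V where "V x = indicator \<Omega> x * \<bar>u x\<bar> powr p" for x
  have Gm[measurable]: "G \<in> borel_measurable lebesgue"
    using gm \<Omega>_sets unfolding G_def by (subst (asm) borel_measurable_restrict_space_iff) (auto simp: mult.commute)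
  have Gb: "\<bar>G x\<bar> \<le> B" for x
    using gb[of x] order_trans[OF gb(1) gb(2)[of x]] by (auto simp: G_def indicator_def)
  have A\<Omega>: "x \<in> \<Omega>" "x + t \<in> \<Omega>" if "x \<in> A" for x using that A(3) At[OF that] by (auto simp: P_def Q_def)
  have T\<Omega>: "T x \<in> \<Omega> \<longleftrightarrow> x \<in> \<Omega>" for x
    using A\<Omega>[of x] A\<Omega>[of "x - t"] by (auto simp: T_def swap_map_def)
  define h where "h x = G (T x)" for x
  have hm[measurable]: "h \<in> borel_measurable lebesgue" unfolding h_def by measurable
  have hR: "h \<in> rearrangement_class \<Omega> g0"
    unfolding rearrangement_class_def Linf_def
  proof (intro CollectI conjI allI impI)
    show "h \<in> borel_measurable (lebesgue_on \<Omega>)" using hm by (intro measurable_restrict_space1)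
    show "\<exists>B. AE x in lebesgue_on \<Omega>. \<bar>h x\<bar> \<le> B" using Gb by (intro exI[of _ B]) (simp add: h_def)
    show "AE x in lebesgue_on \<Omega>. 0 \<le> h x" using gb by (simp add: h_def G_def)
    fix \<tau> :: real assume \<tau>: "0 \<le> \<tau>"
    have "{x \<in> \<Omega>. \<tau> < h x} = T -` {x \<in> \<Omega>. \<tau> < g x}"
      using T\<Omega> by (auto simp: h_def G_def)
    moreover have "{x \<in> \<Omega>. \<tau> < g x} \<in> sets lebesgue"
    proof -
      have "{x \<in> space (lebesgue_on \<Omega>). \<tau> < g x} \<in> sets (lebesgue_on \<Omega>)" by measurable
      then show ?thesis using \<Omega>_sets by (simp add: sets_restrict_space_iff)
    qed
    ultimately have "emeasure lebesgue {x \<in> \<Omega>. \<tau> < h x} = emeasure (distr lebesgue lebesgue T) {x \<in> \<Omega>. \<tau> < g x}"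
      by (simp add: emeasure_distr)
    then show "emeasure lebesgue {x \<in> \<Omega>. \<tau> < h x} = emeasure lebesgue {x \<in> \<Omega>. \<tau> < g0 x}"
      using g \<tau> unfolding Td by (simp add: rearrangement_class_def)
  qed
  have V: "integrable lebesgue V"
    using integrable_mult_indicator[OF \<Omega>_sets, of "\<lambda>x. \<bar>u x\<bar> powr p"] u by (simp add: V_def[abs_def] W0_iff)
  have "(\<integral>x. G x * V x \<partial>lebesgue) \<le> (\<integral>x. G (swap_map A t x) * V x \<partial>lebesgue)"
  proof (rule swap_map_gain[OF A(1) disj V Gm Gb])
    fix x assume x: "x \<in> A"
    have xP: "x \<in> P" and xQ: "x + t \<in> Q" using x A(3) At by auto
    have "\<bar>u x\<bar> powr p \<le> \<bar>u (x + t)\<bar> powr p"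
      using xP xQ p by (intro powr_mono2) (auto simp: P_def Q_def)
    then show "G (x + t) \<le> G x \<and> V x \<le> V (x + t)"
      using xP xQ ab by (auto simp: P_def Q_def G_def V_def)
  qed
  moreover have "(\<integral>x. G x * V x \<partial>lebesgue) = mass g u"
    unfolding mass_def using \<Omega>_sets by (subst integral_restrict_space)
      (auto intro!: Bochner_Integration.integral_cong simp: G_def V_def indicator_def)
  moreover have "(\<integral>x. G (swap_map A t x) * V x \<partial>lebesgue) = mass h u"
    unfolding mass_def using \<Omega>_sets by (subst integral_restrict_space)
      (auto intro!: Bochner_Integration.integral_cong simp: h_def V_def T_def indicator_def)
  ultimately have "AE x in lebesgue_on \<Omega>. h x = g x" by (intro unique hR) simp
  \<comment> \<open>The swap strictly changes the weight on the non-null set \<open>A\<close>: the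
    new value is below \<open>a\<close>, the old one above \<open>b\<close>. This contradicts
    uniqueness even if the mass did not increase.\<close>
  moreover have "h x \<noteq> g x" if "x \<in> A" for x
  proof -
    have "x \<in> P" "x + t \<in> Q" using that A(3) At by auto
    moreover have "h x = g (x + t)" using that A\<Omega>(2)[OF that] by (simp add: h_def T_def swap_map_def G_def)
    ultimately show ?thesis using ab by (auto simp: P_def Q_def)
  qed
  ultimately have "AE x in lebesgue_on \<Omega>. x \<notin> A" by (auto elim!: eventually_mono)
  then have "AE x in lebesgue. x \<in> \<Omega> \<longrightarrow> x \<notin> A" using \<Omega>_sets by (subst (asm) AE_restrict_space_iff) auto
  then have "AE x in lebesgue. x \<notin> A" using A\<Omega>(1) by (auto elim!: eventually_mono)
  then have "A \<in> null_sets lebesgue" using A(1) by (simp add: AE_iff_null_sets)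
  then show False using A(2) by auto
qed

theorem principal_eigenvalue_rearrangement:
  fixes g0 :: "'a \<Rightarrow> real"
  assumes g0: "g0 \<in> Linf \<Omega>" "AE x in lebesgue_on \<Omega>. 0 \<le> g0 x" "\<not> (AE x in lebesgue_on \<Omega>. g0 x = 0)"
  defines "R \<equiv> rearrangement_class \<Omega> g0" and "ev \<equiv> principal_eigenvalue s p \<Omega> K"
  shows "\<exists>h\<in>R. \<forall>g\<in>R. ev h \<le> ev g"
    and "\<And>h g. h \<in> R \<Longrightarrow> \<forall>g\<in>R. ev h \<le> ev g \<Longrightarrow> g \<in> rearrangement_closure \<Omega> g0 - R \<Longrightarrow> ev h < ev g"
    and "\<And>h u. h \<in> R \<Longrightarrow> \<forall>g\<in>R. ev h \<le> ev g \<Longrightarrow> normalized_principal_eigenfunction s p \<Omega> K h u \<Longrightarrow>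
      \<exists>\<eta>::real \<Rightarrow> real. mono \<eta> \<and> (AE x in lebesgue_on \<Omega>. h x = \<eta> (u x))"
proof -
  have R: "g \<in> Linf \<Omega>" "AE x in lebesgue_on \<Omega>. 0 \<le> g x" if "g \<in> R" for g
    using that by (auto simp: rearrangement_class_def R_def)
  obtain m h0 v0 where m: "m > 0" and h0: "h0 \<in> R" "extremal m h0 v0" "mass h0 v0 > 0"
    and le: "\<And>g u. g \<in> R \<Longrightarrow> u \<in> W \<Longrightarrow> mass g u \<le> m * energy u"
    using optimal_pair[OF g0] unfolding R_def by metis
  have ge: "ereal (1 / m) \<le> ev g" if "g \<in> R" for g
    unfolding ev_def using R(2)[OF that] le[OF that] by (intro principal_eigenvalue_ge[OF m]) auto
  have h0le: "ev h0 \<le> ereal (1 / m)" unfolding ev_def by (rule principal_eigenvalue_extremal[OF m h0(2,3)])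
  show "\<exists>h\<in>R. \<forall>g\<in>R. ev h \<le> ev g" using h0(1) h0le ge order_trans by blast
  \<comment> \<open>Every optimal weight has eigenvalue exactly \<open>1 / m\<close>, since the
    lower bound on the class is attained at \<open>h0\<close>.\<close>
  have evmin: "ev h = ereal (1 / m)" if "h \<in> R" "\<forall>g\<in>R. ev h \<le> ev g" for h
    using that h0(1) h0le ge by (meson antisym order_trans)
  have extR: "extremal m g u" if "g \<in> R" "u \<in> W" "m * energy u \<le> mass g u" for g u
    using that R(1) le[of g] by (auto simp: extremal_def intro: antisym)
  obtain B where B: "B > 0" "\<And>g. g \<in> R \<Longrightarrow> AE x in lebesgue_on \<Omega>. g x \<le> B"
    unfolding R_def using rearrangement_class_bounded[OF g0(1) \<Omega>_sets] by metis
  show "ev h < ev g" if h: "h \<in> R" "\<forall>g\<in>R. ev h \<le> ev g" and g: "g \<in> rearrangement_closure \<Omega> g0 - R" for h g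
  proof (rule ccontr)
    assume "\<not> ev h < ev g"
    then have evg: "principal_eigenvalue s p \<Omega> K g \<le> ereal (1 / m)" using evmin[OF h] by (simp add: ev_def not_less)
    have gc: "g \<in> rearrangement_closure \<Omega> g0" using g by simp
    note gp = rearrangement_closure_mass[OF gc g0(1)]
    have gle: "mass g v \<le> m * energy v" if "v \<in> W" for v
      using that le unfolding R_def by (intro gp(3)) auto
    obtain Bg where "AE x in lebesgue_on \<Omega>. \<bar>g x\<bar> \<le> Bg" using gp(1) by (auto simp: Linf_def)
    then have gB: "AE x in lebesgue_on \<Omega>. g x \<le> Bg" by (auto elim!: eventually_mono)
    obtain v where v: "extremal m g v" "energy v = 1"
      using extremal_exists[OF m gp(1,2) gB gle evg] by metis
    have vW: "v \<in> W" and mv: "mass g v = m" using v by (auto simp: extremal_def)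
    \<comment> \<open>The strong maximum principle asks for a nonnegative extremal. Taking absolute
      values keeps the mass and does not raise the energy, so extremality persists.\<close>
    define w where "w x = \<bar>v x\<bar>" for x
    have wW: "w \<in> W" unfolding w_def by (rule W0_abs[OF vW p0])
    have mw: "mass f w = mass f v" for f unfolding w_def by (rule mass_abs)
    have Ew: "energy w \<le> 1" unfolding w_def using energy_abs[OF vW] v(2) by simp
    have mE: "m * energy w \<le> m * 1" using Ew m by (intro mult_left_mono) auto
    then have "mass g w = m * energy w" using gle[OF wW] mw[of g] mv by linarith
    then have exg: "extremal m g w" using gp(1) wW gle by (simp add: extremal_def)
    \<comment> \<open>\<open>k\<close> maximizes the mass at \<open>w\<close> over the class, hence
      over the closure. So \<open>mass k w\<close> is at least \<open>mass g w\<close>, and the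
      global bound makes \<open>w\<close> extremal for both weights.\<close>
    obtain k where k: "k \<in> R" "\<forall>f\<in>R. mass f w \<le> mass k w"
      unfolding R_def using mass_maximizer[OF g0(1) wW] by blast
    have "mass g w \<le> mass k w" using k(2) unfolding R_def by (intro gp(3) wW) auto
    then have exk: "extremal m k w" using mE mw[of g] mv by (intro extR k wW) simp
    have "w \<in> W0_nonzero s p \<Omega>" using mw[of g] mv m by (intro mass_pos_nonzero[OF wW, of g]) simp
    then have "\<not> (AE x in lebesgue. w x = 0)" by (simp add: W0_nonzero_def)
    then have "AE x in lebesgue_on \<Omega>. w x \<noteq> 0"
      by (intro extremal_pos[OF exg m gp(2)]) (simp_all add: w_def)
    then have "AE x in lebesgue_on \<Omega>. g x = k x" by (rule extremal_unique_weight[OF exg exk])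
    then have "g \<in> R"
      using k(1) gp(1) \<Omega>_sets unfolding R_def by - (rule rearrangement_class_cong_AE)
    then show False using g by simp
  qed
  show "\<exists>\<eta>::real \<Rightarrow> real. mono \<eta> \<and> (AE x in lebesgue_on \<Omega>. h x = \<eta> (u x))"
    if h: "h \<in> R" "\<forall>g\<in>R. ev h \<le> ev g" and u: "normalized_principal_eigenfunction s p \<Omega> K h u" for h u
  proof -
    obtain \<mu> where \<mu>: "ereal \<mu> = ev h" and ef: "eigenfunction s p \<Omega> K h \<mu> u"
      and pos: "AE x in lebesgue_on \<Omega>. u x > 0" and one: "(\<integral>x. h x * u x powr p \<partial>lebesgue_on \<Omega>) = 1"
      using u unfolding normalized_principal_eigenfunction_def ev_def by blast
    have \<mu>m: "\<mu> = 1 / m" using \<mu> evmin[OF h] by simp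
    have uW: "u \<in> W" using ef by (simp add: eigenfunction_def W0_nonzero_def)
    have hm: "h \<in> borel_measurable (lebesgue_on \<Omega>)" using R(1)[OF h(1)] by (simp add: Linf_def)
    note um = W_measurable_\<Omega>[OF uW]
    have "mass h u = (\<integral>x. h x * u x powr p \<partial>lebesgue_on \<Omega>)"
      unfolding mass_def using pos hm um by (intro integral_cong_AE) (auto elim!: eventually_mono)
    then have mass1: "mass h u = 1" using one by simp
    \<comment> \<open>Testing the equation with \<open>u\<close> gives its energy as the eigenvalue
      times a unit mass. Thus the given eigenfunction is extremal for \<open>m\<close>.\<close>
    have "energy u = \<mu> * (\<integral>x. h x * (\<bar>u x\<bar> powr (p - 2) * u x) * u x \<partial>lebesgue_on \<Omega>)"
      using ef uW unfolding eigenfunction_def L_K_self[symmetric] by blast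
    also have "(\<integral>x. h x * (\<bar>u x\<bar> powr (p - 2) * u x) * u x \<partial>lebesgue_on \<Omega>) = mass h u"
      unfolding mass_def
    proof (rule integral_cong_AE)
      show "AE x in lebesgue_on \<Omega>. h x * (\<bar>u x\<bar> powr (p - 2) * u x) * u x = h x * \<bar>u x\<bar> powr p"
        using pos
      proof eventually_elim
        case (elim x)
        have "u x powr p = u x powr (p - 2) * u x powr 2" by (simp flip: powr_add)
        also have "u x powr 2 = u x * u x" using elim by (simp add: powr_numeral power2_eq_square)
        finally show ?case using elim by simp
      qed
    qed (use hm um in measurable)
    finally have E: "m * energy u = 1" using mass1 \<mu>m m by simp
    then have exh: "extremal m h u" using mass1 by (intro extR h uW) simp
    have unique: "AE x in lebesgue_on \<Omega>. g x = h x" if g: "g \<in> R" "mass h u \<le> mass g u" for g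
    proof -
      have "extremal m g u" using g E mass1 by (intro extR uW) auto
      moreover have "AE x in lebesgue_on \<Omega>. u x \<noteq> 0" using pos by eventually_elim simp
      ultimately show ?thesis using exh by (intro extremal_unique_weight)
    qed
    \<comment> \<open>A representative of \<open>h\<close> with bounds at every point, as the swap
      argument requires; truncation changes \<open>h\<close> only on a null set.\<close>
    define f where "f x = min B (max 0 (h x))" for x
    have fh: "AE x in lebesgue_on \<Omega>. f x = h x"
      using R(2)[OF h(1)] B(2)[OF h(1)] by eventually_elim (auto simp: f_def)
    have fL: "f \<in> Linf \<Omega>"
      using hm B(1) unfolding f_def[abs_def] Linf_def by (auto intro!: exI[of _ B] AE_I2)
    have fR: "f \<in> R" using h(1) fL fh \<Omega>_sets unfolding R_def by (rule rearrangement_class_cong_AE)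
    have mf: "mass f u = mass h u"
      unfolding mass_def using fh hm um fL by (intro integral_cong_AE) (auto elim!: eventually_mono simp: Linf_def)
    have fb: "0 \<le> f x" "f x \<le> B" for x using B(1) by (auto simp: f_def)
    have funique: "AE x in lebesgue_on \<Omega>. g x = f x" if "g \<in> rearrangement_class \<Omega> g0" "mass f u \<le> mass g u" for g
      using unique[of g] that fh unfolding R_def mf by (auto elim!: eventually_elim2)
    have "\<exists>\<eta>::real \<Rightarrow> real. mono \<eta> \<and> (AE x in lebesgue_on \<Omega>. f x = \<eta> (u x))"
    proof (rule AE_comonotone_imp_function[of _ _ B])
      show "(AE x in lebesgue_on \<Omega>. u x \<le> c \<longrightarrow> f x \<le> b) \<or> (AE x in lebesgue_on \<Omega>. c \<le> u x \<longrightarrow> a \<le> f x)" if "a < b" for a b c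
        by (rule unique_maximizer_comonotone[OF fR[unfolded R_def] fb uW pos funique that])
    qed (use fb B(1) in auto)
    then obtain \<eta> :: "real \<Rightarrow> real" where \<eta>: "mono \<eta>" "AE x in lebesgue_on \<Omega>. f x = \<eta> (u x)" by blast
    have "AE x in lebesgue_on \<Omega>. h x = \<eta> (u x)" using \<eta>(2) fh by eventually_elim simp
    then show ?thesis using \<eta>(1) by blast
  qed
qed

end

theorem theorem3p1:
  fixes \<Omega> :: "'a::euclidean_space set"
    and p s C1 C2 :: real
    and K :: "'a \<Rightarrow> 'a \<Rightarrow> real"
    and g0 :: "'a \<Rightarrow> real"
  assumes "DIM('a) \<ge> 2"
    and "open \<Omega>" "connected \<Omega>" "\<Omega> \<noteq> {}" "bounded \<Omega>" "C11_boundary \<Omega>"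
    and "p > 1" "0 < s" "s < 1"
    and "(\<lambda>(x, y). K x y) \<in> borel_measurable lebesgue"
    and "0 < C1" "C1 \<le> C2"
    and "AE (x, y) in lebesgue. K x y = K y x \<and>
           C1 \<le> K x y * norm (x - y) powr (real DIM('a) + p * s) \<and>
           K x y * norm (x - y) powr (real DIM('a) + p * s) \<le> C2"
    and "g0 \<in> Linf \<Omega>" "AE x in lebesgue_on \<Omega>. g0 x \<ge> 0"
    and "\<not> (AE x in lebesgue_on \<Omega>. g0 x = 0)"
  shows
    "(\<exists>gh \<in> rearrangement_class \<Omega> g0. \<forall>g \<in> rearrangement_class \<Omega> g0.
        principal_eigenvalue s p \<Omega> K gh \<le> principal_eigenvalue s p \<Omega> K g)
     \<and>
     (\<forall>gh \<in> rearrangement_class \<Omega> g0.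
        (\<forall>g \<in> rearrangement_class \<Omega> g0.
           principal_eigenvalue s p \<Omega> K gh \<le> principal_eigenvalue s p \<Omega> K g) \<longrightarrow>
        (\<forall>g \<in> rearrangement_closure \<Omega> g0 - rearrangement_class \<Omega> g0.
           principal_eigenvalue s p \<Omega> K gh < principal_eigenvalue s p \<Omega> K g))
     \<and>
     (\<forall>gh \<in> rearrangement_class \<Omega> g0.
        (\<forall>g \<in> rearrangement_class \<Omega> g0.
           principal_eigenvalue s p \<Omega> K gh \<le> principal_eigenvalue s p \<Omega> K g) \<longrightarrow>
        (\<forall>u. normalized_principal_eigenfunction s p \<Omega> K gh u \<longrightarrow>
           (\<exists>\<eta> :: real \<Rightarrow> real. mono \<eta> \<and> (AE x in lebesgue_on \<Omega>. gh x = \<eta> (u x)))))"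
proof -
  have "AE (x, y) in lebesgue. C1 \<le> K x y * norm (x - y) powr (real DIM('a) + p * s) \<and>
           K x y * norm (x - y) powr (real DIM('a) + p * s) \<le> C2"
    using assms(13) by (auto elim!: eventually_mono)
  then interpret nonlocal_energy \<Omega> p s C1 C2 K
    using assms by unfold_locales auto
  note main = principal_eigenvalue_rearrangement[OF assms(14-16)]
  show ?thesis using main by (intro conjI ballI impI allI) blast+
qed

end
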